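(* In $(S^2\times S^2,\omega\oplus\omega)$, the antidiagonal sphere $\overline{\Delta}$ and the Clifford torus $\mathbb{T}_{\mathrm{Clif}}$ are smoothly cobordant, but they are not Lagrangian cobordant.
   Context: All manifolds and maps are smooth. $\omega$ is a Euclidean area form on $S^2$. The antidiagonal sphere is $\overline{\Delta}=\{(x,-x)\mid x\in S^2\}\subset S^2\times S^2$, where $x\mapsto -x$ is the antipodal map; the Clifford torus is $\mathbb{T}_{\mathrm{Clif}}=S^1\times S^1\subset S^2\times S^2$, the product of the equators in each $S^2$-factor. Both are Lagrangian submanifolds. Two closed $n$-manifolds $X_1,X_2$ are (smoothly) cobordant if there is a compact manifold $Y$ (a cobordism) with $\partial Y=X_1\sqcup X_2$ (no orientations required). Two closed Lagrangians $L,L'$ in a symplectic manifold $(M,\Omega)$ are Lagrangian cobordant if there exist a smooth (compact) cobordism $V$ between $L$ and $L'$ and a Lagrangian embedding $i\colon V\hookrightarrow \big(([0,1]\times\mathbb{R})\times M,(dx\wedge dy)\oplus\Omega\big)$ such that for some $\varepsilon>0$, identifying $V$ with its image $i(V)$, $V\cap([0,\varepsilon)\times\mathbb{R}\times M)=[0,\varepsilon)\times\{0\}\times L$ and $V\cap((1-\varepsilon,1]\times\mathbb{R}\times M)=(1-\varepsilon,1]\times\{0\}\times L'$. *)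

theory Defs
  imports "HOL-Analysis.Analysis"
begin

subsection \<open>Smooth maps between subsets of Euclidean spaces\<close>

text \<open>\<open>Ck_on k U f\<close> is meant for open \<open>U\<close>: all iterated directional derivatives of
  \<open>f\<close> of order at most \<open>k\<close> exist and are continuous on \<open>U\<close>.\<close>

primrec Ck_on :: "nat \<Rightarrow> 'a::euclidean_space set \<Rightarrow> ('a \<Rightarrow> 'b::euclidean_space) \<Rightarrow> bool" where
  "Ck_on 0 U f \<longleftrightarrow> continuous_on U f"
| "Ck_on (Suc k) U f \<longleftrightarrow>
     (\<forall>x\<in>U. f differentiable (at x)) \<and>
     (\<forall>v. Ck_on k U (\<lambda>x. frechet_derivative f (at x) v))"

text \<open>On an arbitrary subset, smoothness means local extendability to a smooth map on an
  open set of the surrounding space.\<close>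

definition smooth_on :: "'a::euclidean_space set \<Rightarrow> ('a \<Rightarrow> 'b::euclidean_space) \<Rightarrow> bool" where
  "smooth_on S f \<longleftrightarrow>
     (\<forall>x\<in>S. \<exists>U g. open U \<and> x \<in> U \<and> (\<forall>k. Ck_on k U g) \<and> (\<forall>y\<in>U \<inter> S. g y = f y))"


subsection \<open>Smooth manifolds with boundary\<close>

text \<open>A chart is a pair of its domain and its coordinate map; the values of the coordinate map
  outside the domain are irrelevant. The dimension is that of the model space \<open>'m\<close>.\<close>

type_synonym ('a, 'm) chart = "'a set \<times> ('a \<Rightarrow> 'm)"
type_synonym ('a, 'm) manifold = "'a topology \<times> ('a, 'm) chart set"

text \<open>The parameter \<open>H\<close> is the local model: \<open>UNIV\<close> for manifolds without boundary, and
  \<open>half_space\<close> for manifolds with boundary.\<close>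

definition smooth_manifold :: "'m::euclidean_space set \<Rightarrow> ('a, 'm) manifold \<Rightarrow> bool" where
  "smooth_manifold H M \<longleftrightarrow>
     (case M of (X, A) \<Rightarrow>
        Hausdorff_space X \<and> second_countable X \<and>
        topspace X = (\<Union>(U, \<phi>)\<in>A. U) \<and>
        (\<forall>(U, \<phi>)\<in>A.
           openin X U \<and> openin (top_of_set H) (\<phi> ` U) \<and>
           homeomorphic_map (subtopology X U) (top_of_set (\<phi> ` U)) \<phi>) \<and>
        (\<forall>(U, \<phi>)\<in>A. \<forall>(V, \<psi>)\<in>A. smooth_on (\<phi> ` (U \<inter> V)) (\<psi> \<circ> inv_into U \<phi>)))"

definition half_space :: "(real \<times> 'e::euclidean_space) set" where
  "half_space = {x. 0 \<le> fst x}"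

definition closed_manifold :: "('a, 'm::euclidean_space) manifold \<Rightarrow> bool" where
  "closed_manifold M \<longleftrightarrow> smooth_manifold UNIV M \<and> compact_space (fst M)"

definition compact_manifold_with_boundary ::
    "('a, real \<times> 'e::euclidean_space) manifold \<Rightarrow> bool" where
  "compact_manifold_with_boundary M \<longleftrightarrow> smooth_manifold half_space M \<and> compact_space (fst M)"

definition boundary_points :: "('a, real \<times> 'e::euclidean_space) manifold \<Rightarrow> 'a set" where
  "boundary_points M = {p. \<exists>(U, \<phi>)\<in>snd M. p \<in> U \<and> fst (\<phi> p) = 0}"

definition boundary_manifold ::
    "('a, real \<times> 'e::euclidean_space) manifold \<Rightarrow> ('a, 'e) manifold" where
  "boundary_manifold M =
     (subtopology (fst M) (boundary_points M),
      (\<lambda>(U, \<phi>). (U \<inter> boundary_points M, snd \<circ> \<phi>)) ` snd M)"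

definition open_submanifold :: "('a, 'm) manifold \<Rightarrow> 'a set \<Rightarrow> ('a, 'm) manifold" where
  "open_submanifold M W = (subtopology (fst M) W, (\<lambda>(U, \<phi>). (U \<inter> W, \<phi>)) ` snd M)"

definition smooth_map ::
    "('a, 'm::euclidean_space) manifold \<Rightarrow> ('b, 'n::euclidean_space) manifold \<Rightarrow> ('a \<Rightarrow> 'b) \<Rightarrow> bool"
  where
  "smooth_map M N f \<longleftrightarrow>
     continuous_map (fst M) (fst N) f \<and>
     (\<forall>(U, \<phi>)\<in>snd M. \<forall>(V, \<psi>)\<in>snd N.
        smooth_on (\<phi> ` (U \<inter> f -` V)) (\<psi> \<circ> f \<circ> inv_into U \<phi>))"

definition diffeomorphic ::
    "('a, 'm::euclidean_space) manifold \<Rightarrow> ('b, 'm) manifold \<Rightarrow> bool" where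
  "diffeomorphic M N \<longleftrightarrow>
     (\<exists>f g. homeomorphic_maps (fst M) (fst N) f g \<and> smooth_map M N f \<and> smooth_map N M g)"

text \<open>The induced structure on an embedded submanifold of a Euclidean space. The atlas consists of
  all diffeomorphisms from relatively open subsets onto open subsets of \<open>'m\<close>; hence \<open>S\<close> is an
  embedded submanifold of dimension \<open>DIM('m)\<close> iff
  \<open>smooth_manifold UNIV (submanifold S :: ('b, 'm) manifold)\<close>.\<close>

definition submanifold :: "'b::euclidean_space set \<Rightarrow> ('b, 'm::euclidean_space) manifold" where
  "submanifold S =
     (top_of_set S,
      {(U, \<phi>). openin (top_of_set S) U \<and> inj_on \<phi> U \<and> open (\<phi> ` U) \<and>
               smooth_on U \<phi> \<and> smooth_on (\<phi> ` U) (inv_into U \<phi>)})"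


subsection \<open>Cobordisms\<close>

text \<open>The boundary of \<open>Y\<close> is the disjoint union of \<open>X1\<close> and \<open>X2\<close>, up to diffeomorphism.\<close>

definition cobordism ::
    "('y, real \<times> 'e::euclidean_space) manifold \<Rightarrow> ('a, 'e) manifold \<Rightarrow> ('b, 'e) manifold \<Rightarrow> bool"
  where
  "cobordism Y X1 X2 \<longleftrightarrow>
     compact_manifold_with_boundary Y \<and> closed_manifold X1 \<and> closed_manifold X2 \<and>
     (\<exists>B1 B2.
        B1 \<union> B2 = boundary_points Y \<and> B1 \<inter> B2 = {} \<and>
        openin (fst (boundary_manifold Y)) B1 \<and> openin (fst (boundary_manifold Y)) B2 \<and>
        diffeomorphic (open_submanifold (boundary_manifold Y) B1) X1 \<and>
        diffeomorphic (open_submanifold (boundary_manifold Y) B2) X2)"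

text \<open>The points of \<open>Y\<close> are taken from the type \<open>real \<times> 'e\<close>, but its topology and atlas are
  arbitrary. This is no restriction: a second countable manifold has at most continuum many points,
  so every abstract manifold modelled on \<open>real \<times> 'e\<close> has a copy on a subset of this type.\<close>

definition cobordant ::
    "('a, 'e::euclidean_space) manifold \<Rightarrow> ('b, 'e) manifold \<Rightarrow> bool" where
  "cobordant X1 X2 \<longleftrightarrow>
     (\<exists>Y :: (real \<times> 'e, real \<times> 'e) manifold. cobordism Y X1 X2)"


subsection \<open>Lagrangian cobordisms\<close>

text \<open>Symplectic manifolds are embedded submanifolds \<open>M\<close> of a Euclidean space with a 2-form given
  by its values \<open>\<Omega> p u v\<close> for \<open>p \<in> M\<close> and \<open>u\<close>, \<open>v\<close> tangent to \<open>M\<close> at \<open>p\<close>.\<close>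

type_synonym 'a form2 = "'a \<Rightarrow> 'a \<Rightarrow> 'a \<Rightarrow> real"

definition sum_form :: "'a form2 \<Rightarrow> 'b form2 \<Rightarrow> ('a \<times> 'b) form2" where
  "sum_form \<alpha> \<beta> p u v = \<alpha> (fst p) (fst u) (fst v) + \<beta> (snd p) (snd u) (snd v)"

definition dx_dy :: "(real \<times> real) form2" where
  "dx_dy p u v = fst u * snd v - snd u * fst v"

definition tangent_space :: "'b::euclidean_space set \<Rightarrow> 'b \<Rightarrow> 'b set" where
  "tangent_space M p =
     {v. \<exists>c e. 0 < (e::real) \<and> smooth_on {-e<..<e} c \<and> c ` {-e<..<e} \<subseteq> M \<and> c 0 = p \<and>
               (c has_vector_derivative v) (at 0)}"

definition lagrangian_subspace ::
    "'b::euclidean_space set \<Rightarrow> ('b \<Rightarrow> 'b \<Rightarrow> real) \<Rightarrow> 'b set \<Rightarrow> bool" where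
  "lagrangian_subspace T \<sigma> W \<longleftrightarrow>
     subspace W \<and> W \<subseteq> T \<and> (\<forall>u\<in>W. \<forall>v\<in>W. \<sigma> u v = 0) \<and> 2 * dim W = dim T"

text \<open>Lagrangian embeddings into \<open>([0,1] \<times> \<real>) \<times> M\<close> with the form \<open>(dx \<and> dy) \<oplus> \<Omega>\<close>. At the boundary
  of the strip the tangent space of the target is the full \<open>\<real>\<^sup>2 \<times> T M\<close>.\<close>

definition lagrangian_embedding_strip ::
    "('v, 'm::euclidean_space) manifold \<Rightarrow> 'b::euclidean_space set \<Rightarrow> 'b form2 \<Rightarrow>
     ('v \<Rightarrow> (real \<times> real) \<times> 'b) \<Rightarrow> bool" where
  "lagrangian_embedding_strip V M \<Omega> i \<longleftrightarrow>
     i ` topspace (fst V) \<subseteq> ({0..1} \<times> UNIV) \<times> M \<and>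
     embedding_map (fst V) euclidean i \<and>
     (\<forall>(U, \<phi>)\<in>snd V.
        smooth_on (\<phi> ` U) (i \<circ> inv_into U \<phi>) \<and>
        (\<forall>p\<in>U. \<exists>D.
           ((i \<circ> inv_into U \<phi>) has_derivative D) (at (\<phi> p) within \<phi> ` U) \<and> inj D \<and>
           lagrangian_subspace (UNIV \<times> tangent_space M (snd (i p)))
             (sum_form dx_dy \<Omega> (i p)) (range D)))"

text \<open>The first argument only fixes the model space, hence the dimension, of \<open>L\<close> and \<open>L'\<close>.
  As in \<open>cobordant\<close>, the underlying type of \<open>V\<close> is no restriction.\<close>

definition lagrangian_cobordant ::
    "'e::euclidean_space itself \<Rightarrow> 'b::euclidean_space set \<Rightarrow> 'b form2 \<Rightarrow> 'b set \<Rightarrow> 'b set \<Rightarrow> bool"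
  where
  "lagrangian_cobordant _ M \<Omega> L L' \<longleftrightarrow>
     (\<exists>(V :: (real \<times> 'e, real \<times> 'e) manifold) i \<epsilon>.
        cobordism V (submanifold L) (submanifold L') \<and>
        lagrangian_embedding_strip V M \<Omega> i \<and>
        0 < \<epsilon> \<and>
        i ` topspace (fst V) \<inter> ({0..<\<epsilon>} \<times> UNIV) \<times> M = ({0..<\<epsilon>} \<times> {0}) \<times> L \<and>
        i ` topspace (fst V) \<inter> ({1-\<epsilon><..1} \<times> UNIV) \<times> M = ({1-\<epsilon><..1} \<times> {0}) \<times> L')"


subsection \<open>The product of two spheres\<close>

abbreviation S2 :: "(real^3) set" where
  "S2 \<equiv> sphere 0 1"

text \<open>The rotation invariant area forms on the unit sphere: the standard one is
  \<open>p \<bullet> (u \<times> v)\<close>, the factor \<open>c \<noteq> 0\<close> accounts for the choice of normalisation and orientation.\<close>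

definition area_form :: "real \<Rightarrow> (real^3) form2" where
  "area_form c p u v = c * (p \<bullet> cross3 u v)"

definition antidiagonal :: "((real^3) \<times> (real^3)) set" where
  "antidiagonal = {(x, - x) | x. x \<in> S2}"

definition equator :: "(real^3) set" where
  "equator = {x \<in> S2. x $ 3 = 0}"

definition clifford_torus :: "((real^3) \<times> (real^3)) set" where
  "clifford_torus = equator \<times> equator"

end

theory Submission
  imports Defs
begin

text \<open>The two surfaces bound: the antidiagonal is a sphere and bounds a ball, the Clifford torus bounds a
  solid torus, so a ball and a disjoint solid torus form a cobordism (\<open>antidiagonal_cobordant_clifford_torus\<close>).

  The obstruction to a Lagrangian cobordism is found in homology mod 2. A cobordism inside \<open>([0,1] \<times> \<real>) \<times> (S2 \<times> S2)\<close> would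
  make the two ends homologous mod 2 in \<open>S2 \<times> S2\<close>, but the projection \<open>g\<close> to the second sphere has degree 1
  on the antidiagonal and misses the north pole on the torus. In elementary terms: let \<open>x\<close> be the
  coordinate in \<open>[0,1]\<close> and consider the map \<open>F = (2 + x) g\<close> from the cobordism, of dimension 3, to \<open>\<real>\<^sup>3\<close>.
  Over points of norm slightly above 2 near the north pole, \<open>F\<close> has exactly one preimage, in the collar
  over the antidiagonal. Shrinking \<open>F\<close> in the middle part of the cobordism, where \<open>x\<close> stays away from
  0 and 1, removes this preimage: close to \<open>x = 0\<close> the map is too short, in the middle it has been
  shortened, and close to \<open>x = 1\<close> the value of \<open>g\<close> is on the equator. The shrinking is done in
  finitely many steps, each supported in one chart, and in one chart the parity of the number of
  preimages of almost every point does not change (\<open>local_parity\<close>), which is a contradiction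
  (\<open>no_embedded_cobordism\<close>).

  The parity statement comes from degree theory in \<open>\<real>\<^sup>3\<close>. For a test function \<open>\<phi> = \<partial>\<^sub>1 \<psi>\<close> the function
  \<open>\<phi>(G) det DG\<close> is the divergence of a vector field depending on \<open>G\<close> pointwise, so its integral does not
  change under compactly supported changes of \<open>G\<close> (\<open>degree_integral_invariant\<close>), while near a
  regular value it counts preimages with signs (\<open>signed_preimage_count\<close>). Degrees are only compared
  within one chart and signs are dropped before passing to the next one, so the cobordism may be
  non-orientable.

  Charts in the interior of the cobordism are available over \<open>0 < x < 1\<close> because the boundary
  lies exactly over \<open>x = 0\<close> and \<open>x = 1\<close>: the boundary in the two collars is found by invariance of domain,
  and there is no room for more since both ends are connected (\<open>interior_of_strip_is_interior\<close>).\<close>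

section \<open>Calculus of \<open>C\<^sup>k\<close> maps\<close>

lemma Ck_on_cong:
  assumes "open U" "\<And>x. x \<in> U \<Longrightarrow> f x = g x" "Ck_on k U f"
  shows "Ck_on k U g"
  using assms(2,3)
proof (induction k arbitrary: f g)
  case 0
  then show ?case by (auto cong: continuous_on_cong)
next
  case (Suc k)
  have diff: "g differentiable (at x)" if "x \<in> U" for x
  proof -
    have "(f has_derivative frechet_derivative f (at x)) (at x)"
      using Suc.prems(2) that by (simp add: frechet_derivative_works[symmetric])
    then have "(g has_derivative frechet_derivative f (at x)) (at x)"
      by (rule has_derivative_transform_within_open[OF _ assms(1) that]) (rule Suc.prems(1))
    then show ?thesis unfolding differentiable_def by blast
  qed
  have "frechet_derivative f (at x) = frechet_derivative g (at x)" if "x \<in> U" for x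
    using Suc.prems that assms(1) by (intro frechet_derivative_transform_within_open[of f x U g]) auto
  then have "Ck_on k U (\<lambda>x. frechet_derivative g (at x) v)" for v
    by (rule_tac f = "\<lambda>x. frechet_derivative f (at x) v" in Suc.IH) (use Suc.prems(2) in simp_all)
  then show ?case using diff by simp
qed

lemma Ck_on_subset: "Ck_on k U f \<Longrightarrow> V \<subseteq> U \<Longrightarrow> Ck_on k V f"
  by (induction k arbitrary: f) (auto intro: continuous_on_subset)

lemma Ck_on_local:
  assumes "\<And>x. x \<in> U \<Longrightarrow> \<exists>W. open W \<and> x \<in> W \<and> Ck_on k W f"
  shows "Ck_on k U f"
  using assms
proof (induction k arbitrary: f)
  case 0
  then show ?case
    by (force intro: continuous_at_imp_continuous_on simp: continuous_on_eq_continuous_at)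
next
  case (Suc k)
  then show ?case by (simp, meson Suc.IH)
qed

lemma Ck_on_Suc_lower: "Ck_on (Suc k) U f \<Longrightarrow> Ck_on k U f"
proof (induction k arbitrary: f)
  case 0
  then show ?case
    by (auto intro!: differentiable_imp_continuous_on
        simp: differentiable_on_def differentiable_at_withinI)
next
  case (Suc k)
  have "Ck_on k U (\<lambda>x. frechet_derivative f (at x) v)" for v
    using Suc.prems by (intro Suc.IH) simp
  then show ?case using Suc.prems by simp
qed

lemma Ck_on_lower: "Ck_on k U f \<Longrightarrow> j \<le> k \<Longrightarrow> Ck_on j U f"
  by (induction k) (use Ck_on_Suc_lower le_Suc_eq in blast)+

lemma Ck_on_const: "Ck_on k U (\<lambda>x. c)"
proof (induction k arbitrary: c)
  case (Suc k)
  have "frechet_derivative (\<lambda>x. c) (at x) = (\<lambda>v. 0)" for x :: 'a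
    by (rule frechet_derivative_at[symmetric]) simp
  then show ?case using Suc by simp
qed simp

lemma Ck_on_bounded_linear:
  assumes "bounded_linear L"
  shows "Ck_on k U L"
proof (cases k)
  case 0
  then show ?thesis by (simp add: assms linear_continuous_on)
next
  case (Suc n)
  have "(L has_derivative L) (at x)" for x
    by (rule bounded_linear_imp_has_derivative[OF assms])
  then have "L differentiable at x \<and> frechet_derivative L (at x) = L" for x
    by (metis differentiable_def frechet_derivative_at)
  then show ?thesis using Suc by (simp add: Ck_on_const)
qed

lemma Ck_on_linear: "linear L \<Longrightarrow> Ck_on k U L"
  by (simp add: Ck_on_bounded_linear linear_conv_bounded_linear)

lemma Ck_on_ident: "Ck_on k U (\<lambda>x. x)"
  by (rule Ck_on_bounded_linear) (rule bounded_linear_ident)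

lemma Ck_on_add:
  assumes "open U" "Ck_on k U f" "Ck_on k U g"
  shows "Ck_on k U (\<lambda>x. f x + g x)"
  using assms(2,3)
proof (induction k arbitrary: f g)
  case 0
  then show ?case by (auto intro: continuous_intros)
next
  case (Suc k)
  have "frechet_derivative (\<lambda>x. f x + g x) (at x) =
      (\<lambda>v. frechet_derivative f (at x) v + frechet_derivative g (at x) v)" if "x \<in> U" for x
    using Suc.prems that
    by (intro frechet_derivative_at[symmetric] has_derivative_add)
       (auto simp: frechet_derivative_works[symmetric])
  moreover have "Ck_on k U (\<lambda>x. frechet_derivative f (at x) v + frechet_derivative g (at x) v)" for v
    using Suc by simp
  ultimately have "Ck_on k U (\<lambda>x. frechet_derivative (\<lambda>x. f x + g x) (at x) v)" for v
    by (auto intro: Ck_on_cong[OF assms(1)])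
  then show ?case using Suc.prems by simp
qed

lemma Ck_on_sum:
  assumes "open U" "\<And>i. i \<in> I \<Longrightarrow> Ck_on k U (f i)"
  shows "Ck_on k U (\<lambda>x. \<Sum>i\<in>I. f i x)"
  using assms(2)
  by (induction I rule: infinite_finite_induct) (auto simp: Ck_on_const intro!: Ck_on_add[OF assms(1)])

lemma Ck_on_bounded_bilinear:
  assumes "bounded_bilinear B" "open U" "Ck_on k U f" "Ck_on k U g"
  shows "Ck_on k U (\<lambda>x. B (f x) (g x))"
  using assms(3,4)
proof (induction k arbitrary: f g)
  case 0
  then show ?case by (auto intro: bounded_bilinear.continuous_on[OF assms(1)])
next
  case (Suc k)
  have D: "((\<lambda>x. B (f x) (g x)) has_derivative
       (\<lambda>v. B (f x) (frechet_derivative g (at x) v) + B (frechet_derivative f (at x) v) (g x))) (at x)"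
    if "x \<in> U" for x
    using Suc.prems that by (intro bounded_bilinear.FDERIV[OF assms(1)])
       (auto simp: frechet_derivative_works[symmetric])
  have "Ck_on k U (\<lambda>x. B (f x) (frechet_derivative g (at x) v) + B (frechet_derivative f (at x) v) (g x))"
    for v using Suc.prems Ck_on_Suc_lower[OF Suc.prems(1)] Ck_on_Suc_lower[OF Suc.prems(2)]
    by (intro Ck_on_add assms Suc.IH) auto
  then have "Ck_on k U (\<lambda>x. frechet_derivative (\<lambda>x. B (f x) (g x)) (at x) v)" for v
    by (rule Ck_on_cong[OF assms(2), rotated]) (simp add: frechet_derivative_at[OF D, symmetric])
  moreover have "(\<lambda>x. B (f x) (g x)) differentiable at x" if "x \<in> U" for x
    using D[OF that] by (auto simp: differentiable_def)
  ultimately show ?case by simp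
qed

lemmas Ck_on_scaleR = Ck_on_bounded_bilinear[OF bounded_bilinear_scaleR]
lemmas Ck_on_mult = Ck_on_bounded_bilinear[OF bounded_bilinear_mult]
lemmas Ck_on_inner = Ck_on_bounded_bilinear[OF bounded_bilinear_inner]

text \<open>In the chain rule the derivative of \<open>g\<close> is applied to a vector that depends on the point;
  expanding that vector in a basis leaves products of maps with one derivative less.\<close>

lemma Ck_on_compose:
  fixes f :: "'a::euclidean_space \<Rightarrow> 'b::euclidean_space" and g :: "'b \<Rightarrow> 'c::euclidean_space"
  assumes "open U" "Ck_on k U f" "Ck_on k V g" "f ` U \<subseteq> V"
  shows "Ck_on k U (\<lambda>x. g (f x))"
  using assms(2,3)
proof (induction k arbitrary: g)
  case 0
  then show ?case using assms(4) by (auto intro: continuous_on_compose2)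
next
  case (Suc k)
  let ?D = "\<lambda>x v. \<Sum>b\<in>Basis. (frechet_derivative f (at x) v \<bullet> b) *\<^sub>R frechet_derivative g (at (f x)) b"
  have D: "((\<lambda>x. g (f x)) has_derivative ?D x) (at x)" if x: "x \<in> U" for x
  proof -
    have gd: "g differentiable at (f x)" and fd: "f differentiable at x"
      using Suc.prems x assms(4) by auto
    have "((\<lambda>x. g (f x)) has_derivative
        (\<lambda>v. frechet_derivative g (at (f x)) (frechet_derivative f (at x) v))) (at x)"
      using diff_chain_at[of f _ x g] fd gd by (auto simp: frechet_derivative_works o_def)
    moreover have rep: "frechet_derivative g (at (f x)) w =
        (\<Sum>b\<in>Basis. (w \<bullet> b) *\<^sub>R frechet_derivative g (at (f x)) b)" for w
    proof -
      have "linear (frechet_derivative g (at (f x)))" using gd by (rule linear_frechet_derivative)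
      then have "frechet_derivative g (at (f x)) (\<Sum>b\<in>Basis. (w \<bullet> b) *\<^sub>R b) =
          (\<Sum>b\<in>Basis. (w \<bullet> b) *\<^sub>R frechet_derivative g (at (f x)) b)"
        by (simp add: linear_sum linear_cmul)
      then show ?thesis by (simp add: euclidean_representation)
    qed
    moreover have "(\<lambda>v. frechet_derivative g (at (f x)) (frechet_derivative f (at x) v)) = ?D x"
      by (rule ext) (rule rep)
    ultimately show ?thesis by metis
  qed
  have "Ck_on k U (\<lambda>x. ?D x v)" for v
    using Suc.prems Ck_on_Suc_lower[OF Suc.prems(1)]
    by (intro Ck_on_sum Ck_on_scaleR Ck_on_inner assms Suc.IH Ck_on_const) auto
  then have "Ck_on k U (\<lambda>x. frechet_derivative (\<lambda>x. g (f x)) (at x) v)" for v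
    by (rule Ck_on_cong[OF assms(1), rotated]) (simp add: frechet_derivative_at[OF D, symmetric])
  moreover have "(\<lambda>x. g (f x)) differentiable at x" if "x \<in> U" for x
    using D[OF that] by (auto simp: differentiable_def)
  ultimately show ?case by simp
qed

lemma Ck_on_linear_compose:
  assumes "open U" "linear L" "Ck_on k U f"
  shows "Ck_on k U (\<lambda>x. L (f x))"
  using Ck_on_compose[OF assms(1,3) Ck_on_linear[OF assms(2)]] by blast

lemma Ck_on_fst: "open U \<Longrightarrow> Ck_on k U f \<Longrightarrow> Ck_on k U (\<lambda>x. fst (f x))"
  by (rule Ck_on_linear_compose) (auto intro: linear_fst)

lemma Ck_on_snd: "open U \<Longrightarrow> Ck_on k U f \<Longrightarrow> Ck_on k U (\<lambda>x. snd (f x))"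
  by (rule Ck_on_linear_compose) (auto intro: linear_snd)

lemma Ck_on_Pair:
  assumes "open U" "Ck_on k U f" "Ck_on k U g"
  shows "Ck_on k U (\<lambda>x. (f x, g x))"
proof -
  have "Ck_on k U (\<lambda>x. (f x, 0) + (0, g x))"
    by (intro Ck_on_add assms
        Ck_on_linear_compose[OF assms(1) _ assms(2), where L = "\<lambda>y. (y, 0)"]
        Ck_on_linear_compose[OF assms(1) _ assms(3), where L = "\<lambda>y. (0, y)"])
       (auto intro!: linearI)
  then show ?thesis by simp
qed

lemma Ck_on_nth: "open U \<Longrightarrow> Ck_on k U f \<Longrightarrow> Ck_on k U (\<lambda>x. f x $ i)"
  by (rule Ck_on_linear_compose) (auto intro!: linearI)

lemma Ck_on_vector_2:
  assumes "open U" "Ck_on k U f" "Ck_on k U g"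
  shows "Ck_on k U (\<lambda>x. vector [f x, g x] :: real^2)"
proof -
  have "Ck_on k U (\<lambda>x. f x *\<^sub>R vector [1, 0] + g x *\<^sub>R vector [0, 1] :: real^2)"
    by (intro Ck_on_add Ck_on_scaleR assms Ck_on_const)
  moreover have "(\<lambda>x. f x *\<^sub>R vector [1, 0] + g x *\<^sub>R vector [0, 1] :: real^2) = (\<lambda>x. vector [f x, g x])"
    by (simp add: fun_eq_iff vec_eq_iff forall_2)
  ultimately show ?thesis by simp
qed

lemma Ck_on_vector_3:
  assumes "open U" "Ck_on k U f" "Ck_on k U g" "Ck_on k U h"
  shows "Ck_on k U (\<lambda>x. vector [f x, g x, h x] :: real^3)"
proof -
  have "Ck_on k U (\<lambda>x. f x *\<^sub>R vector [1, 0, 0] + g x *\<^sub>R vector [0, 1, 0] + h x *\<^sub>R vector [0, 0, 1] :: real^3)"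
    by (intro Ck_on_add Ck_on_scaleR assms Ck_on_const)
  moreover have "(\<lambda>x. f x *\<^sub>R vector [1, 0, 0] + g x *\<^sub>R vector [0, 1, 0] + h x *\<^sub>R vector [0, 0, 1] :: real^3) =
      (\<lambda>x. vector [f x, g x, h x])"
    by (simp add: fun_eq_iff vec_eq_iff forall_3)
  ultimately show ?thesis by simp
qed

lemma Ck_on_uminus: "open U \<Longrightarrow> Ck_on k U f \<Longrightarrow> Ck_on k U (\<lambda>x. - f x)"
  by (rule Ck_on_linear_compose) (auto intro!: linearI)

lemma Ck_on_diff: "open U \<Longrightarrow> Ck_on k U f \<Longrightarrow> Ck_on k U g \<Longrightarrow> Ck_on k U (\<lambda>x. f x - g x)"
  using Ck_on_add[OF _ _ Ck_on_uminus] by fastforce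

text \<open>All real exponents are treated at once because differentiation lowers the exponent; the
  exponents \<open>-1\<close> and \<open>1/2\<close> give reciprocals and norms.\<close>

lemma Ck_on_powr: "Ck_on k {0<..} (\<lambda>x::real. x powr a)"
proof (induction k arbitrary: a)
  case 0
  then show ?case by (auto intro!: continuous_intros)
next
  case (Suc k)
  have D: "((\<lambda>x. x powr a) has_derivative (\<lambda>v. v * (a * x powr (a - 1)))) (at x)" if "x > 0" for x
    using has_real_derivative_powr[OF that, of a]
    by (simp add: has_field_derivative_def mult_commute_abs)
  have "Ck_on k {0<..} (\<lambda>x. v * (a * x powr (a - 1)))" for v
    by (intro Ck_on_mult Ck_on_const Suc.IH) auto
  then have "Ck_on k {0<..} (\<lambda>x. frechet_derivative (\<lambda>x. x powr a) (at x) v)" for v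
    by (rule Ck_on_cong[where f = "\<lambda>x. v * (a * x powr (a - 1))", rotated 2])
       (simp_all add: frechet_derivative_at[OF D, symmetric])
  then show ?case using D by (auto simp: differentiable_def)
qed

lemma Ck_on_powr_compose:
  fixes f :: "'a::euclidean_space \<Rightarrow> real"
  assumes "open U" "Ck_on k U f" "\<And>x. x \<in> U \<Longrightarrow> f x > 0"
  shows "Ck_on k U (\<lambda>x. f x powr a)"
  using assms by (intro Ck_on_compose[OF assms(1,2) Ck_on_powr]) auto

lemma Ck_on_divide:
  assumes "open U" "Ck_on k U f" "Ck_on k U g" "\<And>x. x \<in> U \<Longrightarrow> g x > (0::real)"
  shows "Ck_on k U (\<lambda>x. f x / g x)"
proof (rule Ck_on_cong[OF assms(1)])
  show "Ck_on k U (\<lambda>x. f x * g x powr - 1)"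
    by (intro Ck_on_mult Ck_on_powr_compose assms)
qed (use assms(4) in \<open>simp add: powr_minus_divide order_less_imp_le\<close>)

lemma Ck_on_norm:
  assumes "open U" "Ck_on k U f" "\<And>x. x \<in> U \<Longrightarrow> f x \<noteq> 0"
  shows "Ck_on k U (\<lambda>x. norm (f x))"
proof (rule Ck_on_cong[OF assms(1)])
  show "Ck_on k U (\<lambda>x. (f x \<bullet> f x) powr (1 / 2))"
    using assms(3) by (intro Ck_on_powr_compose Ck_on_inner assms) auto
qed (simp add: norm_eq_sqrt_inner powr_half_sqrt)

subsection \<open>Smooth maps on subsets\<close>

lemma smooth_onI:
  assumes "open U" "S \<subseteq> U" "\<And>k. Ck_on k U f"
  shows "smooth_on S f"
  using assms unfolding smooth_on_def by blast

lemma smooth_on_subset: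
  assumes "smooth_on S f" "T \<subseteq> S"
  shows "smooth_on T f"
  unfolding smooth_on_def
proof
  fix x assume "x \<in> T"
  then obtain U h where "open U" "x \<in> U" "\<forall>k. Ck_on k U h" "\<forall>y\<in>U \<inter> S. h y = f y"
    using assms unfolding smooth_on_def by (meson subsetD)
  then show "\<exists>U h. open U \<and> x \<in> U \<and> (\<forall>k. Ck_on k U h) \<and> (\<forall>y\<in>U \<inter> T. h y = f y)"
    using assms(2) by (intro exI[of _ U] exI[of _ h]) auto
qed

lemma smooth_on_cong:
  assumes "\<And>x. x \<in> S \<Longrightarrow> f x = g x" "smooth_on S f"
  shows "smooth_on S g"
  unfolding smooth_on_def
proof
  fix x assume "x \<in> S"
  then obtain U h where "open U" "x \<in> U" "\<forall>k. Ck_on k U h" "\<forall>y\<in>U \<inter> S. h y = f y"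
    using assms(2) unfolding smooth_on_def by meson
  then show "\<exists>U h. open U \<and> x \<in> U \<and> (\<forall>k. Ck_on k U h) \<and> (\<forall>y\<in>U \<inter> S. h y = g y)"
    using assms(1) by (intro exI[of _ U] exI[of _ h]) auto
qed

lemma smooth_on_compose:
  assumes f: "smooth_on S f" and g: "smooth_on T g" and sub: "f ` S \<subseteq> T"
  shows "smooth_on S (\<lambda>x. g (f x))"
  unfolding smooth_on_def
proof
  fix x assume x: "x \<in> S"
  obtain U f' where U: "open U" "x \<in> U" "\<And>k. Ck_on k U f'" "\<And>y. y \<in> U \<inter> S \<Longrightarrow> f' y = f y"
    using bspec[OF f[unfolded smooth_on_def] x] by auto
  obtain V g' where V: "open V" "f x \<in> V" "\<And>k. Ck_on k V g'" "\<And>y. y \<in> V \<inter> T \<Longrightarrow> g' y = g y"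
    using bspec[OF g[unfolded smooth_on_def] subsetD[OF sub imageI[OF x]]] by auto
  have "continuous_on U f'" using U(3)[of 0] by simp
  then have op: "open (U \<inter> f' -` V)" by (simp add: U(1) V(1) continuous_on_open_vimage Int_commute)
  show "\<exists>U h. open U \<and> x \<in> U \<and> (\<forall>k. Ck_on k U h) \<and> (\<forall>y\<in>U \<inter> S. h y = g (f y))"
  proof (intro exI conjI allI)
    show "Ck_on k (U \<inter> f' -` V) (\<lambda>x. g' (f' x))" for k
      by (rule Ck_on_compose[OF op Ck_on_subset[OF U(3)] V(3)]) auto
    show "\<forall>y\<in>(U \<inter> f' -` V) \<inter> S. g' (f' y) = g (f y)"
      using U(4) V(4) sub by auto
  qed (use op U x V in auto)
qed

lemma smooth_on_imp_continuous_on: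
  assumes "smooth_on S f"
  shows "continuous_on S f"
proof (rule continuous_on_eq_continuous_within[THEN iffD2], rule ballI)
  fix x assume x: "x \<in> S"
  obtain U f' where U: "open U" "x \<in> U" "\<And>k. Ck_on k U f'" "\<And>y. y \<in> U \<inter> S \<Longrightarrow> f' y = f y"
    using bspec[OF assms[unfolded smooth_on_def] x] by auto
  have "isCont f' x" using U(3)[of 0] U(1,2) by (simp add: continuous_on_eq_continuous_at)
  then have c: "continuous (at x within S) f'" by (rule continuous_at_imp_continuous_at_within)
  obtain d where "0 < d" and d: "ball x d \<subseteq> U" using U(1,2) openE by blast
  show "continuous (at x within S) f"
    by (rule continuous_transform_within[OF c \<open>0 < d\<close> x])
       (use U(4) d in \<open>auto simp: dist_commute subset_iff\<close>)
qed

lemma smooth_on_open_imp_Ck_on: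
  assumes "open S" "smooth_on S f"
  shows "Ck_on k S f"
proof (rule Ck_on_local)
  fix x assume x: "x \<in> S"
  then obtain U f' where U: "open U" "x \<in> U" "\<And>k. Ck_on k U f'" "\<And>y. y \<in> U \<inter> S \<Longrightarrow> f' y = f y"
    using bspec[OF assms(2)[unfolded smooth_on_def] x] by auto
  have "Ck_on k (U \<inter> S) f"
    by (rule Ck_on_cong[OF _ U(4) Ck_on_subset[OF U(3)]]) (use U(1) assms in auto)
  then show "\<exists>W. open W \<and> x \<in> W \<and> Ck_on k W f"
    using U x assms by blast
qed

section \<open>Manifolds given by explicit charts on subsets of Euclidean space\<close>

lemma smooth_manifold_top_of_setI:
  fixes S :: "'b::euclidean_space set" and A :: "('b, 'm::euclidean_space) chart set"
  assumes cover: "S = (\<Union>(U, \<phi>)\<in>A. U)"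
    and chart: "\<And>U \<phi>. (U, \<phi>) \<in> A \<Longrightarrow> openin (top_of_set S) U \<and> inj_on \<phi> U \<and>
      openin (top_of_set H) (\<phi> ` U) \<and> smooth_on U \<phi> \<and> smooth_on (\<phi> ` U) (inv_into U \<phi>)"
  shows "smooth_manifold H (top_of_set S, A)"
proof -
  have hom: "homeomorphic_map (subtopology (top_of_set S) U) (top_of_set (\<phi> ` U)) \<phi>" if "(U, \<phi>) \<in> A" for U \<phi>
  proof -
    note c = chart[OF that]
    have US: "U \<subseteq> S" using c openin_imp_subset by blast
    have "homeomorphic_maps (top_of_set U) (top_of_set (\<phi> ` U)) \<phi> (inv_into U \<phi>)"
      unfolding homeomorphic_maps_def using c
      by (auto simp: continuous_map_in_subtopology smooth_on_imp_continuous_on inv_into_into)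
    moreover have "subtopology (top_of_set S) U = top_of_set U"
      using US by (simp add: subtopology_subtopology Int_absorb1)
    ultimately show ?thesis by (auto simp: homeomorphic_map_maps)
  qed
  have trans: "smooth_on (\<phi> ` (U \<inter> V)) (\<psi> \<circ> inv_into U \<phi>)" if "(U, \<phi>) \<in> A" "(V, \<psi>) \<in> A" for U \<phi> V \<psi>
  proof -
    have "smooth_on (\<phi> ` (U \<inter> V)) (inv_into U \<phi>)"
      by (rule smooth_on_subset[of "\<phi> ` U"]) (use chart[OF that(1)] in auto)
    moreover have "smooth_on V \<psi>" using chart[OF that(2)] by simp
    moreover have "inv_into U \<phi> ` \<phi> ` (U \<inter> V) \<subseteq> V" using chart[OF that(1)] by auto
    ultimately have "smooth_on (\<phi> ` (U \<inter> V)) (\<lambda>x. \<psi> (inv_into U \<phi> x))" by (rule smooth_on_compose)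
    then show ?thesis by (simp add: o_def)
  qed
  have "Hausdorff_space (top_of_set S)" by (simp add: Hausdorff_space_subtopology)
  moreover have "second_countable (top_of_set S)"
  proof (rule second_countable_subtopology)
    obtain \<B> :: "'b set set" where "countable \<B>" "\<And>C. C \<in> \<B> \<Longrightarrow> open C" "\<And>S. open S \<Longrightarrow> \<exists>U. U \<subseteq> \<B> \<and> S = \<Union>U"
      using univ_second_countable by blast
    then show "second_countable (euclidean :: 'b topology)"
      unfolding second_countable_def
      by (intro exI[of _ \<B>]) (simp, metis Sup_upper Union_iff subsetD)
  qed
  ultimately show ?thesis
    unfolding smooth_manifold_def using cover chart hom trans by (auto split: prod.splits)
qed

text \<open>The charts have to recognise \<open>D\<close>. This makes \<open>D\<close> the boundary by construction, without an appeal
  to invariance of domain.\<close>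

definition half_atlas ::
    "'b::euclidean_space set \<Rightarrow> 'b set \<Rightarrow> ('b, real \<times> 'e::euclidean_space) chart set" where
  "half_atlas Y D = {(U, \<phi>). openin (top_of_set Y) U \<and> inj_on \<phi> U \<and> openin (top_of_set half_space) (\<phi> ` U) \<and>
     smooth_on U \<phi> \<and> smooth_on (\<phi> ` U) (inv_into U \<phi>) \<and> (\<forall>p\<in>U. fst (\<phi> p) = 0 \<longleftrightarrow> p \<in> D)}"

definition domain_manifold :: "'b::euclidean_space set \<Rightarrow> 'b set \<Rightarrow> ('b, real \<times> 'e::euclidean_space) manifold" where
  "domain_manifold Y D = (top_of_set Y, half_atlas Y D)"

definition half_charted ::
    "'e::euclidean_space itself \<Rightarrow> 'b::euclidean_space set \<Rightarrow> 'b set \<Rightarrow> bool" where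
  "half_charted _ Y D \<longleftrightarrow> D \<subseteq> Y \<and> (\<forall>p\<in>Y. \<exists>U (\<phi> :: 'b \<Rightarrow> real \<times> 'e). (U, \<phi>) \<in> half_atlas Y D \<and> p \<in> U)"

lemma half_atlasI:
  assumes "openin (top_of_set Y) U" "openin (top_of_set half_space) T"
    "\<phi> ` U \<subseteq> T" "\<kappa> ` T \<subseteq> U" "\<And>p. p \<in> U \<Longrightarrow> \<kappa> (\<phi> p) = p" "\<And>z. z \<in> T \<Longrightarrow> \<phi> (\<kappa> z) = z"
    "smooth_on U \<phi>" "smooth_on T \<kappa>" "\<And>p. p \<in> U \<Longrightarrow> fst (\<phi> p) = 0 \<longleftrightarrow> p \<in> D"
  shows "(U, \<phi>) \<in> half_atlas Y D"
proof -
  have im: "\<phi> ` U = T" using assms(3,4,6) by (metis image_subset_iff image_eqI subsetI subset_antisym)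
  have inj: "inj_on \<phi> U" using assms(5) by (rule inj_on_inverseI)
  have "smooth_on T (inv_into U \<phi>)"
  proof (rule smooth_on_cong[OF _ assms(8)])
    fix z assume "z \<in> T"
    then show "\<kappa> z = inv_into U \<phi> z" using assms(4,6) inj by (metis image_subset_iff inv_into_f_f)
  qed
  then show ?thesis using assms inj im by (simp add: half_atlas_def)
qed

lemma smooth_manifold_domain_manifold:
  assumes "half_charted TYPE('e::euclidean_space) Y D"
  shows "smooth_manifold half_space (domain_manifold Y D :: ('b::euclidean_space, real \<times> 'e) manifold)"
  unfolding domain_manifold_def
proof (rule smooth_manifold_top_of_setI)
  let ?A = "half_atlas Y D :: ('b, real \<times> 'e) chart set"
  show "Y = (\<Union>(U, \<phi>)\<in>?A. U)"
  proof (intro equalityI subsetI)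
    fix p assume "p \<in> Y"
    then show "p \<in> (\<Union>(U, \<phi>)\<in>?A. U)"
      using assms unfolding half_charted_def by fast
  next
    fix p assume "p \<in> (\<Union>(U, \<phi>)\<in>?A. U)"
    then show "p \<in> Y" using openin_imp_subset by (fastforce simp: half_atlas_def)
  qed
qed (simp add: half_atlas_def)

lemma boundary_points_domain_manifold:
  assumes "half_charted TYPE('e::euclidean_space) Y D"
  shows "boundary_points (domain_manifold Y D :: ('b::euclidean_space, real \<times> 'e) manifold) = D"
proof (intro equalityI subsetI)
  fix p assume "p \<in> D"
  then obtain U and \<phi> :: "'b \<Rightarrow> real \<times> 'e" where U: "(U, \<phi>) \<in> half_atlas Y D" "p \<in> U"
    using assms unfolding half_charted_def by blast
  then have "fst (\<phi> p) = 0" using \<open>p \<in> D\<close> by (auto simp: half_atlas_def)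
  then show "p \<in> boundary_points (domain_manifold Y D :: ('b, real \<times> 'e) manifold)"
    using U by (auto simp: boundary_points_def domain_manifold_def)
qed (auto simp: boundary_points_def domain_manifold_def half_atlas_def)

text \<open>The surface \<open>S\<close> is identified with a part \<open>B\<close> of the boundary of \<open>Y\<close>. The boundary charts of \<open>Y\<close>,
  transported along this identification, are then charts of \<open>S\<close>, so that no separate charts for the
  sphere and the torus have to be produced.\<close>

locale boundary_part =
  fixes e :: "'e::euclidean_space itself" and Y D B :: "'b::euclidean_space set" and S :: "'c::euclidean_space set"
    and f :: "'b \<Rightarrow> 'c" and g :: "'c \<Rightarrow> 'b"
  assumes charted: "half_charted TYPE('e) Y D"
    and B: "openin (top_of_set D) B"
    and f: "smooth_on B f" "f ` B \<subseteq> S" and g: "smooth_on S g" "g ` S \<subseteq> B"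
    and gf: "\<And>p. p \<in> B \<Longrightarrow> g (f p) = p" and fg: "\<And>s. s \<in> S \<Longrightarrow> f (g s) = s"
begin

lemma boundary_chart:
  assumes "(U, \<phi> :: 'b \<Rightarrow> real \<times> 'e) \<in> half_atlas Y D"
  shows "\<And>p. p \<in> U \<inter> B \<Longrightarrow> \<phi> p = (0, snd (\<phi> p))"
    and "\<And>p. p \<in> U \<inter> B \<Longrightarrow> inv_into U \<phi> (0, snd (\<phi> p)) = p"
    and "smooth_on (snd ` \<phi> ` (U \<inter> B)) (\<lambda>w. inv_into U \<phi> (0, w))"
    and "open (snd ` \<phi> ` (U \<inter> B))"
proof -
  have BD: "B \<subseteq> D" using B by (rule openin_imp_subset)
  have U: "openin (top_of_set Y) U" "inj_on \<phi> U" "openin (top_of_set half_space) (\<phi> ` U)"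
    "smooth_on (\<phi> ` U) (inv_into U \<phi>)" "\<forall>p\<in>U. fst (\<phi> p) = 0 \<longleftrightarrow> p \<in> D"
    using assms by (auto simp: half_atlas_def)
  show 1: "\<phi> p = (0, snd (\<phi> p))" if "p \<in> U \<inter> B" for p
    using U(5) BD that by (auto simp: prod_eq_iff)
  show 2: "inv_into U \<phi> (0, snd (\<phi> p)) = p" if "p \<in> U \<inter> B" for p
    using 1[OF that, symmetric] U(2) that by simp
  have "smooth_on (snd ` \<phi> ` (U \<inter> B)) (\<lambda>w. (0 :: real, w))"
    by (rule smooth_onI[OF open_UNIV]) (auto intro!: Ck_on_Pair Ck_on_const Ck_on_ident simp del: Ck_on.simps)
  moreover have "(\<lambda>w. (0, w)) ` snd ` \<phi> ` (U \<inter> B) \<subseteq> \<phi> ` U"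
  proof
    fix z :: "real \<times> 'e" assume "z \<in> (\<lambda>w. (0, w)) ` snd ` \<phi> ` (U \<inter> B)"
    then obtain p where "p \<in> U \<inter> B" "z = (0, snd (\<phi> p))" by blast
    then show "z \<in> \<phi> ` U" using 1[of p] by (intro image_eqI[of _ _ p]) auto
  qed
  ultimately show "smooth_on (snd ` \<phi> ` (U \<inter> B)) (\<lambda>w. inv_into U \<phi> (0, w))"
    by (rule smooth_on_compose[OF _ U(4)])
  obtain T where T: "open T" "B = D \<inter> T" using B by (auto simp: openin_open)
  have "openin (top_of_set (\<phi> ` U)) (\<phi> ` U \<inter> inv_into U \<phi> -` T)"
    using smooth_on_imp_continuous_on[OF U(4)] T(1) by (rule continuous_openin_preimage_gen)
  then have "openin (top_of_set half_space) (\<phi> ` U \<inter> inv_into U \<phi> -` T)" using U(3) by (rule openin_trans)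
  then obtain R where R: "open R" "\<phi> ` U \<inter> inv_into U \<phi> -` T = half_space \<inter> R" by (auto simp: openin_open)
  have "snd ` \<phi> ` (U \<inter> B) = (\<lambda>w. (0, w)) -` R"
  proof (intro equalityI subsetI)
    fix w assume "w \<in> snd ` \<phi> ` (U \<inter> B)"
    then obtain p where p: "p \<in> U \<inter> B" "w = snd (\<phi> p)" by auto
    then have "(0, w) \<in> \<phi> ` U \<inter> inv_into U \<phi> -` T"
    proof -
      have "\<phi> p = (0, w)" "p \<in> T" "p \<in> U" using 1[OF p(1)] p T by auto
      then show ?thesis using 2[OF p(1)] p(2) by (metis IntI imageI vimageI)
    qed
    then show "w \<in> (\<lambda>w. (0, w)) -` R" unfolding R(2) by simp
  next
    fix w assume "w \<in> (\<lambda>w. (0, w)) -` R"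
    then have "(0, w) \<in> half_space \<inter> R" by (simp add: half_space_def)
    then have "(0, w) \<in> \<phi> ` U" and T': "inv_into U \<phi> (0, w) \<in> T" unfolding R(2)[symmetric] by blast+
    then obtain p where p': "p \<in> U" "(0, w) = \<phi> p" by blast
    note p = p'(1) p'(2)[symmetric] T'
    then have "inv_into U \<phi> (0, w) = p" using inv_into_f_f[OF U(2) p(1)] by simp
    moreover have "p \<in> D" using bspec[OF U(5) p(1)] unfolding p(2) by simp
    ultimately have "p \<in> U \<inter> B" using p(1,3) T(2) by simp
    then have "snd (\<phi> p) \<in> snd ` \<phi> ` (U \<inter> B)" by blast
    then show "w \<in> snd ` \<phi> ` (U \<inter> B)" using p(2) by simp
  qed
  moreover have "open ((\<lambda>w :: 'e. (0 :: real, w)) -` R)"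
    by (rule open_vimage[OF R(1)]) (intro continuous_intros)
  ultimately show "open (snd ` \<phi> ` (U \<inter> B))" by simp
qed

lemma diffeomorphic:
  "diffeomorphic (open_submanifold (boundary_manifold (domain_manifold Y D :: ('b, real \<times> 'e) manifold)) B)
     (submanifold S)"
proof -
  let ?A = "half_atlas Y D :: ('b, real \<times> 'e) chart set"
  let ?S = "submanifold S :: ('c, 'e) manifold"
  have BD: "B \<subseteq> D" and DY: "D \<subseteq> Y" using B charted openin_imp_subset by (auto simp: half_charted_def)
  have topB: "subtopology (subtopology (top_of_set Y) D) B = top_of_set B"
  proof -
    have "Y \<inter> D \<inter> B = B" using BD DY by blast
    then show ?thesis by (simp add: subtopology_subtopology Int_assoc)
  qed
  have bp: "boundary_points (domain_manifold Y D :: ('b, real \<times> 'e) manifold) = D"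
    by (rule boundary_points_domain_manifold[OF charted])
  have M: "open_submanifold (boundary_manifold (domain_manifold Y D :: ('b, real \<times> 'e) manifold)) B =
     (top_of_set B, (\<lambda>(U, \<phi>). (U \<inter> B, snd \<circ> \<phi>)) ` half_atlas Y D)"
    unfolding open_submanifold_def boundary_manifold_def bp
    using BD by (auto simp: domain_manifold_def topB image_image split_def Int_assoc Int_absorb1)
  have hom: "homeomorphic_maps (top_of_set B) (top_of_set S) f g"
    unfolding homeomorphic_maps_def using f g gf fg
    by (auto simp: continuous_map_in_subtopology smooth_on_imp_continuous_on)
  have sm1: "smooth_on ((snd \<circ> \<phi>) ` ((U \<inter> B) \<inter> f -` W)) (\<psi> \<circ> f \<circ> inv_into (U \<inter> B) (snd \<circ> \<phi>))"
    if U: "(U, \<phi>) \<in> half_atlas Y D" and W: "(W, \<psi>) \<in> snd ?S"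
    for U W and \<phi> :: "'b \<Rightarrow> real \<times> 'e" and \<psi> :: "'c \<Rightarrow> 'e"
  proof -
    note bc = boundary_chart[OF U]
    have inj: "inj_on (snd \<circ> \<phi>) (U \<inter> B)" by (rule inj_on_inverseI[of _ "\<lambda>w. inv_into U \<phi> (0, w)"]) (use bc(2) in simp)
    let ?T = "(snd \<circ> \<phi>) ` ((U \<inter> B) \<inter> f -` W)"
    have s1: "smooth_on ?T (\<lambda>w. inv_into U \<phi> (0, w))" by (rule smooth_on_subset[OF bc(3)]) auto
    have im: "(\<lambda>w. inv_into U \<phi> (0, w)) ` ?T \<subseteq> (U \<inter> B) \<inter> f -` W" using bc(2) by auto
    have "smooth_on ?T (\<lambda>w. f (inv_into U \<phi> (0, w)))"
      by (rule smooth_on_compose[OF s1 f(1)]) (use im in blast)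
    moreover have "smooth_on W \<psi>" using W by (simp add: submanifold_def)
    ultimately have "smooth_on ?T (\<lambda>w. \<psi> (f (inv_into U \<phi> (0, w))))"
      by (rule smooth_on_compose) (use im in blast)
    then show ?thesis
    proof (rule smooth_on_cong[rotated])
      fix w assume "w \<in> ?T"
      then obtain p where p: "p \<in> U \<inter> B" "w = snd (\<phi> p)" by auto
      then have "inv_into (U \<inter> B) (snd \<circ> \<phi>) w = p" using inv_into_f_f[OF inj p(1)] by simp
      then show "\<psi> (f (inv_into U \<phi> (0, w))) = (\<psi> \<circ> f \<circ> inv_into (U \<inter> B) (snd \<circ> \<phi>)) w"
        using bc(2)[OF p(1)] p(2) by simp
    qed
  qed
  have smf: "smooth_map (top_of_set B, (\<lambda>(U, \<phi>). (U \<inter> B, snd \<circ> \<phi>)) ` ?A) ?S f" (is "smooth_map ?M ?N f")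
    unfolding smooth_map_def
  proof (intro conjI ballI)
    show "continuous_map (fst ?M) (fst ?N) f" using hom by (simp add: homeomorphic_maps_def submanifold_def)
    fix c assume "c \<in> snd ?M"
    then obtain U \<phi> where c: "(U, \<phi>) \<in> half_atlas Y D" "c = (U \<inter> B, snd \<circ> \<phi>)" by auto
    have "smooth_on ((snd \<circ> \<phi>) ` ((U \<inter> B) \<inter> f -` fst d)) (snd d \<circ> f \<circ> inv_into (U \<inter> B) (snd \<circ> \<phi>))"
      if "d \<in> snd ?N" for d
      using sm1[OF c(1), of "fst d" "snd d"] that by simp
    then show "case c of (U, \<phi>) \<Rightarrow> \<forall>(V, \<psi>)\<in>snd ?N. smooth_on (\<phi> ` (U \<inter> f -` V)) (\<psi> \<circ> f \<circ> inv_into U \<phi>)"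
      unfolding c(2) prod.case by (simp add: split_beta)
  qed
  have sm2: "smooth_on (\<psi> ` (W \<inter> g -` (U \<inter> B))) (snd \<circ> \<phi> \<circ> g \<circ> inv_into W \<psi>)"
    if U: "(U, \<phi>) \<in> half_atlas Y D" and W: "(W, \<psi>) \<in> snd ?S"
    for U W and \<phi> :: "'b \<Rightarrow> real \<times> 'e" and \<psi> :: "'c \<Rightarrow> 'e"
  proof -
    let ?T = "\<psi> ` (W \<inter> g -` (U \<inter> B))"
    have W': "inj_on \<psi> W" "smooth_on (\<psi> ` W) (inv_into W \<psi>)" "W \<subseteq> S"
      using W openin_imp_subset by (auto simp: submanifold_def)
    have "smooth_on ?T (inv_into W \<psi>)" by (rule smooth_on_subset[OF W'(2)]) auto
    from smooth_on_compose[OF this g(1)] have "smooth_on ?T (\<lambda>w. g (inv_into W \<psi> w))" using W'(1,3) by auto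
    moreover have "smooth_on U \<phi>" using U by (simp add: half_atlas_def)
    ultimately have "smooth_on ?T (\<lambda>w. \<phi> (g (inv_into W \<psi> w)))"
      by (rule smooth_on_compose) (use W'(1) in auto)
    moreover have "smooth_on UNIV (snd :: real \<times> 'e \<Rightarrow> 'e)"
      by (rule smooth_onI[OF open_UNIV order_refl]) (rule Ck_on_linear[OF linear_snd])
    ultimately have "smooth_on ?T (\<lambda>w. snd (\<phi> (g (inv_into W \<psi> w))))"
      by (rule smooth_on_compose) simp
    then show ?thesis by (simp add: o_def)
  qed
  have smg: "smooth_map ?S (top_of_set B, (\<lambda>(U, \<phi>). (U \<inter> B, snd \<circ> \<phi>)) ` ?A) g" (is "smooth_map ?N ?M g")
    unfolding smooth_map_def
  proof (intro conjI ballI)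
    show "continuous_map (fst ?N) (fst ?M) g" using hom by (simp add: homeomorphic_maps_def submanifold_def)
    fix d assume d: "d \<in> snd ?N"
    have "smooth_on (snd d ` (fst d \<inter> g -` (U \<inter> B))) (snd \<circ> \<phi> \<circ> g \<circ> inv_into (fst d) (snd d))"
      if "(U, \<phi>) \<in> half_atlas Y D" for U and \<phi> :: "'b \<Rightarrow> real \<times> 'e"
      using sm2[OF that, of "fst d" "snd d"] d by simp
    then have "\<forall>(V, \<psi>)\<in>snd ?M. smooth_on (snd d ` (fst d \<inter> g -` V)) (\<psi> \<circ> g \<circ> inv_into (fst d) (snd d))"
      by auto
    then show "case d of (U, \<phi>) \<Rightarrow> \<forall>(V, \<psi>)\<in>snd ?M. smooth_on (\<phi> ` (U \<inter> g -` V)) (\<psi> \<circ> g \<circ> inv_into U \<phi>)"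
      by (simp add: split_beta)
  qed
  show ?thesis
    unfolding diffeomorphic_def M using hom smf smg
    by (intro exI[of _ f] exI[of _ g] conjI) (simp_all add: submanifold_def)
qed

lemma closed_manifold_submanifold:
  assumes "compact S"
  shows "closed_manifold (submanifold S :: ('c, 'e) manifold)"
proof -
  have BD: "B \<subseteq> D" and DY: "D \<subseteq> Y" using B charted openin_imp_subset by (auto simp: half_charted_def)
  define A where "A = snd (submanifold S :: ('c, 'e) manifold)"
  have chart: "\<exists>W \<psi>. (W, \<psi>) \<in> A \<and> s \<in> W" if s: "s \<in> S" for s
  proof -
    have gs: "g s \<in> B" using g(2) s by auto
    then obtain U and \<phi> :: "'b \<Rightarrow> real \<times> 'e" where U: "(U, \<phi>) \<in> half_atlas Y D" "g s \<in> U"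
      using charted BD DY unfolding half_charted_def by blast
    note bc = boundary_chart[OF U(1)]
    have opU: "openin (top_of_set Y) U" and sU: "smooth_on U \<phi>" using U(1) by (auto simp: half_atlas_def)
    define W where "W = S \<inter> g -` U"
    define \<psi> where "\<psi> s = snd (\<phi> (g s))" for s
    have gW: "g ` W = U \<inter> B"
    proof (intro equalityI subsetI)
      fix p assume "p \<in> U \<inter> B"
      then show "p \<in> g ` W" using gf[of p] f(2) by (intro image_eqI[of _ _ "f p"]) (auto simp: W_def)
    qed (use g(2) in \<open>auto simp: W_def\<close>)
    have \<psi>W: "\<psi> ` W = snd ` \<phi> ` (U \<inter> B)" unfolding gW[symmetric] by (auto simp: \<psi>_def image_image)
    have finv: "f (inv_into U \<phi> (0, \<psi> t)) = t" if "t \<in> W" for t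
    proof -
      have "g t \<in> U \<inter> B" using gW that by blast
      then show ?thesis using bc(2)[of "g t"] fg that by (simp add: \<psi>_def W_def)
    qed
    have inj: "inj_on \<psi> W" by (rule inj_on_inverseI[of _ "\<lambda>w. f (inv_into U \<phi> (0, w))"]) (rule finv)
    have "openin (top_of_set S) W"
    proof -
      obtain T where T: "open T" "U = Y \<inter> T" using opU by (auto simp: openin_open)
      have "W = S \<inter> g -` T" using T(2) g(2) BD DY by (auto simp: W_def)
      then show ?thesis using smooth_on_imp_continuous_on[OF g(1)] T(1) by (simp add: continuous_openin_preimage_gen)
    qed
    moreover have "smooth_on W \<psi>"
    proof -
      have "smooth_on W g" by (rule smooth_on_subset[OF g(1)]) (simp add: W_def)
      from smooth_on_compose[OF this sU] have "smooth_on W (\<lambda>s. \<phi> (g s))" by (auto simp: W_def)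
      moreover have "smooth_on UNIV (snd :: real \<times> 'e \<Rightarrow> 'e)"
        by (rule smooth_onI[OF open_UNIV order_refl]) (rule Ck_on_linear[OF linear_snd])
      ultimately show ?thesis unfolding \<psi>_def by (rule smooth_on_compose) simp
    qed
    moreover have "smooth_on (\<psi> ` W) (inv_into W \<psi>)"
    proof (rule smooth_on_cong)
      show "smooth_on (\<psi> ` W) (\<lambda>w. f (inv_into U \<phi> (0, w)))"
        unfolding \<psi>W by (rule smooth_on_compose[OF bc(3) f(1)]) (use bc(2) in auto)
      show "f (inv_into U \<phi> (0, w)) = inv_into W \<psi> w" if "w \<in> \<psi> ` W" for w
        using that finv inj by auto
    qed
    ultimately have "(W, \<psi>) \<in> A"
      using inj bc(4) unfolding A_def submanifold_def \<psi>W[symmetric] by simp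
    moreover have "s \<in> W" using s U(2) by (simp add: W_def)
    ultimately show ?thesis by blast
  qed
  have "smooth_manifold UNIV (top_of_set S, A)"
  proof (rule smooth_manifold_top_of_setI)
    show "S = (\<Union>(U, \<phi>)\<in>A. U)"
    proof (intro equalityI subsetI)
      fix s assume "s \<in> S"
      then show "s \<in> (\<Union>(U, \<phi>)\<in>A. U)" using chart by fast
    next
      fix s assume "s \<in> (\<Union>(U, \<phi>)\<in>A. U)"
      then show "s \<in> S" using openin_imp_subset by (fastforce simp: A_def submanifold_def)
    qed
  qed (auto simp: A_def submanifold_def)
  moreover have "compact_space (top_of_set S)" using assms by (simp add: compact_space_subtopology)
  ultimately show ?thesis by (simp add: closed_manifold_def A_def submanifold_def)
qed

end

section \<open>A smooth cobordism: a ball and a solid torus\<close>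

text \<open>The inversion in the sphere of radius \<open>sqrt 2\<close> about \<open>-(1, 0)\<close>. That sphere meets the unit sphere
  and the hyperplane \<open>fst x = 0\<close> in their common points, and the inversion is an involution that
  exchanges the two, as well as the unit ball and the half-space. So one rational map provides
  charts of the ball at the boundary, and on the circle it is the stereographic projection.\<close>

definition inversion :: "real \<times> 'e::euclidean_space \<Rightarrow> real \<times> 'e" where
  "inversion x = (2 / ((x + (1, 0)) \<bullet> (x + (1, 0)))) *\<^sub>R (x + (1, 0)) - (1, 0)"

lemma inversion_denominator_pos:
  assumes "x \<noteq> - (1, 0)"
  shows "0 < (x + (1, 0)) \<bullet> (x + (1, 0))"
  using assms by (metis add_eq_0_iff2 inner_gt_zero_iff)

lemma inversion_inversion:
  assumes "x \<noteq> - (1, 0)"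
  shows "inversion (inversion x) = x" and "inversion x \<noteq> - (1, 0)"
proof -
  define d where "d = (x + (1, 0)) \<bullet> (x + (1, 0))"
  have d: "0 < d" unfolding d_def by (rule inversion_denominator_pos[OF assms])
  have i: "inversion x + (1, 0) = (2 / d) *\<^sub>R (x + (1, 0))" by (simp add: inversion_def d_def)
  have "(inversion x + (1, 0)) \<bullet> (inversion x + (1, 0)) = (2 / d) * ((2 / d) * d)"
    unfolding i inner_scaleR_left inner_scaleR_right d_def[symmetric] ..
  then have dd: "(inversion x + (1, 0)) \<bullet> (inversion x + (1, 0)) = 4 / d" using d by (simp add: field_simps)
  have "inversion (inversion x) = (2 / (4 / d)) *\<^sub>R ((2 / d) *\<^sub>R (x + (1, 0))) - (1, 0)"
    by (subst inversion_def) (simp only: dd, simp only: i)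
  then show "inversion (inversion x) = x" using d by simp
  show "inversion x \<noteq> - (1, 0)"
  proof
    assume "inversion x = - (1, 0)"
    then have "(inversion x + (1, 0)) \<bullet> (inversion x + (1, 0)) = 0" by simp
    then show False using dd d by simp
  qed
qed

lemma fst_inversion:
  assumes "x \<noteq> - (1, 0)"
  shows "fst (inversion x) = (1 - x \<bullet> x) / ((x + (1, 0)) \<bullet> (x + (1, 0)))"
proof -
  define d where "d = (x + (1, 0)) \<bullet> (x + (1, 0))"
  have d: "0 < d" unfolding d_def by (rule inversion_denominator_pos[OF assms])
  have e: "d = x \<bullet> x + 2 * fst x + 1"
    by (simp add: d_def inner_add_left inner_add_right inner_prod_def algebra_simps)
  have "fst (inversion x) = 2 * (fst x + 1) / d - 1" by (simp add: inversion_def d_def)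
  also have "\<dots> = (1 - x \<bullet> x) / d" using d by (simp add: field_simps) (simp add: e)
  finally show ?thesis by (simp add: d_def)
qed

lemma inversion_half_space:
  assumes "x \<noteq> - (1, 0)"
  shows "0 \<le> fst (inversion x) \<longleftrightarrow> norm x \<le> 1" and "fst (inversion x) = 0 \<longleftrightarrow> norm x = 1"
proof -
  note d = inversion_denominator_pos[OF assms]
  have "0 \<le> fst (inversion x) \<longleftrightarrow> x \<bullet> x \<le> 1" unfolding fst_inversion[OF assms] using d by (simp add: pos_le_divide_eq)
  then show "0 \<le> fst (inversion x) \<longleftrightarrow> norm x \<le> 1" by (simp add: norm_eq_sqrt_inner)
  have "fst (inversion x) = 0 \<longleftrightarrow> x \<bullet> x = 1" unfolding fst_inversion[OF assms] using d by auto
  then show "fst (inversion x) = 0 \<longleftrightarrow> norm x = 1" by (simp add: norm_eq_sqrt_inner)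
qed

lemma norm_inversion:
  assumes "x \<noteq> - (1, 0)"
  shows "norm (inversion x) \<le> 1 \<longleftrightarrow> 0 \<le> fst x" and "norm (inversion x) = 1 \<longleftrightarrow> fst x = 0"
  using inversion_half_space[OF inversion_inversion(2)[OF assms]] inversion_inversion(1)[OF assms] by auto

lemma Ck_on_inversion:
  assumes "open U" "Ck_on k U f" "\<And>x. x \<in> U \<Longrightarrow> f x \<noteq> - (1, 0)"
  shows "Ck_on k U (\<lambda>x. inversion (f x))"
  unfolding inversion_def
  by (intro Ck_on_diff Ck_on_scaleR Ck_on_divide Ck_on_inner Ck_on_add Ck_on_const assms)
     (rule inversion_denominator_pos[OF assms(3)])

lemma half_space_ne: "z \<in> half_space \<Longrightarrow> z \<noteq> - (1, 0)"
  by (auto simp: half_space_def)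

text \<open>The solid torus with core circle of radius 3 and thickness 1, parametrised by the product of a
  circle and a disc.\<close>

definition tube :: "(real \<times> real) \<times> (real \<times> real) \<Rightarrow> real \<times> (real^2)" where
  "tube ac = (snd (snd ac), (3 + fst (snd ac)) *\<^sub>R vector [fst (fst ac), snd (fst ac)])"

definition tube_coords :: "real \<times> (real^2) \<Rightarrow> (real \<times> real) \<times> (real \<times> real)" where
  "tube_coords p = ((snd p $ 1 / norm (snd p), snd p $ 2 / norm (snd p)), (norm (snd p) - 3, fst p))"

lemma norm_vector_2: "norm (vector [x, y] :: real^2) = norm (x, y)"
  by (simp add: norm_eq_sqrt_inner inner_vec_def sum_2 inner_prod_def)

lemma tube_properties:
  assumes "norm (fst ac) = 1" "norm (snd ac) \<le> 1"
  shows "tube_coords (tube ac) = ac" "snd (tube ac) \<noteq> 0" "2 \<le> norm (tube ac)"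
proof -
  have "\<bar>fst (snd ac)\<bar> \<le> 1" using assms(2) norm_fst_le[of "fst (snd ac)" "snd (snd ac)"] by simp
  then have c: "2 \<le> 3 + fst (snd ac)" by linarith
  have n: "norm (snd (tube ac)) = 3 + fst (snd ac)"
    using c assms(1) by (simp add: tube_def norm_vector_2)
  show "tube_coords (tube ac) = ac" unfolding tube_coords_def n using c
    by (simp add: tube_def prod_eq_iff)
  show "snd (tube ac) \<noteq> 0" using n c by auto
  show "2 \<le> norm (tube ac)" using n c norm_snd_le[of "snd (tube ac)" "fst (tube ac)"] by simp
qed

lemma Ck_on_tube: "Ck_on k UNIV tube"
  unfolding tube_def[abs_def]
  by (intro Ck_on_Pair Ck_on_scaleR Ck_on_add Ck_on_vector_2 Ck_on_fst Ck_on_snd Ck_on_ident Ck_on_const open_UNIV)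

lemma open_snd_ne_0: "open {p :: 'a::topological_space \<times> 'b::t1_space. snd p \<noteq> a}"
proof -
  have "{p :: 'a \<times> 'b. snd p \<noteq> a} = snd -` (- {a})" by auto
  then show ?thesis by (simp add: open_vimage_snd open_Compl)
qed

lemma Ck_on_tube_coords: "Ck_on k {p. snd p \<noteq> 0} tube_coords"
  unfolding tube_coords_def[abs_def]
  by (intro Ck_on_Pair Ck_on_divide Ck_on_diff Ck_on_norm Ck_on_nth Ck_on_fst Ck_on_snd Ck_on_ident
      Ck_on_const open_snd_ne_0) auto

definition filling :: "(real \<times> (real^2)) set" where
  "filling = cball 0 1 \<union> tube ` (sphere 0 1 \<times> cball 0 1)"

definition filling_boundary :: "(real \<times> (real^2)) set" where
  "filling_boundary = sphere 0 1 \<union> tube ` (sphere 0 1 \<times> sphere 0 1)"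

lemma far_point_of_filling:
  assumes "p \<in> filling" "1 < norm p"
  obtains a c where "norm a = 1" "norm c \<le> 1" "p = tube (a, c)"
  using assms by (auto simp: filling_def)

text \<open>Only one point of the ball is missed by the inversion. The sign \<open>s\<close> moves it to the antipode,
  so the two choices of \<open>s\<close> cover the ball.\<close>

lemma ball_chart:
  assumes s: "s = 1 \<or> s = (-1 :: real)"
  shows "({x \<in> filling. norm x < 3/2 \<and> s *\<^sub>R x \<noteq> - (1, 0)}, \<lambda>x. inversion (s *\<^sub>R x)) \<in> half_atlas filling filling_boundary"
    (is "(?U, _) \<in> _")
proof (rule half_atlasI[where T = half_space and \<kappa> = "\<lambda>z. s *\<^sub>R inversion z"])
  have far: "\<not> norm (tube ac) < 3/2" if "ac \<in> sphere 0 1 \<times> cball 0 1" for ac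
    using tube_properties(3)[of ac] that by auto
  have ss: "s * s = 1" "\<bar>s\<bar> = 1" using s by auto
  have U: "x \<in> ?U \<longleftrightarrow> norm x \<le> 1 \<and> s *\<^sub>R x \<noteq> - (1, 0)" for x using far by (auto simp: filling_def)
  have opV: "open {x :: real \<times> (real^2). s *\<^sub>R x \<noteq> - (1, 0)}"
    by (intro open_Collect_neq continuous_intros)
  have "?U = filling \<inter> ({x. norm x < 3/2} \<inter> {x. s *\<^sub>R x \<noteq> - (1, 0)})" by auto
  moreover have "open {x :: real \<times> (real^2). norm x < 3/2}" by (intro open_Collect_less continuous_intros)
  ultimately show "openin (top_of_set filling) ?U" using opV by (simp add: openin_open_Int open_Int)
  show "(\<lambda>x. inversion (s *\<^sub>R x)) ` ?U \<subseteq> half_space"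
  proof (rule image_subsetI)
    fix x assume "x \<in> ?U"
    then show "inversion (s *\<^sub>R x) \<in> half_space"
      unfolding U using inversion_half_space(1)[of "s *\<^sub>R x"] ss(2) by (simp add: half_space_def)
  qed
  show "(\<lambda>z. s *\<^sub>R inversion z) ` half_space \<subseteq> ?U"
    unfolding image_subset_iff U
  proof (intro ballI conjI)
    fix z :: "real \<times> (real^2)" assume z: "z \<in> half_space"
    show "norm (s *\<^sub>R inversion z) \<le> 1"
      using norm_inversion(1)[OF half_space_ne[OF z]] z ss by (simp add: half_space_def)
    show "s *\<^sub>R s *\<^sub>R inversion z \<noteq> - (1, 0)" using inversion_inversion(2)[OF half_space_ne[OF z]] ss by simp
  qed
  show "s *\<^sub>R inversion (inversion (s *\<^sub>R x)) = x" if "x \<in> ?U" for x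
    using that inversion_inversion(1)[of "s *\<^sub>R x"] ss by simp
  show "inversion (s *\<^sub>R s *\<^sub>R inversion z) = z" if "z \<in> half_space" for z :: "real \<times> (real^2)"
    using inversion_inversion(1)[OF half_space_ne[OF that]] ss by simp
  show "smooth_on ?U (\<lambda>x. inversion (s *\<^sub>R x))"
  proof (rule smooth_onI[OF opV])
    show "Ck_on k {x. s *\<^sub>R x \<noteq> - (1, 0)} (\<lambda>x :: real \<times> (real^2). inversion (s *\<^sub>R x))" for k
      by (intro Ck_on_inversion Ck_on_scaleR Ck_on_const Ck_on_ident opV) simp
  qed auto
  have opH: "open {z :: real \<times> (real^2). z \<noteq> - (1, 0)}" by (intro open_Collect_neq continuous_intros)
  show "smooth_on half_space (\<lambda>z :: real \<times> (real^2). s *\<^sub>R inversion z)"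
  proof (rule smooth_onI[OF opH])
    show "Ck_on k {z. z \<noteq> - (1, 0)} (\<lambda>z :: real \<times> (real^2). s *\<^sub>R inversion z)" for k
      by (intro Ck_on_inversion Ck_on_scaleR Ck_on_const Ck_on_ident opH) simp
  qed (use half_space_ne in auto)
  show "fst (inversion (s *\<^sub>R x)) = 0 \<longleftrightarrow> x \<in> filling_boundary" if x: "x \<in> ?U" for x
  proof -
    have "fst (inversion (s *\<^sub>R x)) = 0 \<longleftrightarrow> norm x = 1" using inversion_half_space(2)[of "s *\<^sub>R x"] x ss by simp
    also have "\<dots> \<longleftrightarrow> x \<in> filling_boundary" using x far by (auto simp: filling_boundary_def)
    finally show ?thesis .
  qed
qed simp

text \<open>The inversion is applied in the circle and in the disc. On the circle its first coordinate
  vanishes and the second one is the chart; on the disc it is the chart of the two-dimensional ball,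
  whose first coordinate becomes the boundary coordinate.\<close>

lemma tube_chart:
  assumes s: "s = 1 \<or> s = (-1 :: real)" and t: "t = 1 \<or> t = (-1 :: real)"
  defines "U \<equiv> {p \<in> filling. 3/2 < norm p \<and> s *\<^sub>R fst (tube_coords p) \<noteq> - (1, 0) \<and> t *\<^sub>R snd (tube_coords p) \<noteq> - (1, 0)}"
  shows "(U, \<lambda>p. (fst (inversion (t *\<^sub>R snd (tube_coords p))),
      vector [snd (inversion (s *\<^sub>R fst (tube_coords p))), snd (inversion (t *\<^sub>R snd (tube_coords p)))] :: real^2))
    \<in> half_atlas filling filling_boundary"
    (is "(_, ?\<phi>) \<in> _")
proof (rule half_atlasI[where T = half_space and
      \<kappa> = "\<lambda>z :: real \<times> (real^2). tube (s *\<^sub>R inversion (0, snd z $ 1), t *\<^sub>R inversion (fst z, snd z $ 2))"])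
  let ?\<kappa> = "\<lambda>z :: real \<times> (real^2). tube (s *\<^sub>R inversion (0, snd z $ 1), t *\<^sub>R inversion (fst z, snd z $ 2))"
  have ss: "s * s = 1" "\<bar>s\<bar> = 1" "t * t = 1" "\<bar>t\<bar> = 1" using s t by auto
  have U: "tube (a, c) \<in> U \<longleftrightarrow> s *\<^sub>R a \<noteq> - (1, 0) \<and> t *\<^sub>R c \<noteq> - (1, 0)" if "norm a = 1" "norm c \<le> 1" for a c
    using tube_properties[of "(a, c)"] that by (auto simp: U_def filling_def)
  have Uobt: "\<exists>a c. norm a = 1 \<and> norm c \<le> 1 \<and> p = tube (a, c) \<and> tube_coords p = (a, c) \<and>
      s *\<^sub>R a \<noteq> - (1, 0) \<and> t *\<^sub>R c \<noteq> - (1, 0)" if pU: "p \<in> U" for p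
  proof -
    have "p \<in> filling" "1 < norm p" using pU by (auto simp: U_def)
    then obtain a c where ac: "norm a = 1" "norm c \<le> 1" "p = tube (a, c)" by (rule far_point_of_filling)
    have "tube_coords p = (a, c)" using tube_properties(1)[of "(a, c)"] ac by simp
    moreover have "s *\<^sub>R a \<noteq> - (1, 0)" "t *\<^sub>R c \<noteq> - (1, 0)" using pU U[OF ac(1,2)] ac(3) by blast+
    ultimately show ?thesis using ac by blast
  qed
  define \<Omega> where "\<Omega> = {p. snd p \<noteq> 0} \<inter> tube_coords -` {ac. s *\<^sub>R fst ac \<noteq> - (1, 0) \<and> t *\<^sub>R snd ac \<noteq> - (1, 0)}"
  have op\<Omega>: "open \<Omega>" unfolding \<Omega>_def
  proof (rule continuous_open_preimage[OF _ open_snd_ne_0])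
    show "continuous_on {p. snd p \<noteq> 0} tube_coords" using Ck_on_tube_coords[of 0] by simp
    show "open {ac :: (real \<times> real) \<times> (real \<times> real). s *\<^sub>R fst ac \<noteq> - (1, 0) \<and> t *\<^sub>R snd ac \<noteq> - (1, 0)}"
      by (intro open_Collect_conj open_Collect_neq continuous_intros)
  qed
  have U\<Omega>: "U \<subseteq> \<Omega>"
  proof
    fix p assume "p \<in> U"
    then obtain a c where "norm a = 1" "norm c \<le> 1" "p = tube (a, c)" "tube_coords p = (a, c)"
      "s *\<^sub>R a \<noteq> - (1, 0)" "t *\<^sub>R c \<noteq> - (1, 0)" using Uobt by blast
    then show "p \<in> \<Omega>" using tube_properties(2)[of "(a, c)"] by (simp add: \<Omega>_def)
  qed
  have "U = filling \<inter> ({p. 3/2 < norm p} \<inter> \<Omega>)" using U\<Omega> by (auto simp: U_def \<Omega>_def)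
  moreover have "open {p :: real \<times> (real^2). 3/2 < norm p}" by (intro open_Collect_less continuous_intros)
  ultimately show "openin (top_of_set filling) U" using op\<Omega> by (simp add: openin_open_Int open_Int)
  have ne: "(0 :: real, y :: real) \<noteq> - (1, 0)" for y by simp
  have ne2: "(fst z, y) \<noteq> - (1, 0)" if "z \<in> half_space" for z :: "real \<times> (real^2)" and y :: real
    using that by (auto simp: half_space_def)
  have n1: "norm (s *\<^sub>R inversion (0, y)) = 1" for y :: real using norm_inversion(2)[OF ne] ss by simp
  have n2: "norm (t *\<^sub>R inversion (fst z, y)) \<le> 1" if "z \<in> half_space" for z :: "real \<times> (real^2)" and y :: real
    using norm_inversion(1)[OF ne2[OF that]] ss that by (simp add: half_space_def)
  show "?\<phi> ` U \<subseteq> half_space"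
  proof
    fix z assume "z \<in> ?\<phi> ` U"
    then obtain p where p: "p \<in> U" "z = ?\<phi> p" by blast
    obtain a c where ac: "norm c \<le> 1" "tube_coords p = (a, c)" "t *\<^sub>R c \<noteq> - (1, 0)" using Uobt[OF p(1)] by blast
    then have "0 \<le> fst (inversion (t *\<^sub>R c))" using inversion_half_space(1)[OF ac(3)] ss by simp
    then show "z \<in> half_space" using p(2) ac(2) by (simp add: half_space_def)
  qed
  show "?\<kappa> ` half_space \<subseteq> U"
  proof
    fix p assume "p \<in> ?\<kappa> ` half_space"
    then obtain z where z: "z \<in> half_space" "p = ?\<kappa> z" by blast
    show "p \<in> U" unfolding z(2) U[OF n1 n2[OF z(1)]]
      using inversion_inversion(2)[OF ne] inversion_inversion(2)[OF ne2[OF z(1)]] ss by simp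
  qed
  show "?\<kappa> (?\<phi> p) = p" if pU: "p \<in> U" for p
  proof -
    obtain a c where ac: "norm a = 1" "norm c \<le> 1" "p = tube (a, c)" "tube_coords p = (a, c)"
      "s *\<^sub>R a \<noteq> - (1, 0)" "t *\<^sub>R c \<noteq> - (1, 0)" using Uobt[OF pU] by blast
    have "fst (inversion (s *\<^sub>R a)) = 0" using inversion_half_space(2)[OF ac(5)] ac(1) ss by simp
    then have "(0, snd (inversion (s *\<^sub>R a))) = inversion (s *\<^sub>R a)" by (simp add: prod_eq_iff)
    then show ?thesis
      using ac(3,4) inversion_inversion(1)[OF ac(5)] inversion_inversion(1)[OF ac(6)] ss by simp
  qed
  show "?\<phi> (?\<kappa> z) = z" if z: "z \<in> half_space" for z
  proof -
    have coords: "tube_coords (?\<kappa> z) = (s *\<^sub>R inversion (0, snd z $ 1), t *\<^sub>R inversion (fst z, snd z $ 2))"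
      using n1 n2[OF z] by (intro tube_properties(1)) auto
    have "inversion (s *\<^sub>R s *\<^sub>R inversion (0, snd z $ 1)) = (0, snd z $ 1)"
      "inversion (t *\<^sub>R t *\<^sub>R inversion (fst z, snd z $ 2)) = (fst z, snd z $ 2)"
      unfolding scaleR_scaleR ss scaleR_one
      by (rule inversion_inversion(1)[OF ne], rule inversion_inversion(1)[OF ne2[OF z]])
    then have "?\<phi> (?\<kappa> z) = (fst z, vector [snd z $ 1, snd z $ 2])"
      unfolding coords fst_conv snd_conv by (simp only: fst_conv snd_conv)
    also have "\<dots> = z" by (simp add: prod_eq_iff vec_eq_iff forall_2)
    finally show ?thesis .
  qed
  show "smooth_on U ?\<phi>"
  proof (rule smooth_onI[OF op\<Omega> U\<Omega>])
    fix k
    have C: "Ck_on k \<Omega> tube_coords" by (rule Ck_on_subset[OF Ck_on_tube_coords]) (auto simp: \<Omega>_def)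
    have "Ck_on k \<Omega> (\<lambda>p. inversion (s *\<^sub>R fst (tube_coords p)))"
      by (intro Ck_on_inversion Ck_on_scaleR Ck_on_const Ck_on_fst C op\<Omega>) (simp add: \<Omega>_def)
    moreover have "Ck_on k \<Omega> (\<lambda>p. inversion (t *\<^sub>R snd (tube_coords p)))"
      by (intro Ck_on_inversion Ck_on_scaleR Ck_on_const Ck_on_snd C op\<Omega>) (simp add: \<Omega>_def)
    ultimately show "Ck_on k \<Omega> ?\<phi>" by (intro Ck_on_Pair Ck_on_vector_2 Ck_on_fst Ck_on_snd op\<Omega>)
  qed
  have opH: "open {z :: real \<times> (real^2). -1 < fst z}" by (intro open_Collect_less continuous_intros)
  show "smooth_on half_space ?\<kappa>"
  proof (rule smooth_onI[OF opH])
    fix k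
    have "Ck_on k {z :: real \<times> (real^2). -1 < fst z} (\<lambda>z. (s *\<^sub>R inversion (0, snd z $ 1), t *\<^sub>R inversion (fst z, snd z $ 2)))"
      by (intro Ck_on_Pair Ck_on_scaleR Ck_on_inversion Ck_on_const Ck_on_nth Ck_on_fst Ck_on_snd Ck_on_ident opH) auto
    then show "Ck_on k {z :: real \<times> (real^2). -1 < fst z} ?\<kappa>"
      by (rule Ck_on_compose[OF opH _ Ck_on_tube]) simp
  qed (auto simp: half_space_def)
  show "fst (?\<phi> p) = 0 \<longleftrightarrow> p \<in> filling_boundary" if pU: "p \<in> U" for p
  proof -
    obtain a c where ac: "norm a = 1" "norm c \<le> 1" "p = tube (a, c)" "tube_coords p = (a, c)"
      "s *\<^sub>R a \<noteq> - (1, 0)" "t *\<^sub>R c \<noteq> - (1, 0)" using Uobt[OF pU] by blast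
    have "fst (?\<phi> p) = 0 \<longleftrightarrow> norm c = 1" using inversion_half_space(2)[OF ac(6)] ac(4) ss by simp
    also have "\<dots> \<longleftrightarrow> p \<in> filling_boundary"
    proof
      assume "norm c = 1"
      then show "p \<in> filling_boundary" using ac by (auto simp: filling_boundary_def)
    next
      assume pb: "p \<in> filling_boundary"
      have "p \<notin> sphere 0 1" using pU by (auto simp: U_def)
      then obtain ac' where ac': "ac' \<in> sphere 0 1 \<times> sphere 0 1" "p = tube ac'" using pb by (auto simp: filling_boundary_def)
      then have "ac' = (a, c)" using tube_properties(1)[of ac'] ac(4) by auto
      then show "norm c = 1" using ac' by auto
    qed
    finally show ?thesis .
  qed
qed simp

lemma filling_charted: "half_charted TYPE(real^2) filling filling_boundary"
  unfolding half_charted_def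
proof (intro conjI ballI)
  show "filling_boundary \<subseteq> filling" by (auto simp: filling_def filling_boundary_def)
  have sgn: "\<exists>s. (s = 1 \<or> s = (-1 :: real)) \<and> s *\<^sub>R x \<noteq> - (1, 0)" for x :: "real \<times> 'e::euclidean_space"
  proof (cases "x = - (1, 0)")
    case True
    then show ?thesis by (intro exI[of _ "-1"]) simp
  next
    case False
    then show ?thesis by (intro exI[of _ 1]) simp
  qed
  fix p assume p: "p \<in> filling"
  show "\<exists>U (\<phi> :: real \<times> (real^2) \<Rightarrow> real \<times> (real^2)). (U, \<phi>) \<in> half_atlas filling filling_boundary \<and> p \<in> U"
  proof (cases "norm p < 3/2")
    case True
    obtain s where s: "s = 1 \<or> s = (-1 :: real)" "s *\<^sub>R p \<noteq> - (1, 0)" using sgn[of p] by blast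
    then show ?thesis using ball_chart[OF s(1)] True p by blast
  next
    case False
    obtain s where s: "s = 1 \<or> s = (-1 :: real)" "s *\<^sub>R fst (tube_coords p) \<noteq> - (1, 0)" using sgn by blast
    obtain t where t: "t = 1 \<or> t = (-1 :: real)" "t *\<^sub>R snd (tube_coords p) \<noteq> - (1, 0)" using sgn by blast
    have "1 < norm p" using False by simp
    then obtain a c where "norm a = 1" "norm c \<le> 1" "p = tube (a, c)" by (rule far_point_of_filling[OF p])
    then have "3/2 < norm p" using tube_properties(3)[of "(a, c)"] by simp
    then show ?thesis using tube_chart[OF s(1) t(1)] s(2) t(2) p by blast
  qed
qed

lemma compact_filling: "compact filling"
proof -
  have "continuous_on UNIV tube" using Ck_on_tube[of 0] by simp
  then have "compact (tube ` (sphere 0 1 \<times> cball 0 1))"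
    by (rule compact_continuous_image[OF continuous_on_subset[OF _ subset_UNIV]])
       (intro compact_Times compact_sphere compact_cball)
  then show ?thesis unfolding filling_def by (intro compact_Un compact_cball)
qed

lemma filling_boundary_parts:
  "openin (top_of_set filling_boundary) (sphere 0 1)"
  "openin (top_of_set filling_boundary) (tube ` (sphere 0 1 \<times> sphere 0 1))"
  "sphere 0 1 \<inter> tube ` (sphere 0 1 \<times> sphere 0 1) = {}"
proof -
  have far: "2 \<le> norm p" if "p \<in> tube ` (sphere 0 1 \<times> sphere 0 1)" for p
    using tube_properties(3) that by force
  then show "sphere 0 1 \<inter> tube ` (sphere 0 1 \<times> sphere 0 1) = {}" by force
  have "sphere 0 1 = filling_boundary \<inter> ball 0 (3/2)" using far by (force simp: filling_boundary_def)
  then show "openin (top_of_set filling_boundary) (sphere 0 1)" by (metis openin_open_Int open_ball)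
  have "tube ` (sphere 0 1 \<times> sphere 0 1) = filling_boundary \<inter> - cball 0 (3/2)"
    using far by (force simp: filling_boundary_def)
  then show "openin (top_of_set filling_boundary) (tube ` (sphere 0 1 \<times> sphere 0 1))"
    by (metis openin_open_Int open_Compl closed_cball)
qed

definition to_antidiagonal :: "real \<times> (real^2) \<Rightarrow> (real^3) \<times> (real^3)" where
  "to_antidiagonal p = (vector [fst p, snd p $ 1, snd p $ 2], - vector [fst p, snd p $ 1, snd p $ 2])"

definition from_antidiagonal :: "(real^3) \<times> (real^3) \<Rightarrow> real \<times> (real^2)" where
  "from_antidiagonal y = (fst y $ 1, vector [fst y $ 2, fst y $ 3])"

interpretation sphere_part: boundary_part "TYPE(real^2)" filling filling_boundary "sphere 0 1" antidiagonal
  to_antidiagonal from_antidiagonal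
proof
  show "half_charted TYPE(real^2) filling filling_boundary" by (rule filling_charted)
  show "openin (top_of_set filling_boundary) (sphere 0 1)" by (rule filling_boundary_parts)
  show "smooth_on (sphere 0 1) to_antidiagonal" unfolding to_antidiagonal_def[abs_def]
    by (intro smooth_onI[OF open_UNIV subset_UNIV] Ck_on_Pair Ck_on_uminus Ck_on_vector_3 Ck_on_fst Ck_on_nth Ck_on_snd
        Ck_on_ident open_UNIV)
  show "smooth_on antidiagonal from_antidiagonal" unfolding from_antidiagonal_def[abs_def]
    by (intro smooth_onI[OF open_UNIV subset_UNIV] Ck_on_Pair Ck_on_vector_2 Ck_on_fst Ck_on_nth Ck_on_ident open_UNIV)
  show "to_antidiagonal ` sphere 0 1 \<subseteq> antidiagonal"
    by (auto simp: to_antidiagonal_def antidiagonal_def norm_eq_sqrt_inner inner_vec_def sum_2 sum_3 inner_prod_def)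
  show "from_antidiagonal ` antidiagonal \<subseteq> sphere 0 1"
    by (auto simp: from_antidiagonal_def antidiagonal_def norm_eq_sqrt_inner inner_vec_def sum_2 sum_3 inner_prod_def)
  show "from_antidiagonal (to_antidiagonal p) = p" for p
    by (simp add: from_antidiagonal_def to_antidiagonal_def prod_eq_iff vec_eq_iff forall_2)
  show "to_antidiagonal (from_antidiagonal y) = y" if "y \<in> antidiagonal" for y
    using that by (auto simp: from_antidiagonal_def to_antidiagonal_def antidiagonal_def vec_eq_iff forall_3)
qed

definition to_clifford :: "real \<times> (real^2) \<Rightarrow> (real^3) \<times> (real^3)" where
  "to_clifford p = (vector [fst (fst (tube_coords p)), snd (fst (tube_coords p)), 0],
                    vector [fst (snd (tube_coords p)), snd (snd (tube_coords p)), 0])"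

definition from_clifford :: "(real^3) \<times> (real^3) \<Rightarrow> real \<times> (real^2)" where
  "from_clifford y = tube ((fst y $ 1, fst y $ 2), (snd y $ 1, snd y $ 2))"

lemma equator_iff: "y \<in> equator \<longleftrightarrow> norm (y $ 1, y $ 2) = 1 \<and> y $ 3 = 0"
  by (auto simp: equator_def norm_eq_sqrt_inner inner_vec_def sum_3 inner_prod_def)

interpretation torus_part: boundary_part "TYPE(real^2)" filling filling_boundary "tube ` (sphere 0 1 \<times> sphere 0 1)"
  clifford_torus to_clifford from_clifford
proof
  show "half_charted TYPE(real^2) filling filling_boundary" by (rule filling_charted)
  show "openin (top_of_set filling_boundary) (tube ` (sphere 0 1 \<times> sphere 0 1))" by (rule filling_boundary_parts)
  have coords: "tube_coords (tube ac) = ac" "snd (tube ac) \<noteq> 0" if "ac \<in> sphere 0 1 \<times> sphere 0 1" for ac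
    using tube_properties that by auto
  show "smooth_on (tube ` (sphere 0 1 \<times> sphere 0 1)) to_clifford"
  proof (rule smooth_onI[OF open_snd_ne_0[of 0]])
    show "Ck_on k {p. snd p \<noteq> 0} to_clifford" for k
      unfolding to_clifford_def[abs_def]
      by (intro Ck_on_Pair Ck_on_vector_3 Ck_on_fst Ck_on_snd Ck_on_const Ck_on_tube_coords open_snd_ne_0)
  qed (use coords in auto)
  show "smooth_on clifford_torus from_clifford"
  proof (rule smooth_onI[OF open_UNIV subset_UNIV])
    fix k
    have "Ck_on k UNIV (\<lambda>y :: (real^3) \<times> (real^3). ((fst y $ 1, fst y $ 2), (snd y $ 1, snd y $ 2)))"
      by (intro Ck_on_Pair Ck_on_nth Ck_on_fst Ck_on_snd Ck_on_ident open_UNIV)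
    from Ck_on_compose[OF open_UNIV this Ck_on_tube] show "Ck_on k UNIV from_clifford"
      unfolding from_clifford_def[abs_def] by blast
  qed
  show "to_clifford ` tube ` (sphere 0 1 \<times> sphere 0 1) \<subseteq> clifford_torus"
  proof (rule image_subsetI)
    fix p assume "p \<in> tube ` (sphere 0 1 \<times> sphere 0 1)"
    then obtain ac where ac: "p = tube ac" "ac \<in> sphere 0 1 \<times> sphere 0 1" by blast
    then show "to_clifford p \<in> clifford_torus"
      using coords(1)[OF ac(2)] by (auto simp: to_clifford_def clifford_torus_def equator_iff)
  qed
  show "from_clifford ` clifford_torus \<subseteq> tube ` (sphere 0 1 \<times> sphere 0 1)"
    by (auto simp: from_clifford_def clifford_torus_def equator_iff)
  show "from_clifford (to_clifford p) = p" if "p \<in> tube ` (sphere 0 1 \<times> sphere 0 1)" for p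
    using that coords by (auto simp: from_clifford_def to_clifford_def)
  show "to_clifford (from_clifford y) = y" if "y \<in> clifford_torus" for y
  proof -
    have y: "((fst y $ 1, fst y $ 2), (snd y $ 1, snd y $ 2)) \<in> sphere 0 1 \<times> sphere 0 1" "fst y $ 3 = 0" "snd y $ 3 = 0"
      using that by (auto simp: clifford_torus_def equator_iff)
    then show ?thesis using coords(1)[OF y(1)]
      by (simp add: from_clifford_def to_clifford_def prod_eq_iff vec_eq_iff forall_3)
  qed
qed

lemma antidiagonal_cobordant_clifford_torus:
  "cobordant (submanifold antidiagonal :: ((real^3) \<times> (real^3), real^2) manifold) (submanifold clifford_torus)"
proof -
  let ?Y = "domain_manifold filling filling_boundary :: (real \<times> (real^2), real \<times> (real^2)) manifold"
  have "compact antidiagonal"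
  proof -
    have "antidiagonal = (\<lambda>x. (x, - x)) ` S2" by (auto simp: antidiagonal_def)
    moreover have "compact ((\<lambda>x :: real^3. (x, - x)) ` S2)"
      by (intro compact_continuous_image continuous_intros compact_sphere)
    ultimately show ?thesis by simp
  qed
  moreover have "compact clifford_torus"
  proof -
    have "equator = S2 \<inter> {x. x $ 3 = 0}" by (auto simp: equator_def)
    moreover have "closed {x :: real^3. x $ 3 = 0}" by (intro closed_Collect_eq continuous_intros)
    ultimately have "compact equator" by (metis compact_Int_closed compact_sphere)
    then show ?thesis unfolding clifford_torus_def by (intro compact_Times)
  qed
  moreover have "compact_manifold_with_boundary ?Y"
    unfolding compact_manifold_with_boundary_def
    using smooth_manifold_domain_manifold[OF filling_charted] compact_filling
    by (simp add: domain_manifold_def compact_space_subtopology)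
  moreover have bp: "boundary_points ?Y = filling_boundary"
    by (rule boundary_points_domain_manifold[OF filling_charted])
  moreover have "fst (boundary_manifold ?Y) = top_of_set filling_boundary"
  proof -
    have "filling_boundary \<subseteq> filling" using filling_charted by (simp add: half_charted_def)
    then show ?thesis unfolding boundary_manifold_def bp
      by (simp add: domain_manifold_def subtopology_subtopology Int_absorb1)
  qed
  ultimately have "cobordism ?Y (submanifold antidiagonal) (submanifold clifford_torus)"
    unfolding cobordism_def
    using sphere_part.closed_manifold_submanifold torus_part.closed_manifold_submanifold
      sphere_part.diffeomorphic torus_part.diffeomorphic filling_boundary_parts
    by (intro conjI exI[of _ "sphere 0 1"] exI[of _ "tube ` (sphere 0 1 \<times> sphere 0 1)"])
       (simp_all add: filling_boundary_def)
  then show ?thesis unfolding cobordant_def by blast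
qed

section \<open>Symmetry of second derivatives and integration by parts\<close>

lemma has_real_derivative_along_line:
  assumes "f differentiable at (p + s *\<^sub>R u)"
  shows "((\<lambda>s. f (p + s *\<^sub>R u)) has_real_derivative
           frechet_derivative f (at (p + s *\<^sub>R u)) u) (at s)"
proof -
  have lin: "linear (frechet_derivative f (at (p + s *\<^sub>R u)))"
    using assms by (rule linear_frechet_derivative)
  have "((\<lambda>s. p + s *\<^sub>R u) has_derivative (\<lambda>h. h *\<^sub>R u)) (at s)"
    by (auto intro!: derivative_eq_intros)
  from diff_chain_at[OF this frechet_derivative_works[THEN iffD1, OF assms]]
  have "((\<lambda>s. f (p + s *\<^sub>R u)) has_derivative
      (\<lambda>h. frechet_derivative f (at (p + s *\<^sub>R u)) (h *\<^sub>R u))) (at s)"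
    by (simp add: o_def)
  then show ?thesis
    unfolding has_field_derivative_def by (simp add: linear_cmul[OF lin] mult_commute_abs)
qed

text \<open>The left-hand side of the equation is symmetric in \<open>u\<close> and \<open>v\<close>, the right-hand side is not; the
  symmetry of second derivatives follows for \<open>t\<close> tending to 0. The equation itself is the mean value
  theorem, applied once in each direction.\<close>

lemma second_difference:
  fixes f :: "'a::euclidean_space \<Rightarrow> real"
  assumes f: "Ck_on 2 (ball x d) f" and t: "0 < t" "t * (norm u + norm v) < d"
  shows "\<exists>a b. 0 < a \<and> a < t \<and> 0 < b \<and> b < t \<and>
      f (x + t *\<^sub>R u + t *\<^sub>R v) - f (x + t *\<^sub>R u) - f (x + t *\<^sub>R v) + f x =
      t * t * frechet_derivative (\<lambda>p. frechet_derivative f (at p) u) (at (x + a *\<^sub>R u + b *\<^sub>R v)) v"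
proof -
  have inb: "x + a *\<^sub>R u + b *\<^sub>R v \<in> ball x d" if "0 \<le> a" "a \<le> t" "0 \<le> b" "b \<le> t" for a b
  proof -
    have "norm (a *\<^sub>R u + b *\<^sub>R v) \<le> t * norm u + t * norm v"
      using that by (intro norm_triangle_le add_mono) (auto intro: mult_right_mono)
    also have "\<dots> < d" using t by (simp add: distrib_left)
    finally show ?thesis
      using norm_minus_cancel[of "a *\<^sub>R u + b *\<^sub>R v"] by (simp add: dist_norm)
  qed
  have df: "f differentiable at p" and ddf: "(\<lambda>p. frechet_derivative f (at p) u) differentiable at p"
    if "p \<in> ball x d" for p
    using f that by (auto simp: numeral_2_eq_2)
  let ?Du = "\<lambda>p. frechet_derivative f (at p) u"
  have "\<exists>a. 0 < a \<and> a < t \<and>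
     (f (x + t *\<^sub>R v + t *\<^sub>R u) - f (x + t *\<^sub>R u)) - (f (x + t *\<^sub>R v + 0 *\<^sub>R u) - f (x + 0 *\<^sub>R u)) =
     (t - 0) * (?Du (x + t *\<^sub>R v + a *\<^sub>R u) - ?Du (x + a *\<^sub>R u))"
  proof (rule MVT2[OF t(1)])
    fix s assume s: "0 \<le> s" "s \<le> t"
    have "x + t *\<^sub>R v + s *\<^sub>R u \<in> ball x d" "x + s *\<^sub>R u \<in> ball x d"
      using inb[of s t] inb[of s 0] s t by (auto simp: add_ac)
    then show "((\<lambda>s. f (x + t *\<^sub>R v + s *\<^sub>R u) - f (x + s *\<^sub>R u)) has_real_derivative
       ?Du (x + t *\<^sub>R v + s *\<^sub>R u) - ?Du (x + s *\<^sub>R u)) (at s)"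
      by (intro DERIV_diff has_real_derivative_along_line df)
  qed
  then obtain a where a: "0 < a" "a < t" and 1:
    "f (x + t *\<^sub>R v + t *\<^sub>R u) - f (x + t *\<^sub>R u) - (f (x + t *\<^sub>R v) - f x) =
     t * (?Du (x + t *\<^sub>R v + a *\<^sub>R u) - ?Du (x + a *\<^sub>R u))"
    by auto
  have "\<exists>b. 0 < b \<and> b < t \<and>
     ?Du (x + a *\<^sub>R u + t *\<^sub>R v) - ?Du (x + a *\<^sub>R u + 0 *\<^sub>R v) =
     (t - 0) * frechet_derivative ?Du (at (x + a *\<^sub>R u + b *\<^sub>R v)) v"
  proof (rule MVT2[OF t(1)])
    fix s assume "0 \<le> s" "s \<le> t"
    then have "x + a *\<^sub>R u + s *\<^sub>R v \<in> ball x d" using inb a by simp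
    then show "((\<lambda>s. ?Du (x + a *\<^sub>R u + s *\<^sub>R v)) has_real_derivative
        frechet_derivative ?Du (at (x + a *\<^sub>R u + s *\<^sub>R v)) v) (at s)"
      by (rule has_real_derivative_along_line[OF ddf])
  qed
  then obtain b where b: "0 < b" "b < t" and 2:
    "?Du (x + a *\<^sub>R u + t *\<^sub>R v) - ?Du (x + a *\<^sub>R u) =
     t * frechet_derivative ?Du (at (x + a *\<^sub>R u + b *\<^sub>R v)) v"
    by auto
  show ?thesis using a b 1 2 by (intro exI[of _ a] exI[of _ b]) (simp add: add_ac)
qed

lemma second_derivative_symmetric_real:
  fixes f :: "'a::euclidean_space \<Rightarrow> real"
  assumes U: "open U" "x \<in> U" and f: "Ck_on 2 U f"
  shows "frechet_derivative (\<lambda>p. frechet_derivative f (at p) u) (at x) v =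
         frechet_derivative (\<lambda>p. frechet_derivative f (at p) v) (at x) u"
    (is "?A x = ?B x")
proof (rule ccontr)
  assume ne: "?A x \<noteq> ?B x"
  define e where "e = \<bar>?A x - ?B x\<bar> / 2"
  have e: "0 < e" using ne by (simp add: e_def)
  have "continuous_on U ?A" "continuous_on U ?B"
    using f by (simp_all add: numeral_2_eq_2)
  then have cA: "isCont ?A x" and cB: "isCont ?B x"
    using U continuous_on_eq_continuous_at by blast+
  obtain dA where dA: "0 < dA" "\<And>y. dist y x < dA \<Longrightarrow> dist (?A y) (?A x) < e"
    using cA[unfolded continuous_at_eps_delta, THEN spec, THEN mp, OF e] by (elim exE conjE) blast
  obtain dB where dB: "0 < dB" "\<And>y. dist y x < dB \<Longrightarrow> dist (?B y) (?B x) < e"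
    using cB[unfolded continuous_at_eps_delta, THEN spec, THEN mp, OF e] by (elim exE conjE) blast
  obtain dU where dU: "0 < dU" "ball x dU \<subseteq> U" using U openE by blast
  define d where "d = min dU (min dA dB)"
  have d: "0 < d" using dA dB dU by (simp add: d_def)
  define t where "t = d / (2 * (norm u + norm v + 1))"
  have n: "0 < norm u + norm v + 1" by (simp add: add_nonneg_pos)
  have t: "0 < t" using d n by (simp add: t_def)
  have "t * (norm u + norm v) \<le> t * (norm u + norm v + 1)" using t by simp
  also have "\<dots> = d / 2" using n by (simp add: t_def field_simps)
  also have "\<dots> < d" using d by simp
  finally have td: "t * (norm u + norm v) < d" .
  have "ball x d \<subseteq> U" using dU(2) by (auto simp: d_def)
  with f have fb: "Ck_on 2 (ball x d) f" by (rule Ck_on_subset)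
  obtain a b where ab: "0 < a" "a < t" "0 < b" "b < t"
    and 1: "f (x + t *\<^sub>R u + t *\<^sub>R v) - f (x + t *\<^sub>R u) - f (x + t *\<^sub>R v) + f x = t * t * ?A (x + a *\<^sub>R u + b *\<^sub>R v)"
    using second_difference[OF fb t td] by blast
  obtain a' b' where ab': "0 < a'" "a' < t" "0 < b'" "b' < t"
    and 2: "f (x + t *\<^sub>R v + t *\<^sub>R u) - f (x + t *\<^sub>R v) - f (x + t *\<^sub>R u) + f x = t * t * ?B (x + a' *\<^sub>R v + b' *\<^sub>R u)"
    using second_difference[OF fb t, of v u] td by (auto simp: add_ac)
  have near: "dist (x + r *\<^sub>R p + s *\<^sub>R q) x < d"
    if "0 < r" "r < t" "0 < s" "s < t" "t * (norm p + norm q) < d" for r s and p q :: 'a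
  proof -
    have "norm (r *\<^sub>R p + s *\<^sub>R q) \<le> t * norm p + t * norm q"
      using that by (intro norm_triangle_le add_mono) (auto intro: mult_right_mono)
    also have "\<dots> < d" using that by (simp add: distrib_left)
    finally show ?thesis by (simp add: dist_norm add.assoc)
  qed
  have "t * t * ?A (x + a *\<^sub>R u + b *\<^sub>R v) = t * t * ?B (x + a' *\<^sub>R v + b' *\<^sub>R u)"
    using 1 2 unfolding add.assoc[of x] add.commute[of "t *\<^sub>R v"] by linarith
  then have "?A (x + a *\<^sub>R u + b *\<^sub>R v) = ?B (x + a' *\<^sub>R v + b' *\<^sub>R u)" using t by simp
  moreover have "dist (?A (x + a *\<^sub>R u + b *\<^sub>R v)) (?A x) < e"
    using near[OF ab td] by (intro dA(2)) (simp add: d_def)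
  moreover have "dist (?B (x + a' *\<^sub>R v + b' *\<^sub>R u)) (?B x) < e"
    using near[OF ab', of v u] td by (intro dB(2)) (simp add: d_def add.commute)
  ultimately show False
    unfolding e_def dist_real_def by argo
qed


lemma frechet_derivative_linear_compose:
  fixes f :: "'a::real_normed_vector \<Rightarrow> 'b::euclidean_space" and L :: "'b \<Rightarrow> 'c::real_normed_vector"
  assumes "linear L" "f differentiable at x"
  shows "frechet_derivative (\<lambda>x. L (f x)) (at x) v = L (frechet_derivative f (at x) v)"
proof -
  have "((\<lambda>x. L (f x)) has_derivative (\<lambda>v. L (frechet_derivative f (at x) v))) (at x)"
    by (rule bounded_linear.has_derivative[OF _ frechet_derivative_works[THEN iffD1, OF assms(2)]])
      (rule assms(1)[unfolded linear_conv_bounded_linear])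
  from frechet_derivative_at[OF this] show ?thesis by metis
qed

lemma second_derivative_symmetric:
  fixes f :: "'a::euclidean_space \<Rightarrow> 'b::euclidean_space"
  assumes U: "open U" "x \<in> U" and f: "Ck_on 2 U f"
  shows "frechet_derivative (\<lambda>p. frechet_derivative f (at p) u) (at x) v =
         frechet_derivative (\<lambda>p. frechet_derivative f (at p) v) (at x) u"
proof (rule euclidean_eqI)
  fix b :: 'b assume "b \<in> Basis"
  have lin: "linear (\<lambda>y::'b. y \<bullet> b)" by (auto intro!: linearI simp: inner_add_left)
  have d1: "f differentiable at p" and d2: "(\<lambda>p. frechet_derivative f (at p) w) differentiable at p"
    if "p \<in> U" for p w
    using f that by (auto simp: numeral_2_eq_2)
  have *: "frechet_derivative (\<lambda>p. frechet_derivative (\<lambda>x. f x \<bullet> b) (at p) u) (at x) v =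
      frechet_derivative (\<lambda>p. frechet_derivative f (at p) u) (at x) v \<bullet> b" for u v
  proof -
    have "frechet_derivative (\<lambda>p. frechet_derivative f (at p) u \<bullet> b) (at x) =
        frechet_derivative (\<lambda>p. frechet_derivative (\<lambda>x. f x \<bullet> b) (at p) u) (at x)"
    proof (rule frechet_derivative_transform_within_open[OF _ U])
      show "(\<lambda>p. frechet_derivative f (at p) u \<bullet> b) differentiable at x"
        using d2[OF U(2)] by (intro differentiable_inner) auto
      show "frechet_derivative f (at p) u \<bullet> b = frechet_derivative (\<lambda>x. f x \<bullet> b) (at p) u"
        if "p \<in> U" for p
        using frechet_derivative_linear_compose[OF lin d1[OF that]] by simp
    qed
    then show ?thesis
      using frechet_derivative_linear_compose[OF lin d2[OF U(2)], of u v] by simp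
  qed
  have "Ck_on 2 U (\<lambda>x. f x \<bullet> b)" by (rule Ck_on_linear_compose[OF U(1) lin f])
  from second_derivative_symmetric_real[OF U this, of u v]
  show "frechet_derivative (\<lambda>p. frechet_derivative f (at p) u) (at x) v \<bullet> b =
      frechet_derivative (\<lambda>p. frechet_derivative f (at p) v) (at x) u \<bullet> b"
    by (simp add: *)
qed

text \<open>By translation invariance all difference quotients have integral 0, and they converge boundedly
  to the derivative.\<close>

lemma integral_directional_derivative_0:
  fixes h :: "'a::euclidean_space \<Rightarrow> real"
  assumes h: "Ck_on 1 UNIV h" and K: "compact K" "\<And>x. x \<notin> K \<Longrightarrow> h x = 0"
  shows "((\<lambda>x. frechet_derivative h (at x) v) has_integral 0) UNIV"
proof -
  let ?D = "\<lambda>x. frechet_derivative h (at x) v"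
  have dh: "h differentiable at x" for x using h by simp
  have cD: "continuous_on UNIV ?D" using h by simp
  have ch: "continuous_on UNIV h" using Ck_on_Suc_lower[of 0 UNIV h] h by simp
  define L where "L = (\<lambda>(x, s). x - s *\<^sub>R v) ` (K \<times> {0..1::real})"
  have L: "compact L"
    unfolding L_def split_def by (intro compact_continuous_image compact_Times K continuous_intros) auto
  have KL: "x + s *\<^sub>R v \<notin> K" if "x \<notin> L" "s \<in> {0..1}" for x s
    using that by (force simp: L_def image_iff)
  define P where "P = (\<lambda>(x, s). x + s *\<^sub>R v) ` (L \<times> {0..1::real})"
  have P: "compact P"
    unfolding P_def split_def by (intro compact_continuous_image compact_Times L continuous_intros) auto
  have "bounded (?D ` P)"
    using compact_continuous_image[OF continuous_on_subset[OF cD] P] compact_imp_bounded by blast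
  then obtain M where M: "\<And>x. x \<in> P \<Longrightarrow> \<bar>?D x\<bar> \<le> M"
    by (auto simp: bounded_iff)
  let ?q = "\<lambda>n x. (h (x + (1 / real (Suc n)) *\<^sub>R v) - h x) * real (Suc n)"
  have bnd: "\<bar>?q n x\<bar> \<le> indicator L x * M" for n x
  proof (cases "x \<in> L")
    case False
    then have "h (x + (1 / real (Suc n)) *\<^sub>R v) = 0" "h x = 0"
      using KL[of x "1 / real (Suc n)"] KL[of x 0] K by (auto simp del: of_nat_Suc)
    then show ?thesis using False by simp
  next
    case True
    have "\<exists>s. 0 < s \<and> s < 1 / real (Suc n) \<and>
        h (x + (1 / real (Suc n)) *\<^sub>R v) - h (x + 0 *\<^sub>R v) = (1 / real (Suc n) - 0) * ?D (x + s *\<^sub>R v)"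
      by (rule MVT2) (auto intro!: has_real_derivative_along_line dh)
    then obtain s where s: "0 < s" "s < 1 / real (Suc n)"
      and eq: "h (x + (1 / real (Suc n)) *\<^sub>R v) - h x = 1 / real (Suc n) * ?D (x + s *\<^sub>R v)"
      by auto
    have "1 / real (Suc n) \<le> 1" by simp
    then have "s \<le> 1" using s by linarith
    then have "x + s *\<^sub>R v \<in> P"
      using s True unfolding P_def by (intro image_eqI[of _ _ "(x, s)"]) auto
    then show ?thesis using M True eq by simp
  qed
  have lim: "(\<lambda>n. ?q n x) \<longlonglongrightarrow> ?D x" for x
  proof -
    have "((\<lambda>s. h (x + s *\<^sub>R v)) has_real_derivative ?D x) (at 0)"
      using has_real_derivative_along_line[of h x 0 v] dh by simp
    then have "((\<lambda>s. (h (x + s *\<^sub>R v) - h x) / s) \<longlongrightarrow> ?D x) (at 0)"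
      by (simp add: has_field_derivative_iff)
    moreover have "filterlim (\<lambda>n. 1 / real (Suc n)) (at 0) sequentially"
      using LIMSEQ_inverse_real_of_nat
      by (auto simp: filterlim_at inverse_eq_divide simp del: of_nat_Suc)
    ultimately have "(\<lambda>n. (h (x + (1 / real (Suc n)) *\<^sub>R v) - h x) / (1 / real (Suc n))) \<longlonglongrightarrow> ?D x"
      by (rule filterlim_compose)
    then show ?thesis by simp
  qed
  have ih: "integrable lborel h"
  proof -
    have "integrable lborel (\<lambda>x. indicator K x *\<^sub>R h x)"
      by (rule borel_integrable_compact[OF K(1) continuous_on_subset[OF ch]]) simp
    moreover have "(\<lambda>x. indicator K x *\<^sub>R h x) = h"
    proof
      show "indicator K x *\<^sub>R h x = h x" for x using K(2) by (cases "x \<in> K") auto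
    qed
    ultimately show ?thesis by simp
  qed
  have shift: "integrable lborel (\<lambda>x. h (x + w))" "integral\<^sup>L lborel (\<lambda>x. h (x + w)) = integral\<^sup>L lborel h" for w
  proof -
    have m: "h \<in> borel_measurable borel" using ch by (rule borel_measurable_continuous_onI)
    have "integral\<^sup>L (distr lborel borel ((+) w)) h = integral\<^sup>L lborel (\<lambda>x. h (w + x))"
      by (rule integral_distr) (auto simp: m)
    then show "integral\<^sup>L lborel (\<lambda>x. h (x + w)) = integral\<^sup>L lborel h"
      by (simp add: lborel_distr_plus add.commute)
    have "integrable (distr lborel borel ((+) w)) h \<longleftrightarrow> integrable lborel (\<lambda>x. h (w + x))"
      by (rule integrable_distr_eq) (auto simp: m)
    then show "integrable lborel (\<lambda>x. h (x + w))"
      using ih by (simp add: lborel_distr_plus add.commute)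
  qed
  have q0: "integral\<^sup>L lborel (?q n) = 0" for n
    using ih shift by (simp del: of_nat_Suc)
  have wL: "integrable lborel (\<lambda>x. indicator L x * M)"
    using borel_integrable_compact[OF L, of "\<lambda>x. M"] by simp
  have mD: "?D \<in> borel_measurable lborel"
    using cD by (simp add: borel_measurable_continuous_onI)
  have mq: "?q n \<in> borel_measurable lborel" for n
    by (intro borel_measurable_continuous_onI continuous_intros continuous_on_compose2[OF ch] | simp)+
  have int: "integrable lborel ?D"
    by (rule integrable_dominated_convergence[where s = ?q and w = "\<lambda>x. indicator L x * M"])
       (use mD mq wL lim bnd in auto)
  have "(\<lambda>n. integral\<^sup>L lborel (?q n)) \<longlonglongrightarrow> integral\<^sup>L lborel ?D"
    by (rule integral_dominated_convergence[where w = "\<lambda>x. indicator L x * M"])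
       (use mD mq wL lim bnd in auto)
  then have "integral\<^sup>L lborel ?D = 0"
    unfolding q0 by (simp add: LIMSEQ_const_iff)
  then show ?thesis using has_integral_integral_lborel[OF int] by simp
qed

section \<open>Invariance of the degree integral in three-space\<close>

abbreviation dcol :: "(real^3 \<Rightarrow> real^3) \<Rightarrow> 3 \<Rightarrow> real^3 \<Rightarrow> real^3" where
  "dcol G j x \<equiv> frechet_derivative G (at x) (axis j 1)"

text \<open>The vector field with divergence \<open>\<phi>(G) det DG\<close>, where \<open>\<phi> = \<partial>\<^sub>1 \<psi>\<close>: the first row of the cofactor
  matrix of \<open>DG\<close>, multiplied by \<open>\<psi>(G)\<close>. The indices of type \<open>3\<close> are cyclic, so \<open>j + 1\<close> and \<open>j + 2\<close> are
  the two columns other than \<open>j\<close> in the order that gives the cofactor its sign.\<close>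

definition degree_field :: "(real^3 \<Rightarrow> real) \<Rightarrow> (real^3 \<Rightarrow> real^3) \<Rightarrow> 3 \<Rightarrow> real^3 \<Rightarrow> real" where
  "degree_field \<psi> G j x = \<psi> (G x) *
     (dcol G (j + 1) x $ 2 * dcol G (j + 2) x $ 3 - dcol G (j + 2) x $ 2 * dcol G (j + 1) x $ 3)"

lemma Ck_on_degree_field:
  assumes "open O'" "Ck_on 2 O' G" "Ck_on 1 UNIV \<psi>"
  shows "Ck_on 1 O' (degree_field \<psi> G j)"
proof -
  have G1: "Ck_on 1 O' G" using Ck_on_Suc_lower[of 1 O' G] assms(2) by (simp add: numeral_2_eq_2)
  have col: "Ck_on 1 O' (dcol G k)" for k using assms(2) by (simp add: numeral_2_eq_2)
  have "Ck_on 1 O' (\<lambda>x. \<psi> (G x))" by (rule Ck_on_compose[OF assms(1) G1 assms(3)]) simp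
  then show ?thesis
    unfolding degree_field_def[abs_def]
    by (intro Ck_on_mult Ck_on_diff Ck_on_nth assms(1) col)
qed

text \<open>The cofactor row has divergence 0 because second derivatives are symmetric. What remains is the
  derivative of \<open>\<psi>(G)\<close> against the cofactors of the first row: the determinant for the partial
  derivative \<open>\<partial>\<^sub>1 \<psi>\<close>, and determinants with a repeated row for the other two.\<close>

lemma divergence_degree_field:
  assumes O': "open O'" "x \<in> O'" and G: "Ck_on 2 O' G" and \<psi>: "Ck_on 1 UNIV \<psi>"
  shows "(\<Sum>j\<in>UNIV. frechet_derivative (degree_field \<psi> G j) (at x) (axis j 1)) =
     frechet_derivative \<psi> (at (G x)) (axis 1 1) * det (matrix (frechet_derivative G (at x)))"
proof -
  define H where "H j k = frechet_derivative (dcol G j) (at x) (axis k 1)" for j k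
  have Hsym: "H j k = H k j" for j k
    unfolding H_def by (rule second_derivative_symmetric[OF O' G])
  have dG: "G differentiable at x" and dcol: "dcol G j differentiable at x" for j
    using G O' by (auto simp: numeral_2_eq_2)
  have d\<psi>: "\<psi> differentiable at p" for p using \<psi> by simp
  define p where "p = frechet_derivative \<psi> (at (G x))"
  have linp: "linear p" unfolding p_def by (rule linear_frechet_derivative[OF d\<psi>])
  have Dcol: "((\<lambda>y. dcol G j y $ i) has_derivative (\<lambda>v. frechet_derivative (dcol G j) (at x) v $ i)) (at x)" for i j
    using dcol[of j] by (intro bounded_linear.has_derivative[OF bounded_linear_vec_nth])
      (simp add: frechet_derivative_works[symmetric])
  have D\<psi>: "((\<lambda>y. \<psi> (G y)) has_derivative (\<lambda>v. p (frechet_derivative G (at x) v))) (at x)"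
    using diff_chain_at[OF frechet_derivative_works[THEN iffD1, OF dG] frechet_derivative_works[THEN iffD1, OF d\<psi>]]
    by (simp add: o_def p_def)
  have D: "frechet_derivative (degree_field \<psi> G j) (at x) (axis k 1) =
      \<psi> (G x) * (dcol G (j + 1) x $ 2 * H (j + 2) k $ 3 + H (j + 1) k $ 2 * dcol G (j + 2) x $ 3
        - (dcol G (j + 2) x $ 2 * H (j + 1) k $ 3 + H (j + 2) k $ 2 * dcol G (j + 1) x $ 3))
      + p (dcol G k x) * (dcol G (j + 1) x $ 2 * dcol G (j + 2) x $ 3 - dcol G (j + 2) x $ 2 * dcol G (j + 1) x $ 3)"
    for j k
    unfolding degree_field_def[abs_def] H_def
    by (subst frechet_derivative_at[OF has_derivative_mult[OF D\<psi> has_derivative_diff[OF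
          has_derivative_mult[OF Dcol Dcol] has_derivative_mult[OF Dcol Dcol]]], symmetric]) (rule refl)
  have p: "p w = w $ 1 * p (axis 1 1) + w $ 2 * p (axis 2 1) + w $ 3 * p (axis 3 1)" for w
  proof -
    have "p w = p (\<Sum>i\<in>UNIV. w $ i *\<^sub>R axis i 1)"
      by (simp add: basis_expansion flip: scalar_mult_eq_scaleR)
    then show ?thesis by (simp add: linear_add[OF linp] linear_cmul[OF linp] sum_3)
  qed
  have num: "(1::3) + 1 = 2" "(1::3) + 2 = 3" "(2::3) + 1 = 3" "(2::3) + 2 = 1" "(3::3) + 1 = 1" "(3::3) + 2 = 2"
    by simp_all
  define a where "a j = dcol G j x" for j
  have det: "det (matrix (frechet_derivative G (at x))) =
     a 1 $ 1 * a 2 $ 2 * a 3 $ 3 + a 2 $ 1 * a 3 $ 2 * a 1 $ 3 + a 3 $ 1 * a 1 $ 2 * a 2 $ 3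
     - a 1 $ 1 * a 3 $ 2 * a 2 $ 3 - a 2 $ 1 * a 1 $ 2 * a 3 $ 3 - a 3 $ 1 * a 2 $ 2 * a 1 $ 3"
    by (simp add: det_3 matrix_def a_def)
  show ?thesis
    unfolding sum_3 D num det a_def[symmetric] p[of "a 1"] p[of "a 2"] p[of "a 3"] p_def[symmetric]
      Hsym[of 2 1] Hsym[of 3 1] Hsym[of 3 2]
    by algebra
qed

text \<open>The difference of the two degree fields has compact support, so its divergence integrates to 0.\<close>

lemma degree_integral_invariant:
  fixes \<psi> :: "real^3 \<Rightarrow> real"
  assumes O': "open O'" and G: "Ck_on 2 O' G0" "Ck_on 2 O' G1" and \<psi>: "Ck_on 1 UNIV \<psi>"
    and K: "compact K" "K \<subseteq> D" "D \<subseteq> O'" and eq: "\<And>x. x \<in> O' - K \<Longrightarrow> G0 x = G1 x"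
  shows "((\<lambda>x. frechet_derivative \<psi> (at (G0 x)) (axis 1 1) * det (matrix (frechet_derivative G0 (at x)))
     - frechet_derivative \<psi> (at (G1 x)) (axis 1 1) * det (matrix (frechet_derivative G1 (at x))))
     has_integral 0) D" (is "(?I has_integral 0) D")
proof -
  define h where "h j x = (if x \<in> O' then degree_field \<psi> G0 j x - degree_field \<psi> G1 j x else 0)" for j x
  have opK: "open (O' - K)" using O' K by (simp add: open_Diff compact_imp_closed)
  have deq: "frechet_derivative G0 (at x) = frechet_derivative G1 (at x)" if "x \<in> O' - K" for x
    using that G(1) eq by (intro frechet_derivative_transform_within_open[OF _ opK that])
      (auto simp: numeral_2_eq_2)
  have h0: "h j x = 0" if "x \<notin> K" for j x
    using that eq deq by (auto simp: h_def degree_field_def)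
  have hO: "Ck_on 1 O' (h j)" for j
    by (rule Ck_on_cong[OF O' _ Ck_on_diff[OF O' Ck_on_degree_field[OF O' G(1) \<psi>, of j] Ck_on_degree_field[OF O' G(2) \<psi>, of j]]])
       (simp add: h_def)
  have opK': "open (- K)" using K(1) by (simp add: compact_imp_closed open_Compl)
  have hK: "Ck_on 1 (- K) (h j)" for j
  proof (rule Ck_on_cong[OF opK'])
    show "Ck_on 1 (- K) (\<lambda>x::real^3. 0::real)" by (rule Ck_on_const)
  qed (simp add: h0)
  have h: "Ck_on 1 UNIV (h j)" for j
  proof (rule Ck_on_local)
    fix x
    show "\<exists>W. open W \<and> x \<in> W \<and> Ck_on 1 W (h j)"
    proof (cases "x \<in> K")
      case True
      then show ?thesis using hO O' K by (intro exI[of _ O'] conjI) auto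
    next
      case False
      then show ?thesis using hK opK' by (intro exI[of _ "- K"] conjI) auto
    qed
  qed
  have int: "((\<lambda>x. \<Sum>j\<in>UNIV. frechet_derivative (h j) (at x) (axis j 1)) has_integral (\<Sum>j\<in>(UNIV::3 set). 0)) UNIV"
    by (rule has_integral_sum[where f = "\<lambda>j x. frechet_derivative (h j) (at x) (axis j 1)" and i = "\<lambda>j::3. 0"])
       (auto intro: integral_directional_derivative_0[OF h K(1) h0])
  have inO: "(\<Sum>j\<in>UNIV. frechet_derivative (h j) (at x) (axis j 1)) = ?I x" if x: "x \<in> O'" for x
  proof -
    have d: "degree_field \<psi> G0 j differentiable at x" "degree_field \<psi> G1 j differentiable at x" for j
      using Ck_on_degree_field[OF O' G(1) \<psi>, of j] Ck_on_degree_field[OF O' G(2) \<psi>, of j] x by auto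
    have "frechet_derivative (h j) (at x) = frechet_derivative (\<lambda>x. degree_field \<psi> G0 j x - degree_field \<psi> G1 j x) (at x)" for j
    proof (rule frechet_derivative_transform_within_open[OF _ O' x])
      show "h j differentiable at x" using h[of j] by simp
    qed (simp add: h_def)
    also have "\<dots> j = (\<lambda>v. frechet_derivative (degree_field \<psi> G0 j) (at x) v - frechet_derivative (degree_field \<psi> G1 j) (at x) v)" for j
      using d[of j] by (intro frechet_derivative_at[symmetric] has_derivative_diff) (simp_all add: frechet_derivative_works[symmetric])
    finally have "(\<Sum>j\<in>UNIV. frechet_derivative (h j) (at x) (axis j 1)) =
       (\<Sum>j\<in>UNIV. frechet_derivative (degree_field \<psi> G0 j) (at x) (axis j 1)) -
       (\<Sum>j\<in>UNIV. frechet_derivative (degree_field \<psi> G1 j) (at x) (axis j 1))"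
      by (simp add: sum_subtractf)
    then show ?thesis
      by (simp add: divergence_degree_field[OF O' x G(1) \<psi>] divergence_degree_field[OF O' x G(2) \<psi>])
  qed
  have I0: "?I x = 0" if "x \<in> O' - K" for x using that eq deq by simp
  have off: "(\<Sum>j\<in>UNIV. frechet_derivative (h j) (at x) (axis j 1)) = 0" if "x \<notin> K" for x
  proof -
    have "frechet_derivative (h j) (at x) = frechet_derivative (\<lambda>x. 0) (at x)" for j
    proof (rule frechet_derivative_transform_within_open[OF _ opK'])
      show "h j differentiable at x" using h[of j] by simp
    qed (use that h0 in auto)
    also have "\<dots> = (\<lambda>v. 0)" by (rule frechet_derivative_at[symmetric]) simp
    finally show ?thesis by simp
  qed
  have "((\<lambda>x. if x \<in> D then ?I x else 0) has_integral 0) UNIV"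
  proof (rule has_integral_eq[OF _ int[simplified sum.neutral_const]])
    fix x show "(\<Sum>j\<in>UNIV. frechet_derivative (h j) (at x) (axis j 1)) = (if x \<in> D then ?I x else 0)"
      using inO[of x] off[of x] I0[of x] K by auto
  qed
  then show ?thesis by (simp add: has_integral_restrict_UNIV)
qed

section \<open>Parity of preimages is unchanged by compactly supported deformations\<close>

lemma has_real_derivative_max_power:
  "((\<lambda>t. (max 0 t) ^ (n + 2)) has_real_derivative real (n + 2) * (max 0 t) ^ (n + 1)) (at t)"
proof (cases t "0::real" rule: linorder_cases)
  case less
  have "((\<lambda>t. 0) has_real_derivative real (n + 2) * (max 0 t) ^ (n + 1)) (at t)"
    using less by (auto intro!: derivative_eq_intros simp: max_def)
  then show ?thesis
    by (rule DERIV_cong_ev[THEN iffD1, rotated -1])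
       (use less eventually_nhds_in_open[of "{..<0}" t] in \<open>auto elim!: eventually_mono\<close>)
next
  case greater
  have "((\<lambda>t. t ^ (n + 2)) has_real_derivative real (n + 2) * (max 0 t) ^ (n + 1)) (at t)"
    using greater DERIV_pow[of "n + 2" t] by (simp add: max_def)
  then show ?thesis
    by (rule DERIV_cong_ev[THEN iffD1, rotated -1])
       (use greater eventually_nhds_in_open[of "{0<..}" t] in \<open>auto elim!: eventually_mono\<close>)
next
  case equal
  have "((\<lambda>h. (max 0 h) ^ (n + 2) / h) \<longlongrightarrow> 0) (at (0::real))"
  proof (rule Lim_null_comparison)
    show "\<forall>\<^sub>F h in at (0::real). norm ((max 0 h) ^ (n + 2) / h) \<le> \<bar>h\<bar> ^ (n + 1)"
      by (rule always_eventually) (auto simp: max_def abs_mult power_abs intro!: mult_nonpos_nonneg)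
    have "((\<lambda>h. \<bar>h\<bar> ^ (n + 1)) \<longlongrightarrow> \<bar>0::real\<bar> ^ (n + 1)) (at 0)"
      by (intro tendsto_intros)
    then show "((\<lambda>h. \<bar>h\<bar> ^ (n + 1)) \<longlongrightarrow> 0) (at (0::real))" by simp
  qed
  then show ?thesis using equal by (simp add: has_field_derivative_iff)
qed

text \<open>Powers of the positive part are the building blocks for bump functions; finite differentiability
  is enough, as the degree argument needs second derivatives only.\<close>

lemma Ck_on_max_power: "Ck_on k UNIV (\<lambda>t::real. (max 0 t) ^ (k + 1))"
proof (induction k)
  case 0
  then show ?case by (auto intro!: continuous_intros)
next
  case (Suc k)
  have D: "((\<lambda>t. (max 0 t) ^ (k + 2)) has_derivative (\<lambda>v. v * (real (k + 2) * (max 0 t) ^ (k + 1)))) (at t)" for t :: real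
    using has_real_derivative_max_power[of k t]
    unfolding has_field_derivative_def by (simp add: mult_commute_abs)
  have "Ck_on k UNIV (\<lambda>t. v * (real (k + 2) * (max 0 t) ^ (k + 1)))" for v
    by (intro Ck_on_mult Ck_on_const Suc.IH) auto
  moreover have "frechet_derivative (\<lambda>t. (max 0 t) ^ (k + 2)) (at t) v = v * (real (k + 2) * (max 0 t) ^ (k + 1))"
    for t v :: real
    using fun_cong[OF frechet_derivative_at[OF D[of t]], of v] by simp
  moreover have "(\<lambda>t. (max 0 t) ^ (k + 2)) differentiable at t" for t :: real
    using D[of t] unfolding differentiable_def by blast
  ultimately show ?case by simp
qed

text \<open>The test function is a product of three bumps in the coordinates. In the first coordinate the
  bump \<open>b\<close> is a tent, because it needs an explicit primitive \<open>A\<close>; the factors \<open>e\<close> have to be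
  differentiable themselves, as they occur in \<open>\<psi>\<close>.\<close>

lemma exists_degree_test_function:
  fixes y :: "real^3"
  assumes "0 < d"
  obtains \<psi> :: "real^3 \<Rightarrow> real" and c where "Ck_on 1 UNIV \<psi>"
    "\<And>z. z \<notin> ball y d \<Longrightarrow> frechet_derivative \<psi> (at z) (axis 1 1) = 0"
    "(\<lambda>z. frechet_derivative \<psi> (at z) (axis 1 1)) absolutely_integrable_on ball y d"
    "((\<lambda>z. frechet_derivative \<psi> (at z) (axis 1 1)) has_integral c) (ball y d)" "c \<noteq> 0"
proof -
  define r where "r = d / 2"
  have r: "0 < r" using assms by (simp add: r_def)
  define A :: "real \<Rightarrow> real" where "A t = 1 / 2 * ((max 0 (t + r)) ^ 2 - 2 * (max 0 t) ^ 2 + (max 0 (t - r)) ^ 2)" for t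
  define b :: "real \<Rightarrow> real" where "b t = max 0 (t + r) - 2 * max 0 t + max 0 (t - r)" for t
  define e :: "real \<Rightarrow> real" where "e t = (max 0 (r * r - t * t)) ^ 2" for t
  define \<psi> :: "real^3 \<Rightarrow> real" where "\<psi> z = A (z $ 1 - y $ 1) * (e (z $ 2 - y $ 2) * e (z $ 3 - y $ 3))" for z
  define \<phi> :: "real^3 \<Rightarrow> real" where "\<phi> z = b (z $ 1 - y $ 1) * (e (z $ 2 - y $ 2) * e (z $ 3 - y $ 3))" for z
  have sq: "Ck_on 1 UNIV (\<lambda>x. (max 0 (g x)) ^ 2)" if "Ck_on 1 UNIV g" for g :: "real \<Rightarrow> real"
    using Ck_on_compose[OF open_UNIV that Ck_on_max_power[of 1]] by (simp add: numeral_2_eq_2)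
  have "Ck_on 1 UNIV A" "Ck_on 1 UNIV e"
    unfolding A_def[abs_def] e_def[abs_def]
    by (intro Ck_on_mult Ck_on_add Ck_on_diff sq Ck_on_const Ck_on_ident open_UNIV)+
  then have "Ck_on 1 UNIV (\<lambda>z::real^3. A (z $ i - y $ i))" "Ck_on 1 UNIV (\<lambda>z::real^3. e (z $ i - y $ i))" for i
    using Ck_on_compose[OF open_UNIV Ck_on_diff[OF open_UNIV Ck_on_nth[OF open_UNIV Ck_on_ident] Ck_on_const] _ subset_UNIV]
    by blast+
  then have \<psi>C: "Ck_on 1 UNIV \<psi>"
    unfolding \<psi>_def[abs_def] by (intro Ck_on_mult open_UNIV)
  have sqD: "((\<lambda>t. (max 0 (t + a)) ^ 2) has_real_derivative 2 * max 0 (t + a)) (at t)" for t a :: real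
    using DERIV_shift[of "\<lambda>t. (max 0 t) ^ 2" "2 * max 0 (t + a)" t a] has_real_derivative_max_power[of 0 "t + a"]
    by (simp add: numeral_2_eq_2)
  have DA: "(A has_real_derivative b t) (at t)" for t
  proof -
    have 0: "((\<lambda>t. (max 0 t) ^ 2) has_real_derivative 2 * max 0 t) (at t)" using sqD[of 0 t] by simp
    have m: "((\<lambda>t. (max 0 (t - r)) ^ 2) has_real_derivative 2 * max 0 (t - r)) (at t)" using sqD[of "- r" t] by simp
    have "(A has_real_derivative 1 / 2 * (2 * max 0 (t + r) - 2 * (2 * max 0 t) + 2 * max 0 (t - r))) (at t)"
      unfolding A_def[abs_def] by (rule DERIV_cmult DERIV_add DERIV_diff 0 m sqD)+
    moreover have "1 / 2 * (2 * max 0 (t + r) - 2 * (2 * max 0 t) + 2 * max 0 (t - r)) = b t"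
      by (simp add: b_def)
    ultimately show ?thesis by metis
  qed
  have D\<psi>: "frechet_derivative \<psi> (at z) (axis 1 1) = \<phi> z" for z
  proof -
    have "\<psi> differentiable at (z + 0 *\<^sub>R axis 1 1)" using \<psi>C by simp
    from has_real_derivative_along_line[OF this]
    have "((\<lambda>s. \<psi> (z + s *\<^sub>R axis 1 1)) has_real_derivative frechet_derivative \<psi> (at z) (axis 1 1)) (at 0)"
      by simp
    moreover have "((\<lambda>s. \<psi> (z + s *\<^sub>R axis 1 1)) has_real_derivative \<phi> z) (at 0)"
    proof -
      have "((\<lambda>s. A (z $ 1 + s - y $ 1)) has_real_derivative b (z $ 1 - y $ 1)) (at 0)"
      proof -
        have "((\<lambda>s. z $ 1 + s - y $ 1) has_real_derivative 1) (at 0)"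
          by (auto intro!: derivative_eq_intros)
        from DERIV_chain2[of A "b (z $ 1 - y $ 1)" "\<lambda>s. z $ 1 + s - y $ 1", OF _ this] DA
        show ?thesis by simp
      qed
      then show ?thesis
        unfolding \<psi>_def \<phi>_def by (simp add: axis_def) (rule DERIV_cmult_right)
    qed
    ultimately show ?thesis by (rule DERIV_unique)
  qed
  have b0: "b t = 0" if "\<bar>t\<bar> \<ge> r" for t using that r by (auto simp: b_def max_def abs_if split: if_splits)
  have e0: "e t = 0" if "\<bar>t\<bar> \<ge> r" for t
  proof -
    have "r\<^sup>2 \<le> t\<^sup>2" using that r by (metis abs_le_square_iff abs_of_pos)
    then show ?thesis by (simp add: e_def power2_eq_square)
  qed
  have "0 \<le> b t" for t using r by (auto simp: b_def max_def)
  then have \<phi>nn: "0 \<le> \<phi> z" for z by (simp add: \<phi>_def e_def)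
  have \<phi>y: "0 < \<phi> y" using r by (simp add: \<phi>_def b_def e_def)
  have \<phi>supp: "\<phi> z = 0" if "z \<notin> ball y d" for z
  proof (rule ccontr)
    assume "\<phi> z \<noteq> 0"
    then have "\<bar>(z - y) $ 1\<bar> < r" "\<bar>(z - y) $ 2\<bar> < r" "\<bar>(z - y) $ 3\<bar> < r"
      using b0 e0 by (force simp: \<phi>_def not_le[symmetric])+
    then have "((z - y) $ 1)\<^sup>2 \<le> r\<^sup>2" "((z - y) $ 2)\<^sup>2 \<le> r\<^sup>2" "((z - y) $ 3)\<^sup>2 \<le> r\<^sup>2"
      by (simp_all add: abs_le_square_iff[symmetric])
    then have "(norm (z - y))\<^sup>2 \<le> 3 * r\<^sup>2"
      unfolding power2_norm_eq_inner by (simp add: inner_vec_def sum_3 power2_eq_square)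
    also have "\<dots> < d\<^sup>2" using assms by (simp add: r_def power2_eq_square)
    finally have "norm (z - y) < d" using assms by (simp add: power_less_imp_less_base)
    then show False using that by (simp add: dist_norm norm_minus_commute)
  qed
  have \<phi>C: "continuous_on UNIV \<phi>"
    unfolding \<phi>_def b_def e_def by (intro continuous_intros)
  let ?l = "\<chi> i. y $ i - d" and ?u = "\<chi> i. y $ i + d"
  have sub: "ball y d \<subseteq> cbox ?l ?u"
  proof
    fix z assume z: "z \<in> ball y d"
    have "\<bar>z $ i - y $ i\<bar> \<le> d" for i
      using component_le_norm_cart[of "z - y" i] z by (simp add: dist_norm norm_minus_commute)
    then show "z \<in> cbox ?l ?u" by (simp add: mem_box_cart abs_le_iff) (metis abs_le_iff diff_le_eq add.commute minus_diff_eq)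
  qed
  have yb: "y \<in> box ?l ?u" "y \<in> cbox ?l ?u" using assms by (simp_all add: mem_box_cart)
  have ai: "\<phi> absolutely_integrable_on cbox ?l ?u"
    by (rule absolutely_integrable_continuous[OF continuous_on_subset[OF \<phi>C]]) simp
  then have aib: "\<phi> absolutely_integrable_on ball y d"
    by (rule set_integrable_subset) (use sub in auto)
  have I: "(\<phi> has_integral integral (ball y d) \<phi>) (ball y d)"
    using aib set_lebesgue_integral_eq_integral(1) integrable_integral by blast
  have "integral (ball y d) \<phi> \<noteq> 0"
  proof
    assume "integral (ball y d) \<phi> = 0"
    then have "(\<phi> has_integral 0) (cbox ?l ?u)"
      using I has_integral_on_superset[OF _ _ sub] \<phi>supp by metis
    then have "\<phi> y = 0"
      using has_integral_0_cbox_imp_0[OF continuous_on_subset[OF \<phi>C subset_UNIV] \<phi>nn] yb by blast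
    then show False using \<phi>y by simp
  qed
  then show thesis
    using that[OF \<psi>C, unfolded D\<psi>] \<phi>supp aib I by blast
qed


lemma has_integral_on_superset_within:
  fixes f :: "'n::euclidean_space \<Rightarrow> 'a::banach"
  assumes "(f has_integral i) S" "\<And>x. x \<in> T \<Longrightarrow> x \<notin> S \<Longrightarrow> f x = 0" "S \<subseteq> T"
  shows "(f has_integral i) T"
proof -
  have "((\<lambda>x. if x \<in> S then f x else 0) has_integral i) T"
    using assms(1) by (subst has_integral_restrict[OF assms(3)])
  then show ?thesis by (rule has_integral_eq[rotated]) (use assms in auto)
qed

text \<open>Near a regular value all preimages lie in disjoint neighbourhoods that \<open>G\<close> maps bijectively onto
  the same ball, so the degree integral of a test function counts them with the sign of the
  Jacobian.\<close>

lemma signed_preimage_count: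
  fixes G :: "real^3 \<Rightarrow> real^3"
  defines "J \<equiv> \<lambda>x. det (matrix (frechet_derivative G (at x)))"
  assumes O': "open O'" and G: "Ck_on 1 O' G" and sub: "cball a s \<subseteq> O'"
    and sph: "y \<notin> G ` sphere a s" and reg: "\<And>x. x \<in> cball a s \<Longrightarrow> G x = y \<Longrightarrow> J x \<noteq> 0"
  obtains d where "finite {x \<in> ball a s. G x = y}" "0 < d"
    "\<And>(\<phi> :: real^3 \<Rightarrow> real) c d'. 0 < d' \<Longrightarrow> d' \<le> d \<Longrightarrow> (\<And>z. z \<notin> ball y d' \<Longrightarrow> \<phi> z = 0) \<Longrightarrow>
       \<phi> absolutely_integrable_on ball y d' \<Longrightarrow> (\<phi> has_integral c) (ball y d') \<Longrightarrow>
       ((\<lambda>x. \<phi> (G x) * J x) has_integral (\<Sum>x\<in>{x \<in> ball a s. G x = y}. sgn (J x)) * c) (cball a s)"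
proof -
  define S where "S = {x \<in> ball a s. G x = y}"
  define G' where "G' x = frechet_derivative G (at x)" for x
  have Scb: "S = {x \<in> cball a s. G x = y}"
    using sph by (auto simp: S_def cball_def ball_def sphere_def order_less_le)
  have contG: "continuous_on O' G" using G Ck_on_Suc_lower[of 0 O' G] by simp
  have diff: "(G has_derivative G' x) (at x)" if "x \<in> O'" for x
    using G that by (simp add: G'_def frechet_derivative_works[symmetric])
  have contG': "continuous_on O' (\<lambda>x. G' x v)" for v
    using G by (simp add: G'_def)
  have contJ: "continuous_on O' J"
    unfolding J_def G'_def[symmetric] det_3 matrix_def by (simp, intro continuous_intros contG')
  have nbhd: "\<exists>W. open W \<and> x \<in> W \<and> W \<subseteq> ball a s \<and> inj_on G W \<and> (\<forall>z\<in>W. sgn (J z) = sgn (J x))"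
    if x: "x \<in> S" for x
  proof -
    have xO: "x \<in> O'" and xb: "x \<in> ball a s" and Jx: "J x \<noteq> 0"
      using x sub reg by (auto simp: S_def)
    have lin: "linear (G' x)" using diff[OF xO] has_derivative_linear by blast
    have "inj (G' x)" using Jx lin by (simp add: J_def G'_def det_nz_iff_inj)
    then obtain g' where g': "linear g'" "g' \<circ> G' x = id"
      using linear_injective_left_inverse[OF lin] by blast
    have small: "\<exists>d>0. \<forall>z. dist x z < d \<longrightarrow> onorm (\<lambda>v. G' z v - G' x v) < e" if e: "0 < e" for e
    proof -
      let ?n = "\<lambda>z. \<Sum>b\<in>Basis. norm (G' z b - G' x b)"
      have "continuous_on O' ?n" by (intro continuous_intros contG')
      then have "isCont ?n x" using O' xO continuous_on_eq_continuous_at by blast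
      then obtain d1 where d1: "0 < d1" "\<And>z. dist z x < d1 \<Longrightarrow> dist (?n z) (?n x) < e"
        using e unfolding continuous_at_eps_delta by blast
      obtain d2 where d2: "0 < d2" "ball x d2 \<subseteq> O'" using O' xO openE by blast
      have "onorm (\<lambda>v. G' z v - G' x v) < e" if z: "dist x z < min d1 d2" for z
      proof -
        have "z \<in> O'" using z d2 by auto
        then have "bounded_linear (\<lambda>v. G' z v - G' x v)"
          using diff xO by (intro bounded_linear_sub has_derivative_bounded_linear) auto
        from onorm_componentwise[OF this] have "onorm (\<lambda>v. G' z v - G' x v) \<le> ?n z" .
        moreover have "0 \<le> ?n z" by (simp add: sum_nonneg)
        ultimately show ?thesis using d1(2)[of z] z by (simp add: dist_commute)
      qed
      then show ?thesis using d1(1) d2(1) by (intro exI[of _ "min d1 d2"]) simp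
    qed
    have "\<exists>r>0. inj_on G (ball x r)"
    proof (rule has_derivative_locally_injective[of x O' g' G' G])
      show "bounded_linear g'" using g'(1) by (simp add: linear_conv_bounded_linear)
    qed (use xO O' g'(2) diff small in auto)
    then obtain r where r: "0 < r" "inj_on G (ball x r)" by blast
    define Q where "Q = O' \<inter> (\<lambda>z. J z * J x) -` {0<..}"
    have "open Q" unfolding Q_def
      by (intro continuous_open_preimage[OF _ O'] continuous_intros contJ)
    moreover have "sgn (J z) = sgn (J x)" if "z \<in> Q" for z
      using that by (auto simp: Q_def zero_less_mult_iff)
    moreover have "x \<in> Q"
    proof -
      have "0 < J x * J x" using Jx by (metis not_real_square_gt_zero)
      then show ?thesis using xO by (simp add: Q_def)
    qed
    moreover have "inj_on G (ball x r \<inter> (ball a s \<inter> Q))"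
      by (rule inj_on_subset[OF r(2)]) (rule Int_lower1)
    moreover have "open (ball x r \<inter> (ball a s \<inter> Q))" using \<open>open Q\<close> by (intro open_Int open_ball)
    moreover have "x \<in> ball x r \<inter> (ball a s \<inter> Q)" using r(1) xb \<open>x \<in> Q\<close> by simp
    ultimately show ?thesis by (metis IntD1 IntD2 subsetI)
  qed
  have finS: "finite S"
  proof (rule ccontr)
    assume inf: "infinite S"
    have "S = cball a s \<inter> G -` {y}" by (auto simp: Scb)
    then have "compact S"
      using continuous_closed_preimage[OF continuous_on_subset[OF contG sub] closed_cball closed_singleton, of y]
      by (simp add: compact_eq_bounded_closed) (metis bounded_cball bounded_subset inf_le1)
    then obtain x where x: "x \<in> S" "x islimpt S"
      using inf by (meson compact_eq_Bolzano_Weierstrass order_refl)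
    obtain W where W: "open W" "x \<in> W" "inj_on G W" using nbhd[OF x(1)] by blast
    obtain x' where "x' \<in> S" "x' \<in> W" "x' \<noteq> x"
      using x(2) W by (meson islimptE)
    then show False using W x(1) by (auto simp: S_def inj_on_def)
  qed
  obtain W0 where W0: "\<And>x. x \<in> S \<Longrightarrow> open (W0 x) \<and> x \<in> W0 x \<and> W0 x \<subseteq> ball a s \<and> inj_on G (W0 x) \<and> (\<forall>z\<in>W0 x. sgn (J z) = sgn (J x))"
    using nbhd by metis
  obtain \<delta> where \<delta>: "\<And>x. 0 < \<delta> x \<and> (\<forall>x'\<in>S. x' \<noteq> x \<longrightarrow> \<delta> x \<le> dist x x')"
    using finite_set_avoid[OF finS] by metis
  define \<rho> where "\<rho> = Min (insert 1 (\<delta> ` S))"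
  have \<rho>0: "0 < \<rho>" using finS \<delta> by (auto simp: \<rho>_def)
  have \<rho>: "\<rho> \<le> dist x x'" if x: "x \<in> S" "x' \<in> S" "x \<noteq> x'" for x x'
  proof -
    have "\<rho> \<le> \<delta> x" using x(1) finS by (simp add: \<rho>_def)
    also have "\<delta> x \<le> dist x x'" using \<delta>[of x] x(2,3) by metis
    finally show ?thesis .
  qed
  define W where "W x = W0 x \<inter> ball x (\<rho> / 2)" for x
  have W: "open (W x)" "x \<in> W x" "W x \<subseteq> ball a s" "inj_on G (W x)" "\<And>z. z \<in> W x \<Longrightarrow> sgn (J z) = sgn (J x)"
    if "x \<in> S" for x
  proof -
    have sub: "W x \<subseteq> W0 x" by (simp add: W_def)
    have *: "open (W0 x)" "x \<in> W0 x" "W0 x \<subseteq> ball a s" "inj_on G (W0 x)" "\<forall>z\<in>W0 x. sgn (J z) = sgn (J x)"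
      using W0[OF that] by blast+
    show "open (W x)" unfolding W_def by (intro open_Int *(1) open_ball)
    show "x \<in> W x" using *(2) \<rho>0 by (simp add: W_def)
    show "W x \<subseteq> ball a s" using sub *(3) by (rule order_trans)
    show "inj_on G (W x)" using *(4) sub by (rule inj_on_subset)
    show "sgn (J z) = sgn (J x)" if "z \<in> W x" for z using *(5) sub that by blast
  qed
  have disj: "W x \<inter> W x' = {}" if "x \<in> S" "x' \<in> S" "x \<noteq> x'" for x x'
  proof -
    have "dist x x' < \<rho>" if "z \<in> ball x (\<rho> / 2)" "z \<in> ball x' (\<rho> / 2)" for z
      using that dist_triangle_half_r[of z x \<rho> x'] by (simp add: dist_commute)
    then show ?thesis using \<rho>[OF that] by (fastforce simp: W_def)
  qed
  define C where "C = cball a s - (\<Union>x\<in>S. W x)"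
  have compC: "compact C" unfolding C_def using W(1) by (intro compact_diff compact_cball open_UN) auto
  have GC: "compact (G ` C)"
    using compC sub by (intro compact_continuous_image continuous_on_subset[OF contG]) (auto simp: C_def)
  have yC: "y \<notin> G ` C" using W(2) by (auto simp: C_def Scb)
  define T where "T = (\<Inter>x\<in>S. G ` W x) \<inter> - G ` C"
  have WO: "W x \<subseteq> O'" if "x \<in> S" for x
    using W(3)[OF that] ball_subset_cball sub by (meson order_trans)
  have opGW: "open (G ` W x)" if "x \<in> S" for x
    by (rule invariance_of_domain[OF continuous_on_subset[OF contG WO[OF that]] W(1)[OF that] W(4)[OF that]])
  have "open T" unfolding T_def
    using finS opGW GC by (intro open_Int open_INT open_Compl compact_imp_closed) auto
  moreover have "y \<in> T" using W(2) yC by (auto simp: T_def S_def image_iff)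
  ultimately obtain d where d: "0 < d" "ball y d \<subseteq> T" by (meson openE)
  show thesis
  proof (rule that[of d])
    show "finite {x \<in> ball a s. G x = y}" using finS by (simp add: S_def)
    show "0 < d" by fact
    fix \<phi> :: "real^3 \<Rightarrow> real" and c d'
    assume d': "0 < d'" "d' \<le> d" and \<phi>0: "\<And>z. z \<notin> ball y d' \<Longrightarrow> \<phi> z = 0"
      and ai: "\<phi> absolutely_integrable_on ball y d'" and I: "(\<phi> has_integral c) (ball y d')"
    have dT: "ball y d' \<subseteq> T" using d d' by force
    define V where "V x = W x \<inter> G -` ball y d'" for x
    have GV: "G ` V x = ball y d'" if "x \<in> S" for x
    proof -
      have "ball y d' \<subseteq> G ` W x" using dT that by (auto simp: T_def)
      then show ?thesis unfolding V_def by blast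
    qed
    have opV: "open (V x)" if "x \<in> S" for x
      unfolding V_def
      by (rule continuous_open_preimage[OF continuous_on_subset[OF contG WO[OF that]] W(1)[OF that] open_ball])
    have VO: "V x \<subseteq> O'" if "x \<in> S" for x
      using WO[OF that] by (auto simp: V_def)
    have each: "((\<lambda>z. \<phi> (G z) * J z) has_integral sgn (J x) * c) (V x)" if x: "x \<in> S" for x
    proof -
      have "(\<lambda>z. \<bar>det (matrix (G' z))\<bar> *\<^sub>R vec (\<phi> (G z)) :: real^1) absolutely_integrable_on V x \<and>
          integral (V x) (\<lambda>z. \<bar>det (matrix (G' z))\<bar> *\<^sub>R vec (\<phi> (G z)) :: real^1) = vec c"
      proof (subst has_absolute_integral_change_of_variables[of "V x" G G' "\<lambda>z. vec (\<phi> z)"])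
        show "V x \<in> sets lebesgue" using opV[OF x] by simp
        show "(G has_derivative G' z) (at z within V x)" if "z \<in> V x" for z
          using diff VO[OF x] that has_derivative_at_withinI by blast
        show "inj_on G (V x)" using W(4)[OF x] by (rule inj_on_subset) (auto simp: V_def)
        show "(\<lambda>z. vec (\<phi> z) :: real^1) absolutely_integrable_on G ` V x \<and> integral (G ` V x) (\<lambda>z. vec (\<phi> z) :: real^1) = vec c"
          unfolding GV[OF x] using ai I
          by (simp add: absolutely_integrable_on_1_iff integral_on_1_eq o_def integral_unique)
      qed
      then have "((\<lambda>z. \<bar>J z\<bar> * \<phi> (G z)) has_integral c) (V x)"
        unfolding J_def G'_def[symmetric]
        by (simp add: absolutely_integrable_on_1_iff integral_on_1_eq o_def vec_eq_iff has_integral_iff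
            set_lebesgue_integral_eq_integral(1))
      then have "((\<lambda>z. sgn (J x) * (\<bar>J z\<bar> * \<phi> (G z))) has_integral sgn (J x) * c) (V x)"
        by (rule has_integral_mult_right)
      then show ?thesis
      proof (rule has_integral_eq[rotated])
        fix z assume "z \<in> V x"
        then have "sgn (J x) = sgn (J z)" using W(5)[OF x, of z] by (simp add: V_def)
        then have "sgn (J x) * \<bar>J z\<bar> = J z" by (simp only: sgn_mult_abs)
        then show "sgn (J x) * (\<bar>J z\<bar> * \<phi> (G z)) = \<phi> (G z) * J z" by (metis mult.assoc mult.commute)
      qed
    qed
    have "((\<lambda>z. \<phi> (G z) * J z) has_integral (\<Sum>x\<in>S. sgn (J x) * c)) (\<Union>x\<in>S. V x)"
    proof (rule has_integral_UN[OF finS each])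
      show "pairwise (\<lambda>i i'. negligible (V i \<inter> V i')) S"
        using disj by (auto simp: pairwise_def V_def intro: negligible_subset[of "{}"])
    qed
    moreover have "\<phi> (G z) * J z = 0" if "z \<in> cball a s" "z \<notin> (\<Union>x\<in>S. V x)" for z
    proof (cases "z \<in> C")
      case True
      then have "G z \<notin> ball y d'" using dT by (auto simp: T_def)
      then show ?thesis using \<phi>0 by simp
    next
      case False
      then show ?thesis using that \<phi>0 by (auto simp: C_def V_def)
    qed
    moreover have "(\<Union>x\<in>S. V x) \<subseteq> cball a s" using W(3) ball_subset_cball[of a s] by (force simp: V_def)
    ultimately have "((\<lambda>z. \<phi> (G z) * J z) has_integral (\<Sum>x\<in>S. sgn (J x) * c)) (cball a s)"
      using has_integral_on_superset_within by blast
    then show "((\<lambda>x. \<phi> (G x) * J x) has_integral (\<Sum>x\<in>{x \<in> ball a s. G x = y}. sgn (J x)) * c) (cball a s)"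
      by (simp add: S_def sum_distrib_right)
  qed
qed


lemma sum_sgn_parity:
  fixes f :: "'a \<Rightarrow> real"
  assumes "finite S" "\<And>x. x \<in> S \<Longrightarrow> f x \<noteq> 0"
  shows "(\<Sum>x\<in>S. sgn (f x)) = real (card S) - 2 * real (card {x \<in> S. f x < 0})"
  using assms
proof (induction S rule: finite_induct)
  case (insert a S)
  have "{x \<in> insert a S. f x < 0} = (if f a < 0 then insert a {x \<in> S. f x < 0} else {x \<in> S. f x < 0})"
    by auto
  then show ?case using insert by (auto simp: sgn_if)
qed simp

lemma negligible_critical_values:
  assumes "Ck_on 1 O' G" "S \<subseteq> O'"
  shows "negligible (G ` {x \<in> S. det (matrix (frechet_derivative G (at x) :: real^3 \<Rightarrow> real^3)) = 0})"
proof (rule baby_Sard[where f' = "\<lambda>x. frechet_derivative G (at x)"])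
  fix x assume x: "x \<in> {x \<in> S. det (matrix (frechet_derivative G (at x))) = 0}"
  then have D: "(G has_derivative frechet_derivative G (at x)) (at x)"
    using assms by (auto simp: frechet_derivative_works[symmetric])
  then show "(G has_derivative frechet_derivative G (at x)) (at x within {x \<in> S. det (matrix (frechet_derivative G (at x))) = 0})"
    by (rule has_derivative_at_withinI)
  have "linear (frechet_derivative G (at x))" using D by (rule has_derivative_linear)
  then have "\<not> inj (frechet_derivative G (at x))" "(*v) (matrix (frechet_derivative G (at x))) = frechet_derivative G (at x)"
    using x det_nz_iff_inj by (auto simp: matrix_works)
  then show "rank (matrix (frechet_derivative G (at x))) < CARD(3)"
    unfolding less_rank_noninjective by simp
qed simp

text \<open>Off the images of the sphere and of the critical points, which are null sets, both maps have
  finitely many preimages in the ball. A bump function near the value shows that the signed counts agree, and a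
  signed count has the parity of the unsigned one.\<close>

lemma local_parity:
  fixes G0 G1 :: "real^3 \<Rightarrow> real^3"
  assumes O': "open O'" and G: "Ck_on 2 O' G0" "Ck_on 2 O' G1" and sub: "cball a s \<subseteq> O'"
    and K: "compact K" "K \<subseteq> ball a s" and eq: "\<And>x. x \<in> O' - K \<Longrightarrow> G0 x = G1 x"
  shows "negligible {y. \<not> (finite {x \<in> ball a s. G0 x = y} \<and> finite {x \<in> ball a s. G1 x = y} \<and>
            even (card {x \<in> ball a s. G0 x = y} + card {x \<in> ball a s. G1 x = y}))}"
proof -
  let ?J = "\<lambda>G x. det (matrix (frechet_derivative G (at x) :: real^3 \<Rightarrow> real^3))"
  let ?P = "\<lambda>G y. {x \<in> ball a s. G x = y}"
  have G1: "Ck_on 1 O' G0" "Ck_on 1 O' G1"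
    by (rule Ck_on_lower[OF G(1)], simp, rule Ck_on_lower[OF G(2)], simp)
  define N where "N G = G ` sphere a s \<union> G ` {x \<in> cball a s. ?J G x = 0}" for G
  have neg: "negligible (N G)" if "Ck_on 1 O' G" for G
  proof -
    have "negligible (G ` sphere a s)"
    proof (rule negligible_differentiable_image_negligible[OF order_refl negligible_sphere])
      show "G differentiable_on sphere a s"
        unfolding differentiable_on_def
      proof
        fix x assume "x \<in> sphere a s"
        then have "x \<in> O'" using sub by auto
        then show "G differentiable at x within sphere a s"
          using that by (simp add: differentiable_at_withinI)
      qed
    qed
    then show ?thesis unfolding N_def using negligible_critical_values[OF that sub] by simp
  qed
  show ?thesis
  proof (rule negligible_subset[OF negligible_Un[OF neg[OF G1(1)] neg[OF G1(2)]]], rule subsetI, rule ccontr)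
    fix y assume y: "y \<notin> N G0 \<union> N G1"
      and bad: "y \<in> {y. \<not> (finite (?P G0 y) \<and> finite (?P G1 y) \<and> even (card (?P G0 y) + card (?P G1 y)))}"
    have reg: "y \<notin> G ` sphere a s" "\<And>x. x \<in> cball a s \<Longrightarrow> G x = y \<Longrightarrow> ?J G x \<noteq> 0"
      if "G = G0 \<or> G = G1" for G
      using y that by (auto simp: N_def)
    obtain d0 where d0: "finite (?P G0 y)" "0 < d0"
      "\<And>(\<phi> :: real^3 \<Rightarrow> real) c d'. 0 < d' \<Longrightarrow> d' \<le> d0 \<Longrightarrow> (\<And>z. z \<notin> ball y d' \<Longrightarrow> \<phi> z = 0) \<Longrightarrow>
       \<phi> absolutely_integrable_on ball y d' \<Longrightarrow> (\<phi> has_integral c) (ball y d') \<Longrightarrow>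
       ((\<lambda>x. \<phi> (G0 x) * ?J G0 x) has_integral (\<Sum>x\<in>?P G0 y. sgn (?J G0 x)) * c) (cball a s)"
      by (rule signed_preimage_count[OF O' G1(1) sub reg(1)[of G0] reg(2)[of G0]]) auto
    obtain d1 where d1: "finite (?P G1 y)" "0 < d1"
      "\<And>(\<phi> :: real^3 \<Rightarrow> real) c d'. 0 < d' \<Longrightarrow> d' \<le> d1 \<Longrightarrow> (\<And>z. z \<notin> ball y d' \<Longrightarrow> \<phi> z = 0) \<Longrightarrow>
       \<phi> absolutely_integrable_on ball y d' \<Longrightarrow> (\<phi> has_integral c) (ball y d') \<Longrightarrow>
       ((\<lambda>x. \<phi> (G1 x) * ?J G1 x) has_integral (\<Sum>x\<in>?P G1 y. sgn (?J G1 x)) * c) (cball a s)"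
      by (rule signed_preimage_count[OF O' G1(2) sub reg(1)[of G1] reg(2)[of G1]]) auto
    define d where "d = min d0 d1"
    have d: "0 < d" "d \<le> d0" "d \<le> d1" using d0 d1 by (auto simp: d_def)
    obtain \<psi> :: "real^3 \<Rightarrow> real" and c where \<psi>: "Ck_on 1 UNIV \<psi>"
      and \<phi>: "\<And>z. z \<notin> ball y d \<Longrightarrow> frechet_derivative \<psi> (at z) (axis 1 1) = 0"
        "(\<lambda>z. frechet_derivative \<psi> (at z) (axis 1 1)) absolutely_integrable_on ball y d"
        "((\<lambda>z. frechet_derivative \<psi> (at z) (axis 1 1)) has_integral c) (ball y d)"
      and c: "c \<noteq> 0"
      using exists_degree_test_function[OF d(1), of y] by metis
    have "((\<lambda>x. frechet_derivative \<psi> (at (G0 x)) (axis 1 1) * ?J G0 x -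
        frechet_derivative \<psi> (at (G1 x)) (axis 1 1) * ?J G1 x) has_integral
        (\<Sum>x\<in>?P G0 y. sgn (?J G0 x)) * c - (\<Sum>x\<in>?P G1 y. sgn (?J G1 x)) * c) (cball a s)"
      by (rule has_integral_diff[OF d0(3)[OF d(1,2) \<phi>] d1(3)[OF d(1,3) \<phi>]])
    moreover have "((\<lambda>x. frechet_derivative \<psi> (at (G0 x)) (axis 1 1) * ?J G0 x -
        frechet_derivative \<psi> (at (G1 x)) (axis 1 1) * ?J G1 x) has_integral 0) (cball a s)"
      using K(2) ball_subset_cball[of a s]
      by (intro degree_integral_invariant[OF O' G \<psi> K(1) _ sub eq]) auto
    ultimately have "(\<Sum>x\<in>?P G0 y. sgn (?J G0 x)) * c - (\<Sum>x\<in>?P G1 y. sgn (?J G1 x)) * c = 0"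
      by (rule has_integral_unique)
    then have "(\<Sum>x\<in>?P G0 y. sgn (?J G0 x)) = (\<Sum>x\<in>?P G1 y. sgn (?J G1 x))" using c by simp
    moreover have "(\<Sum>x\<in>?P G y. sgn (?J G x)) = real (card (?P G y)) - 2 * real (card {x \<in> ?P G y. ?J G x < 0})"
      if "G = G0 \<or> G = G1" for G
      using that d0(1) d1(1) reg(2)[OF that] by (intro sum_sgn_parity) auto
    ultimately have "real (card (?P G0 y) + 2 * card {x \<in> ?P G1 y. ?J G1 x < 0}) =
        real (card (?P G1 y) + 2 * card {x \<in> ?P G0 y. ?J G0 x < 0})"
      by simp
    then have "card (?P G0 y) + 2 * card {x \<in> ?P G1 y. ?J G1 x < 0} =
        card (?P G1 y) + 2 * card {x \<in> ?P G0 y. ?J G0 x < 0}"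
      using of_nat_eq_iff by blast
    then have "even (card (?P G0 y) + card (?P G1 y))" by presburger
    then show False using bad d0(1) d1(1) by simp
  qed
qed

section \<open>The obstruction for subsets of Euclidean space\<close>

text \<open>A neighbourhood of \<open>w\<close> in \<open>J\<close> is a three-dimensional submanifold piece, without boundary, that is
  parametrised twice differentiably.\<close>

definition C2_chart_at :: "'b::euclidean_space set \<Rightarrow> 'b \<Rightarrow> bool" where
  "C2_chart_at J w \<longleftrightarrow> (\<exists>(P :: (real^3) set) h g. open P \<and> Ck_on 2 P h \<and> homeomorphism P (h ` P) h g \<and>
     openin (top_of_set J) (h ` P) \<and> w \<in> h ` P)"

text \<open>Finiteness is a premise for \<open>F0\<close> only: preimages outside the chart in which the maps differ are
  beyond control, but they are the same for both maps. In this form the relation is transitive.\<close>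

definition same_parity :: "'b set \<Rightarrow> ('b \<Rightarrow> real^3) \<Rightarrow> ('b \<Rightarrow> real^3) \<Rightarrow> real^3 \<Rightarrow> bool" where
  "same_parity J F0 F1 y \<longleftrightarrow> (finite {w \<in> J. F0 w = y} \<longrightarrow> finite {w \<in> J. F1 w = y} \<and>
     even (card {w \<in> J. F0 w = y} + card {w \<in> J. F1 w = y}))"

lemma same_parity_trans:
  "same_parity J F0 F1 y \<Longrightarrow> same_parity J F1 F2 y \<Longrightarrow> same_parity J F0 F2 y"
  unfolding same_parity_def even_add by argo

text \<open>Small ambient balls meet \<open>J\<close> inside one chart. A change of the map within such a ball is a
  compactly supported change in the chart, and the preimages elsewhere are unaffected.\<close>

lemma parity_in_chart:
  fixes J :: "'b::euclidean_space set"
  assumes J: "compact J" and p: "C2_chart_at J p"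
  shows "\<exists>r>0. \<forall>F0 F1. Ck_on 2 UNIV F0 \<longrightarrow> Ck_on 2 UNIV F1 \<longrightarrow>
      (\<forall>w. w \<notin> ball p r \<longrightarrow> F0 w = F1 w) \<longrightarrow> negligible {y. \<not> same_parity J F0 F1 y}"
proof -
  obtain P :: "(real^3) set" and h g where P: "open P" and h: "Ck_on 2 P h" and hom: "homeomorphism P (h ` P) h g"
    and op: "openin (top_of_set J) (h ` P)" and pP: "p \<in> h ` P"
    using p unfolding C2_chart_at_def by blast
  obtain a where a: "a \<in> P" "h a = p" using pP by blast
  obtain s where s: "0 < s" "cball a s \<subseteq> P" using P a(1) open_contains_cball by blast
  have bP: "ball a s \<subseteq> P" using s ball_subset_cball by blast
  have gh: "g (h x) = x" if "x \<in> P" for x using hom that by (simp add: homeomorphism_def)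
  have contg: "continuous_on (h ` P) g" using hom by (simp add: homeomorphism_def)
  have inj: "inj_on h (ball a s)" using gh bP by (metis inj_on_inverseI subsetD)
  have "openin (top_of_set (h ` P)) (h ` ball a s)"
    by (rule homeomorphism_imp_open_map[OF hom]) (use bP in \<open>simp add: open_openin_trans P openin_open_eq\<close>)
  then have "openin (top_of_set J) (h ` ball a s)" using op by (rule openin_trans)
  then obtain T where T: "open T" "h ` ball a s = J \<inter> T" by (auto simp: openin_open)
  have "p \<in> T" using T(2) a s by (metis IntD2 centre_in_ball image_eqI)
  then obtain r where r: "0 < r" "cball p r \<subseteq> T" using T(1) open_contains_cball by blast
  define K where "K = g ` (J \<inter> cball p r)"
  have JK: "J \<inter> cball p r \<subseteq> h ` ball a s" using r T by blast
  have "compact K" unfolding K_def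
    by (intro compact_continuous_image continuous_on_subset[OF contg] compact_Int_closed J closed_cball)
       (use JK bP in blast)
  have Kb: "K \<subseteq> ball a s" unfolding K_def using JK gh bP by (auto dest!: subsetD)
  have hJ: "h ` P \<subseteq> J" using op openin_imp_subset by blast
  show ?thesis
  proof (intro exI[of _ r] conjI allI impI)
    show "0 < r" by fact
    fix F0 F1 :: "'b \<Rightarrow> real^3"
    assume F: "Ck_on 2 UNIV F0" "Ck_on 2 UNIV F1" and eq': "\<forall>w. w \<notin> ball p r \<longrightarrow> F0 w = F1 w"
    have eq: "F0 w = F1 w" if "w \<notin> ball p r" for w using eq' that by blast
    have "negligible {y. \<not> (finite {x \<in> ball a s. F0 (h x) = y} \<and> finite {x \<in> ball a s. F1 (h x) = y} \<and>
            even (card {x \<in> ball a s. F0 (h x) = y} + card {x \<in> ball a s. F1 (h x) = y}))}"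
    proof (rule local_parity[OF P _ _ s(2) \<open>compact K\<close> Kb])
      show "Ck_on 2 P (\<lambda>x. F0 (h x))" by (rule Ck_on_compose[OF P h F(1)]) simp
      show "Ck_on 2 P (\<lambda>x. F1 (h x))" by (rule Ck_on_compose[OF P h F(2)]) simp
      fix x assume x: "x \<in> P - K"
      have "h x \<notin> cball p r"
      proof
        assume "h x \<in> cball p r"
        then have "g (h x) \<in> K" using x hJ by (auto simp: K_def)
        then show False using x gh by auto
      qed
      then show "F0 (h x) = F1 (h x)" using eq[of "h x"] by auto
    qed
    then show "negligible {y. \<not> same_parity J F0 F1 y}"
    proof (rule negligible_subset, intro subsetI CollectI notI)
      fix y assume y: "y \<in> {y. \<not> same_parity J F0 F1 y}"
        and good: "finite {x \<in> ball a s. F0 (h x) = y} \<and> finite {x \<in> ball a s. F1 (h x) = y} \<and>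
            even (card {x \<in> ball a s. F0 (h x) = y} + card {x \<in> ball a s. F1 (h x) = y})"
      define R where "R = {w \<in> J - h ` ball a s. F0 w = y}"
      have "F0 w = F1 w" if "w \<in> J - h ` ball a s" for w
        using JK that by (intro eq) auto
      then have R1: "R = {w \<in> J - h ` ball a s. F1 w = y}"
        unfolding R_def by auto
      have split: "{w \<in> J. F w = y} = h ` {x \<in> ball a s. F (h x) = y} \<union> {w \<in> J - h ` ball a s. F w = y}"
        "h ` {x \<in> ball a s. F (h x) = y} \<inter> {w \<in> J - h ` ball a s. F w = y} = {}"
        "card (h ` {x \<in> ball a s. F (h x) = y}) = card {x \<in> ball a s. F (h x) = y}"
        for F :: "'b \<Rightarrow> real^3"
      proof -
        show "card (h ` {x \<in> ball a s. F (h x) = y}) = card {x \<in> ball a s. F (h x) = y}"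
          by (rule card_image[OF inj_on_subset[OF inj]]) auto
        have "h ` ball a s \<subseteq> J" using bP hJ by blast
        then show "{w \<in> J. F w = y} = h ` {x \<in> ball a s. F (h x) = y} \<union> {w \<in> J - h ` ball a s. F w = y}"
          by auto
      qed auto
      have "same_parity J F0 F1 y"
        unfolding same_parity_def
      proof
        assume "finite {w \<in> J. F0 w = y}"
        then have "finite R" by (rule rev_finite_subset) (auto simp: R_def)
        have "card {w \<in> J. F0 w = y} = card {x \<in> ball a s. F0 (h x) = y} + card R"
          unfolding split(1)[of F0] R_def using good split(2)[of F0] \<open>finite R\<close> split(3)[of F0]
          by (subst card_Un_disjoint) (auto simp: R_def)
        moreover have "card {w \<in> J. F1 w = y} = card {x \<in> ball a s. F1 (h x) = y} + card R"
          unfolding split(1)[of F1] R1 using good split(2)[of F1] \<open>finite R\<close> split(3)[of F1]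
          by (subst card_Un_disjoint) (auto simp: R1)
        moreover have "finite {w \<in> J. F1 w = y}"
          unfolding split(1)[of F1] R1[symmetric] using good \<open>finite R\<close> by simp
        ultimately show "finite {w \<in> J. F1 w = y} \<and> even (card {w \<in> J. F0 w = y} + card {w \<in> J. F1 w = y})"
          using good by simp
      qed
      then show False using y by simp
    qed
  qed
qed

text \<open>A cutoff that shortens a map near \<open>p\<close>. On the ball of half the radius it is at most
  \<open>1 - (3/4)^3 = 37/64\<close>, which is all that is needed in place of a cutoff that vanishes there.\<close>

definition damp :: "'b::euclidean_space \<Rightarrow> real \<Rightarrow> 'b \<Rightarrow> real" where
  "damp p r w = 1 - (max 0 (1 - (1 / r\<^sup>2) * ((w - p) \<bullet> (w - p)))) ^ 3"

lemma Ck_on_damp: "Ck_on 2 UNIV (damp p r)"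
proof -
  have "Ck_on 2 UNIV (\<lambda>w. 1 - (1 / r\<^sup>2) * ((w - p) \<bullet> (w - p)))"
    by (intro Ck_on_diff Ck_on_mult Ck_on_inner Ck_on_const Ck_on_ident open_UNIV)
  from Ck_on_compose[OF open_UNIV this Ck_on_max_power[of 2] subset_UNIV]
  have "Ck_on 2 UNIV (\<lambda>w. (max 0 (1 - (1 / r\<^sup>2) * ((w - p) \<bullet> (w - p)))) ^ 3)" by simp
  then show ?thesis unfolding damp_def[abs_def] by (intro Ck_on_diff Ck_on_const open_UNIV)
qed

lemma damp_bounds:
  assumes "0 < r"
  shows "0 \<le> damp p r w" "damp p r w \<le> 1"
    and "w \<notin> ball p r \<Longrightarrow> damp p r w = 1"
    and "w \<in> ball p (r / 2) \<Longrightarrow> damp p r w \<le> 37 / 64"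
proof -
  define q where "q = (1 / r\<^sup>2) * ((w - p) \<bullet> (w - p))"
  have q: "q = (norm (w - p) / r)\<^sup>2" "damp p r w = 1 - (max 0 (1 - q)) ^ 3"
    by (simp_all add: q_def damp_def power_divide power2_norm_eq_inner)
  have "0 \<le> q" by (simp add: q)
  then have "max 0 (1 - q) ^ 3 \<le> 1 ^ 3" by (intro power_mono) auto
  then show "0 \<le> damp p r w" "damp p r w \<le> 1" by (simp_all add: q)
  show "damp p r w = 1" if "w \<notin> ball p r"
  proof -
    have "1 \<le> norm (w - p) / r" using that assms by (simp add: dist_norm norm_minus_commute)
    then have "1 \<le> q" unfolding q by (rule one_le_power)
    then show ?thesis by (simp add: q)
  qed
  show "damp p r w \<le> 37 / 64" if "w \<in> ball p (r / 2)"
  proof -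
    have "norm (w - p) / r \<le> 1 / 2" using that assms by (simp add: dist_norm norm_minus_commute field_simps)
    then have "q \<le> (1 / 2)\<^sup>2" unfolding q using assms by (intro power_mono) auto
    then have "(3 / 4) ^ 3 \<le> max 0 (1 - q) ^ 3" by (intro power_mono) (auto simp: power2_eq_square)
    then show ?thesis by (simp add: q power3_eq_cube)
  qed
qed

text \<open>The cutoffs of a finite cover of \<open>C\<close> are multiplied one after the other. Each factor changes the
  map in one chart only, and the other factors can only decrease the product further. Since the cutoffs
  are functions on the ambient space, no transition maps enter.\<close>

lemma parity_of_damped_map:
  fixes J :: "'b::euclidean_space set"
  assumes J: "compact J" and C: "compact C" and chart: "\<And>w. w \<in> C \<Longrightarrow> C2_chart_at J w"
  obtains \<Lambda> :: "'b \<Rightarrow> real" where "\<And>w. 0 \<le> \<Lambda> w" "\<And>w. \<Lambda> w \<le> 1" "\<And>w. w \<in> C \<Longrightarrow> \<Lambda> w \<le> 37 / 64"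
    "\<And>F. Ck_on 2 UNIV F \<Longrightarrow> negligible {y. \<not> same_parity J F (\<lambda>w. \<Lambda> w *\<^sub>R F w) y}"
proof -
  define good where "good p r \<longleftrightarrow> 0 < r \<and> (\<forall>F0 F1. Ck_on 2 UNIV F0 \<longrightarrow> Ck_on 2 UNIV F1 \<longrightarrow>
      (\<forall>w. w \<notin> ball p r \<longrightarrow> F0 w = F1 w) \<longrightarrow> negligible {y. \<not> same_parity J F0 F1 y})" for p r
  have "\<exists>r. good p r" if p: "p \<in> C" for p
    using parity_in_chart[OF J chart[OF p]] unfolding good_def by blast
  then obtain r where r: "\<And>p. p \<in> C \<Longrightarrow> good p (r p)" by metis
  have "C \<subseteq> (\<Union>p\<in>C. ball p (r p / 2))"
  proof
    fix p assume "p \<in> C"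
    then show "p \<in> (\<Union>p\<in>C. ball p (r p / 2))" using r[of p] by (intro UN_I[of p]) (auto simp: good_def)
  qed
  then obtain D where D: "D \<subseteq> C" "finite D" "C \<subseteq> (\<Union>p\<in>D. ball p (r p / 2))"
    using compactE_image[OF C, of C "\<lambda>p. ball p (r p / 2)"] by auto
  have "\<exists>\<Lambda> :: 'b \<Rightarrow> real. Ck_on 2 UNIV \<Lambda> \<and> (\<forall>w. 0 \<le> \<Lambda> w \<and> \<Lambda> w \<le> 1) \<and> (\<forall>p\<in>D. \<forall>w. \<Lambda> w \<le> damp p (r p) w) \<and>
      (\<forall>F. Ck_on 2 UNIV F \<longrightarrow> negligible {y. \<not> same_parity J F (\<lambda>w. \<Lambda> w *\<^sub>R F w) y})"
    using D(2,1)
  proof (induction D rule: finite_induct)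
    case empty
    have "same_parity J F F y" for F y by (simp add: same_parity_def)
    then show ?case by (intro exI[of _ "\<lambda>w. 1"]) (simp add: Ck_on_const)
  next
    case (insert p D)
    then obtain \<Lambda> :: "'b \<Rightarrow> real" where \<Lambda>: "Ck_on 2 UNIV \<Lambda>" "\<And>w. 0 \<le> \<Lambda> w" "\<And>w. \<Lambda> w \<le> 1"
      "\<And>p w. p \<in> D \<Longrightarrow> \<Lambda> w \<le> damp p (r p) w"
      "\<And>F. Ck_on 2 UNIV F \<Longrightarrow> negligible {y. \<not> same_parity J F (\<lambda>w. \<Lambda> w *\<^sub>R F w) y}"
      by auto
    have g: "good p (r p)" using r insert.prems by simp
    then have rp: "0 < r p" by (simp add: good_def)
    define M where "M w = damp p (r p) w * \<Lambda> w" for w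
    have MC: "Ck_on 2 UNIV M" unfolding M_def[abs_def] by (intro Ck_on_mult Ck_on_damp \<Lambda> open_UNIV)
    have M0: "0 \<le> M w" for w unfolding M_def by (intro mult_nonneg_nonneg damp_bounds rp \<Lambda>)
    have M1: "M w \<le> damp p (r p) w" "M w \<le> \<Lambda> w" for w

      using mult_left_le[OF \<Lambda>(3)[of w] damp_bounds(1)[OF rp, of p w]]
        mult_left_le_one_le[OF \<Lambda>(2)[of w] damp_bounds(1,2)[OF rp, of p w]]
      by (simp_all add: M_def)
    show ?case
    proof (intro exI[of _ M] conjI allI impI ballI)
      show "M w \<le> 1" for w using M1(2)[of w] \<Lambda>(3)[of w] by linarith
      show "M w \<le> damp p' (r p') w" if "p' \<in> insert p D" for p' w
        using that M1[of w] \<Lambda>(4)[of p' w] by auto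
      fix F :: "'b \<Rightarrow> real^3" assume F: "Ck_on 2 UNIV F"
      have "negligible {y. \<not> same_parity J (\<lambda>w. \<Lambda> w *\<^sub>R F w) (\<lambda>w. M w *\<^sub>R F w) y}"
      proof (rule g[unfolded good_def, THEN conjunct2, rule_format])
        show "Ck_on 2 UNIV (\<lambda>w. \<Lambda> w *\<^sub>R F w)" "Ck_on 2 UNIV (\<lambda>w. M w *\<^sub>R F w)"
          by (intro Ck_on_scaleR F \<Lambda> MC open_UNIV)+
      qed (simp add: M_def damp_bounds[OF rp])
      with \<Lambda>(5)[OF F] show "negligible {y. \<not> same_parity J F (\<lambda>w. M w *\<^sub>R F w) y}"
        by (rule negligible_subset[OF negligible_Un]) (use same_parity_trans in blast)
    qed (use M0 MC in auto)
  qed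
  then obtain \<Lambda> :: "'b \<Rightarrow> real" where \<Lambda>: "\<And>w. 0 \<le> \<Lambda> w" "\<And>w. \<Lambda> w \<le> 1"
      "\<And>p w. p \<in> D \<Longrightarrow> \<Lambda> w \<le> damp p (r p) w"
      "\<And>F. Ck_on 2 UNIV F \<Longrightarrow> negligible {y. \<not> same_parity J F (\<lambda>w. \<Lambda> w *\<^sub>R F w) y}"
    by auto
  show thesis
  proof (rule that[OF \<Lambda>(1,2) _ \<Lambda>(4)])
    fix w assume "w \<in> C"
    then obtain p where p: "p \<in> D" "w \<in> ball p (r p / 2)" using D(3) by auto
    then have "0 < r p" using r D(1) by (auto simp: good_def)
    then show "\<Lambda> w \<le> 37 / 64" using \<Lambda>(3)[OF p(1), of w] damp_bounds(4)[OF _ p(2)] by linarith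
  qed
qed

text \<open>The map \<open>F = (2 + x) g\<close> and its shortened version would have one and no preimage, respectively, over
  every point of a ball.\<close>

lemma no_embedded_cobordism:
  fixes J :: "((real \<times> real) \<times> ((real^3) \<times> (real^3))) set"
  assumes J: "compact J" "J \<subseteq> ({0..1} \<times> UNIV) \<times> (S2 \<times> S2)" and \<epsilon>: "0 < \<epsilon>" "\<epsilon> \<le> 1/2"
    and left: "J \<inter> ({0..<\<epsilon>} \<times> UNIV) \<times> (S2 \<times> S2) = ({0..<\<epsilon>} \<times> {0}) \<times> antidiagonal"
    and right: "\<And>w. w \<in> J \<Longrightarrow> 1 - \<epsilon> < fst (fst w) \<Longrightarrow> snd (snd w) $ 3 = 0"
    and chart: "\<And>w. w \<in> J \<Longrightarrow> 0 < fst (fst w) \<Longrightarrow> fst (fst w) < 1 \<Longrightarrow> C2_chart_at J w"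
  shows False
proof -
  define x :: "(real \<times> real) \<times> ((real^3) \<times> (real^3)) \<Rightarrow> real" where "x w = fst (fst w)" for w
  define F :: "(real \<times> real) \<times> ((real^3) \<times> (real^3)) \<Rightarrow> real^3" where "F w = (2 + x w) *\<^sub>R snd (snd w)" for w
  have FC: "Ck_on 2 UNIV F" unfolding F_def x_def
    by (intro Ck_on_scaleR Ck_on_add Ck_on_fst Ck_on_snd Ck_on_ident Ck_on_const open_UNIV)
  have xJ: "0 \<le> x w" "x w \<le> 1" "norm (snd (snd w)) = 1" if "w \<in> J" for w
    using subsetD[OF J(2) that] by (auto simp: x_def)
  have nF: "norm (F w) = 2 + x w" if "w \<in> J" for w using xJ[OF that] by (simp add: F_def)
  define C where "C = J \<inter> x -` {\<epsilon> / 2 .. 1 - \<epsilon> / 2}"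
  have "compact C" unfolding C_def x_def
    by (intro compact_Int_closed J closed_vimage continuous_intros closed_atLeastAtMost)
  moreover have "C2_chart_at J w" if "w \<in> C" for w
    using that \<epsilon> by (intro chart) (auto simp: C_def x_def)
  ultimately obtain \<Lambda> where \<Lambda>: "\<And>w. 0 \<le> \<Lambda> w" "\<And>w. \<Lambda> w \<le> 1" "\<And>w. w \<in> C \<Longrightarrow> \<Lambda> w \<le> 37 / 64"
    "\<And>F. Ck_on 2 UNIV F \<Longrightarrow> negligible {y. \<not> same_parity J F (\<lambda>w. \<Lambda> w *\<^sub>R F w) y}"
    using parity_of_damped_map[OF J(1), of C] by blast
  \<comment> \<open>The norm of \<open>y0\<close> lies strictly between the values \<open>2 + \<epsilon>/2\<close> and \<open>2 + \<epsilon>\<close> of the norm of \<open>F\<close>: these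
    belong to the start of the middle part and to the end of the collar.\<close>
  define y0 :: "real^3" where "y0 = axis 3 (2 + 3 * \<epsilon> / 4)"
  have "ball y0 (\<epsilon> / 8) \<subseteq> {y. \<not> same_parity J F (\<lambda>w. \<Lambda> w *\<^sub>R F w) y}"
  proof (intro subsetI CollectI notI)
    fix y assume "y \<in> ball y0 (\<epsilon> / 8)" and par: "same_parity J F (\<lambda>w. \<Lambda> w *\<^sub>R F w) y"
    then have dy: "norm (y - y0) < \<epsilon> / 8" by (simp add: dist_norm norm_minus_commute)
    have ny0: "norm y0 = 2 + 3 * \<epsilon> / 4" using \<epsilon> by (simp add: y0_def norm_eq_sqrt_inner inner_axis_axis)
    have ny: "2 + 5 * \<epsilon> / 8 < norm y" "norm y < 2 + 7 * \<epsilon> / 8"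
      using dy ny0 norm_triangle_ineq3[of y y0] by linarith+
    have "\<bar>y $ 3 - (2 + 3 * \<epsilon> / 4)\<bar> < \<epsilon> / 8"
      using dy component_le_norm_cart[of "y - y0" 3] by (simp add: y0_def)
    then have y3: "0 < y $ 3" using \<epsilon> by linarith
    define v where "v = (1 / norm y) *\<^sub>R y"
    have nv: "norm v = 1" "y = norm y *\<^sub>R v" using ny \<epsilon> by (auto simp: v_def)
    have one: "{w \<in> J. F w = y} = {((norm y - 2, 0), (- v, v))}"
    proof (intro equalityI subsetI)
      fix w assume w: "w \<in> {w \<in> J. F w = y}"
      then have xw: "x w = norm y - 2" using nF[of w] by auto
      then have "w \<in> ({0..<\<epsilon>} \<times> {0}) \<times> antidiagonal"
        unfolding left[symmetric] using w ny \<epsilon> J(2) by (auto simp: x_def)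
      then obtain u where u: "w = ((x w, 0), (u, - u))" by (auto simp: antidiagonal_def x_def)
      have "F w = y" using w by simp
      then have "(2 + x w) *\<^sub>R (- u) = y" unfolding F_def by (subst (asm) (2) u) simp
      then have "norm y *\<^sub>R (- u) = norm y *\<^sub>R v" using xw nv(2) by simp
      then have "u = - v"
      proof -
        have "norm y \<noteq> 0" using ny \<epsilon> by linarith
        then have "- u = v" using \<open>norm y *\<^sub>R (- u) = norm y *\<^sub>R v\<close> scaleR_left_imp_eq by blast
        then show ?thesis by auto
      qed
      then show "w \<in> {((norm y - 2, 0), (- v, v))}" using u xw by simp
    next
      fix w assume w: "w \<in> {((norm y - 2, 0 :: real), (- v, v))}"
      have "w \<in> ({0..<\<epsilon>} \<times> {0}) \<times> antidiagonal"
        using w ny \<epsilon> nv by (auto simp: antidiagonal_def intro!: exI[of _ "- v"])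
      then have "w \<in> J" using left by blast
      then show "w \<in> {w \<in> J. F w = y}" using w nv by (simp add: F_def x_def)
    qed
    have none: "{w \<in> J. \<Lambda> w *\<^sub>R F w = y} = {}"
    proof (rule ccontr)
      assume "{w \<in> J. \<Lambda> w *\<^sub>R F w = y} \<noteq> {}"
      then obtain w where w: "w \<in> J" "\<Lambda> w *\<^sub>R F w = y" by blast
      have n: "norm y = \<Lambda> w * (2 + x w)" using nF[OF w(1)] \<Lambda>(1)[of w] w(2) by auto
      consider "x w < \<epsilon> / 2" | "w \<in> C" | "1 - \<epsilon> / 2 < x w" using w(1) by (fastforce simp: C_def)
      then show False
      proof cases
        case 1
        have "\<Lambda> w * (2 + x w) \<le> 1 * (2 + x w)" using \<Lambda> xJ w by (intro mult_right_mono) auto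
        then have "norm y \<le> 2 + x w" using n by simp
        then show False using ny 1 \<epsilon> by linarith
      next
        case 2
        \<comment> \<open>The offset 2 in \<open>F\<close> makes the shortened norm, at most \<open>37/64 * 3\<close>, smaller than 2.\<close>
        have "\<Lambda> w * (2 + x w) \<le> 37 / 64 * 3" using \<Lambda> 2 xJ w by (intro mult_mono) auto
        then have "norm y \<le> 37 / 64 * 3" using n by simp
        then show False using ny \<epsilon> by linarith
      next
        case 3
        then have "snd (snd w) $ 3 = 0" using right[OF w(1)] \<epsilon> by (simp add: x_def)
        then have "y $ 3 = 0" using w(2) by (auto simp: F_def)
        then show False using y3 by simp
      qed
    qed
    then show False using par unfolding same_parity_def one none by simp
  qed
  then have "negligible (ball y0 (\<epsilon> / 8))" using negligible_subset[OF \<Lambda>(4)[OF FC]] by blast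
  then show False using \<epsilon> open_not_negligible[OF open_ball, of y0 "\<epsilon> / 8"] by simp
qed

section \<open>The boundary of an embedded cobordism lies at the ends\<close>

lemma homeomorphism_if_homeomorphic_maps:
  assumes "homeomorphic_maps (top_of_set S) (top_of_set T) f g"
  shows "homeomorphism S T f g"
  using assms unfolding homeomorphic_maps_def
  by (intro homeomorphismI) (auto simp: continuous_map_in_subtopology)

lemma embedding_map_imp_continuous_map:
  assumes "embedding_map X euclidean i"
  shows "continuous_map X euclidean i"
  using homeomorphic_imp_continuous_map[OF assms[unfolded embedding_map_def]]
  by (simp add: continuous_map_in_subtopology)

lemma chart_homeomorphism:
  assumes V: "smooth_manifold half_space V" and i: "embedding_map (fst V) euclidean i" and U: "(U, \<phi>) \<in> snd V"
  shows "\<exists>k. homeomorphism (\<phi> ` U) (i ` U) (i \<circ> inv_into U \<phi>) k \<and> (\<forall>q\<in>U. k (i q) = \<phi> q)"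
    and "openin (top_of_set half_space) (\<phi> ` U)" "openin (top_of_set (i ` topspace (fst V))) (i ` U)"
    and "inj_on \<phi> U" "inj_on i (topspace (fst V))" "U \<subseteq> topspace (fst V)"
proof -
  obtain X A where V': "V = (X, A)" by (cases V)
  have UA: "(U, \<phi>) \<in> A" using U V' by simp
  from V UA have opU: "openin X U" and op\<phi>: "openin (top_of_set half_space) (\<phi> ` U)"
    and hom: "homeomorphic_map (subtopology X U) (top_of_set (\<phi> ` U)) \<phi>"
    unfolding V' smooth_manifold_def by auto
  show "openin (top_of_set half_space) (\<phi> ` U)" by (rule op\<phi>)
  have UX: "U \<subseteq> topspace X" using opU by (rule openin_subset)
  then show "U \<subseteq> topspace (fst V)" by (simp add: V')
  have tU: "topspace (subtopology X U) = U" using UX by auto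
  show inj: "inj_on \<phi> U" using homeomorphic_imp_injective_map[OF hom] tU by simp
  have ihom: "homeomorphic_map X (top_of_set (i ` topspace X)) i"
    using i by (simp add: V' embedding_map_def)
  then obtain j where j: "homeomorphic_maps X (top_of_set (i ` topspace X)) i j"
    by (auto simp: homeomorphic_map_maps)
  show "inj_on i (topspace (fst V))" using homeomorphic_imp_injective_map[OF ihom] by (simp add: V')
  show "openin (top_of_set (i ` topspace (fst V))) (i ` U)"
    using homeomorphic_map_openness_eq[OF ihom] opU by (simp add: V')
  obtain g where g: "homeomorphic_maps (subtopology X U) (top_of_set (\<phi> ` U)) \<phi> g"
    using hom by (auto simp: homeomorphic_map_maps)
  have gi: "g w = inv_into U \<phi> w" if "w \<in> \<phi> ` U" for w
    using g that inj tU by (auto simp: homeomorphic_maps_def)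
  have "homeomorphic_maps (subtopology X U) (subtopology (top_of_set (i ` topspace X)) (i ` U)) i j"
    by (rule homeomorphic_maps_subtopologies[OF j]) (use UX in auto)
  then have "homeomorphic_maps (subtopology X U) (top_of_set (i ` U)) i j"
    using UX by (simp add: subtopology_subtopology image_mono Int_absorb1)
  then have "homeomorphic_maps (top_of_set (\<phi> ` U)) (top_of_set (i ` U)) (i \<circ> g) (\<phi> \<circ> j)"
    by (rule homeomorphic_maps_compose[OF conjI[OF homeomorphic_maps_sym[THEN iffD1, OF g]]])
  then have "homeomorphism (\<phi> ` U) (i ` U) (i \<circ> g) (\<phi> \<circ> j)" by (rule homeomorphism_if_homeomorphic_maps)
  then have "homeomorphism (\<phi> ` U) (i ` U) (i \<circ> inv_into U \<phi>) (\<phi> \<circ> j)"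
    by (rule homeomorphism_cong[OF _ refl refl]) (simp_all add: gi)
  moreover have "j (i q) = q" if "q \<in> U" for q
    using j UX that by (auto simp: homeomorphic_maps_def)
  ultimately show "\<exists>k. homeomorphism (\<phi> ` U) (i ` U) (i \<circ> inv_into U \<phi>) k \<and> (\<forall>q\<in>U. k (i q) = \<phi> q)"
    by (intro exI[of _ "\<phi> \<circ> j"]) simp
qed

lemma openin_half_space_imp_open:
  assumes "openin (top_of_set half_space) P"
  shows "open (P \<inter> {z. 0 < fst z})"
proof -
  obtain T where T: "open T" "P = half_space \<inter> T" using assms by (auto simp: openin_open)
  have "P \<inter> {z. 0 < fst z} = T \<inter> {z. 0 < fst z}" using T by (auto simp: half_space_def)
  moreover have "open {z :: real \<times> 'a. 0 < fst z}"
    by (intro open_Collect_less continuous_intros)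
  ultimately show ?thesis using T(1) by (simp add: open_Int)
qed

lemma interior_chart_imp_C2_chart_at:
  fixes V :: "('a, real \<times> (real^2)) manifold"
  assumes V: "smooth_manifold half_space V" and i: "embedding_map (fst V) euclidean i" and U: "(U, \<phi>) \<in> snd V"
    and smooth: "smooth_on (\<phi> ` U) (i \<circ> inv_into U \<phi>)" and p: "p \<in> U" "0 < fst (\<phi> p)"
  shows "C2_chart_at (i ` topspace (fst V)) (i p)"
proof -
  obtain k where k: "homeomorphism (\<phi> ` U) (i ` U) (i \<circ> inv_into U \<phi>) k" "\<forall>q\<in>U. k (i q) = \<phi> q"
    using chart_homeomorphism(1)[OF V i U] by blast
  note ch = chart_homeomorphism(2-)[OF V i U]
  define h where "h = i \<circ> inv_into U \<phi>"
  define Q where "Q = \<phi> ` U \<inter> {z. 0 < fst z}"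
  have opQ: "open Q" unfolding Q_def by (rule openin_half_space_imp_open[OF ch(1)])
  have homQ: "homeomorphism Q (h ` Q) h k"
    by (rule homeomorphism_of_subsets[OF k(1)[folded h_def]]) (auto simp: Q_def)
  define L :: "real^3 \<Rightarrow> real \<times> (real^2)" where "L z = (z $ 1, vector [z $ 2, z $ 3])" for z
  define L' :: "real \<times> (real^2) \<Rightarrow> real^3" where "L' z = vector [fst z, snd z $ 1, snd z $ 2]" for z
  have LL: "L (L' z) = z" "L' (L y) = y" for z y
    by (auto simp: L_def L'_def prod_eq_iff vec_eq_iff forall_2 forall_3 vector_3)
  have linL: "linear L" by (auto intro!: linearI simp: L_def prod_eq_iff vec_eq_iff forall_2)
  have linL': "linear L'" by (auto intro!: linearI simp: L'_def vec_eq_iff forall_3 vector_3)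
  have contL: "continuous_on S L" "continuous_on T L'" for S T
    using linL linL' by (simp_all add: linear_continuous_on linear_conv_bounded_linear)
  define P where "P = L' ` Q"
  have P: "P = L -` Q"
  proof (intro equalityI subsetI)
    fix x assume "x \<in> L -` Q"
    then show "x \<in> P" unfolding P_def using LL(2)[of x] by (intro image_eqI[of _ _ "L x"]) auto
  qed (auto simp: P_def LL)
  have opP: "open P" unfolding P using opQ contL(1)[of UNIV] by (simp add: continuous_on_open_vimage)
  have LP: "L ` P = Q" unfolding P using LL by (metis surjI surj_image_vimage_eq)
  have homL: "homeomorphism P Q L L'"
    by (intro homeomorphismI contL) (auto simp: P LL)
  have "homeomorphism P (h ` Q) (h \<circ> L) (L' \<circ> k)" by (rule homeomorphism_compose[OF homL homQ])
  moreover have hLP: "(h \<circ> L) ` P = h ` Q" using LP by (metis image_comp)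
  moreover have "Ck_on 2 P (h \<circ> L)"
  proof -
    have "Ck_on 2 Q h"
      by (rule smooth_on_open_imp_Ck_on[OF opQ smooth_on_subset[OF smooth[folded h_def]]]) (simp add: Q_def)
    from Ck_on_compose[OF opP Ck_on_linear[OF linL] this] show ?thesis using LP by (simp add: o_def)
  qed
  moreover have "openin (top_of_set (i ` topspace (fst V))) (h ` Q)"
  proof (rule openin_trans[OF _ ch(2)])
    have "openin (top_of_set (\<phi> ` U)) Q"
      by (rule open_subset[OF _ opQ]) (simp add: Q_def)
    then show "openin (top_of_set (i ` U)) (h ` Q)"
      by (rule homeomorphism_imp_open_map[OF k(1)[folded h_def]])
  qed
  moreover have "i p \<in> h ` Q"
  proof (rule image_eqI[of _ _ "\<phi> p"])
    show "i p = h (\<phi> p)" using p ch(3) by (simp add: h_def)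
  qed (use p in \<open>simp add: Q_def\<close>)
  ultimately show ?thesis unfolding C2_chart_at_def using opP
    by (intro exI[of _ P] exI[of _ "h \<circ> L"] exI[of _ "L' \<circ> k"]) simp
qed

text \<open>An interior point has an open neighbourhood, whose image is open by invariance of domain. A set
  that contains a boundary point of the half-space and is contained in the half-space is not open.\<close>

lemma homeomorphism_preserves_boundary_aux:
  fixes P Q :: "(real \<times> 'e::euclidean_space) set"
  assumes P: "openin (top_of_set half_space) P" and Q: "Q \<subseteq> half_space"
    and hom: "homeomorphism P Q f g" and z: "z \<in> P" "0 < fst z"
  shows "0 < fst (f z)"
proof (rule ccontr)
  assume "\<not> 0 < fst (f z)"
  moreover have "f z \<in> Q" using hom z by (auto simp: homeomorphism_def)
  ultimately have f0: "fst (f z) = 0" using Q by (force simp: half_space_def)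
  define P' where "P' = P \<inter> {z. 0 < fst z}"
  have "open P'" unfolding P'_def by (rule openin_half_space_imp_open[OF P])
  moreover have "continuous_on P' f" using hom by (metis P'_def homeomorphism_def continuous_on_subset inf_le1)
  moreover have "inj_on f P'"
    by (rule inj_on_inverseI[of _ g]) (use hom in \<open>simp add: homeomorphism_def P'_def\<close>)
  ultimately have "open (f ` P')" using invariance_of_domain by blast
  moreover have fz: "f z \<in> f ` P'" using z by (auto simp: P'_def)
  ultimately obtain e where e: "0 < e" "ball (f z) e \<subseteq> f ` P'" by (meson openE)
  have "f z - (e / 2, 0) \<in> ball (f z) e" using e(1) by (simp add: dist_norm norm_Pair)
  moreover have "f ` P' \<subseteq> half_space" using Q hom by (auto simp: homeomorphism_def P'_def)
  ultimately have "f z - (e / 2, 0) \<in> half_space" using e(2) by blast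
  then show False using f0 e(1) by (simp add: half_space_def)
qed

lemma homeomorphism_preserves_boundary:
  fixes P Q :: "(real \<times> 'e::euclidean_space) set"
  assumes P: "openin (top_of_set half_space) P" and Q: "openin (top_of_set half_space) Q"
    and hom: "homeomorphism P Q f g" and z: "z \<in> P"
  shows "fst z = 0 \<longleftrightarrow> fst (f z) = 0"
proof -
  have PQ: "P \<subseteq> half_space" "Q \<subseteq> half_space" using P Q openin_imp_subset by blast+
  have fz: "f z \<in> Q" "g (f z) = z" using hom z by (auto simp: homeomorphism_def)
  have "0 < fst z \<longleftrightarrow> 0 < fst (f z)"
    using homeomorphism_preserves_boundary_aux[OF P PQ(2) hom z]
      homeomorphism_preserves_boundary_aux[OF Q PQ(1) homeomorphism_symD[OF hom] fz(1)] fz(2) by auto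
  moreover have "0 \<le> fst z" "0 \<le> fst (f z)" using PQ z fz(1) by (auto simp: half_space_def)
  ultimately show ?thesis by linarith
qed

text \<open>The collar is homeomorphic to the product of an interval and \<open>L\<close>, whose charts show the boundary at
  \<open>t = 0\<close>; the boundary does not depend on the charts. The map \<open>r\<close> is the identity for the left end of the
  strip and \<open>1 - t\<close> for the right end.\<close>

lemma collar_boundary:
  fixes V :: "('a, real \<times> 'e::euclidean_space) manifold" and i :: "'a \<Rightarrow> (real \<times> real) \<times> 'b::euclidean_space"
    and r :: "real \<Rightarrow> real"
  defines "J \<equiv> i ` topspace (fst V)"
  assumes V: "smooth_manifold half_space V" and i: "embedding_map (fst V) euclidean i"
    and L: "closed_manifold (submanifold L :: ('b, 'e) manifold)"
    and r: "continuous_on UNIV r" "\<And>t. r (r t) = t"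
    and collar: "{w \<in> J. r (fst (fst w)) < \<epsilon>} = {((r t, 0), l) | t l. t \<in> {0..<\<epsilon>} \<and> l \<in> L}"
    and U: "(U, \<phi>) \<in> snd V" and p: "p \<in> U" "r (fst (fst (i p))) < \<epsilon>"
  shows "fst (\<phi> p) = 0 \<longleftrightarrow> r (fst (fst (i p))) = 0"
proof -
  obtain k where k: "homeomorphism (\<phi> ` U) (i ` U) (i \<circ> inv_into U \<phi>) k" "\<forall>q\<in>U. k (i q) = \<phi> q"
    using chart_homeomorphism(1)[OF V i U] by blast
  note ch = chart_homeomorphism(2-)[OF V i U]
  have ipJ: "i p \<in> J" using p ch(5) by (auto simp: J_def)
  have collarD: "\<exists>t l. w = ((r t, 0), l) \<and> t \<in> {0..<\<epsilon>} \<and> l \<in> L" if "w \<in> J" "r (fst (fst w)) < \<epsilon>" for w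
    using collar that by blast
  have lL: "snd (i p) \<in> L" using collarD[OF ipJ p(2)] by auto
  have top: "topspace (top_of_set L) = (\<Union>(U, \<phi>) \<in> snd (submanifold L :: ('b, 'e) manifold). U)"
    using L unfolding closed_manifold_def smooth_manifold_def submanifold_def by simp
  obtain c where "c \<in> snd (submanifold L :: ('b, 'e) manifold)" "snd (i p) \<in> (case c of (U, \<phi>) \<Rightarrow> U)"
    using lL top unfolding topspace_euclidean_subtopology by blast
  then obtain W and \<psi> :: "'b \<Rightarrow> 'e" where W: "(W, \<psi>) \<in> snd (submanifold L :: ('b, 'e) manifold)" "snd (i p) \<in> W"
    by (cases c) auto
  then have opW: "openin (top_of_set L) W" and inj: "inj_on \<psi> W" and op\<psi>: "open (\<psi> ` W)"
    and c: "continuous_on W \<psi>" "continuous_on (\<psi> ` W) (inv_into W \<psi>)"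
    by (auto simp: submanifold_def intro: smooth_on_imp_continuous_on)
  have WL: "W \<subseteq> L" using opW by (rule openin_imp_subset)
  define Col where "Col = {w \<in> J. r (fst (fst w)) < \<epsilon> \<and> snd w \<in> W}"
  define B where "B = {0..<\<epsilon>} \<times> \<psi> ` W"
  define \<theta> where "\<theta> w = (r (fst (fst w)), \<psi> (snd w))" for w :: "(real \<times> real) \<times> 'b"
  define \<theta>' where "\<theta>' z = ((r (fst z), 0 :: real), inv_into W \<psi> (snd z))" for z
  have ColE: "w = ((r t, 0), l) \<and> t \<in> {0..<\<epsilon>} \<and> l \<in> W" if w: "w \<in> Col" and tl: "t = r (fst (fst w))" "l = snd w" for w t l
  proof -
    obtain t' l' where "w = ((r t', 0), l')" "t' \<in> {0..<\<epsilon>}"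
      using collarD[of w] w by (auto simp: Col_def)
    then show ?thesis using w tl r(2) by (auto simp: Col_def)
  qed
  have ColI: "((r t, 0), l) \<in> Col" if "t \<in> {0..<\<epsilon>}" "l \<in> W" for t l
  proof -
    have "((r t, 0), l) \<in> {w \<in> J. r (fst (fst w)) < \<epsilon>}" unfolding collar using that WL by blast
    then show ?thesis using that by (simp add: Col_def)
  qed
  have hom\<theta>: "homeomorphism Col B \<theta> \<theta>'"
  proof (rule homeomorphismI)
    show "continuous_on Col \<theta>" unfolding \<theta>_def
      by (intro continuous_intros continuous_on_compose2[OF r(1)] continuous_on_compose2[OF c(1)]) (auto simp: Col_def)
    show "continuous_on B \<theta>'" unfolding \<theta>'_def
      by (intro continuous_intros continuous_on_compose2[OF r(1)] continuous_on_compose2[OF c(2)]) (auto simp: B_def)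
    show "\<theta> ` Col \<subseteq> B"
    proof
      fix z assume "z \<in> \<theta> ` Col"
      then obtain w where w: "w \<in> Col" "z = \<theta> w" by blast
      then show "z \<in> B" using ColE[OF w(1) refl refl] by (simp add: B_def \<theta>_def)
    qed
    show "\<theta>' ` B \<subseteq> Col"
    proof
      fix w assume "w \<in> \<theta>' ` B"
      then obtain t l where "t \<in> {0..<\<epsilon>}" "l \<in> W" "w = \<theta>' (t, \<psi> l)" by (auto simp: B_def)
      then show "w \<in> Col" using ColI[of t l] inj by (simp add: \<theta>'_def)
    qed
    show "\<theta>' (\<theta> w) = w" if "w \<in> Col" for w
      using ColE[OF that refl refl] inj r(2) by (auto simp: \<theta>_def \<theta>'_def prod_eq_iff)
    show "\<theta> (\<theta>' z) = z" if "z \<in> B" for z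
      using that r(2) inj by (auto simp: \<theta>_def \<theta>'_def B_def)
  qed
  have opB: "openin (top_of_set half_space) B"
  proof -
    have "B = half_space \<inter> {..<\<epsilon>} \<times> \<psi> ` W" by (auto simp: B_def half_space_def)
    then show ?thesis using op\<psi> by (simp add: openin_open_Int open_Times)
  qed
  have opCol: "openin (top_of_set J) Col"
  proof -
    obtain T where T: "open T" "W = L \<inter> T" using opW by (auto simp: openin_open)
    have "Col = J \<inter> {w. r (fst (fst w)) < \<epsilon>} \<inter> (UNIV \<times> T)"
    proof (intro equalityI subsetI)
      fix w assume w: "w \<in> J \<inter> {w. r (fst (fst w)) < \<epsilon>} \<inter> (UNIV \<times> T)"
      then have "snd w \<in> L" using collarD[of w] by auto
      then show "w \<in> Col" using w T by (auto simp: Col_def)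
    qed (use T in \<open>auto simp: Col_def mem_Times_iff\<close>)
    moreover have "open ({w :: (real \<times> real) \<times> 'b. r (fst (fst w)) < \<epsilon>} \<inter> (UNIV \<times> T))"
      using T(1) by (intro open_Int open_Times open_UNIV open_Collect_less continuous_intros continuous_on_compose2[OF r(1)]) auto
    ultimately show ?thesis by (simp add: Int_assoc openin_open_Int)
  qed
  define Z where "Z = i ` U \<inter> Col"
  have opZ: "openin (top_of_set Col) Z" "openin (top_of_set (i ` U)) Z"
    using opCol ch(2)[folded J_def]
    by (auto simp: Z_def openin_open)
  have "homeomorphism Z (k ` Z) k (i \<circ> inv_into U \<phi>)"
    by (rule homeomorphism_of_subsets[OF homeomorphism_symD[OF k(1)], of _ "{}"]) (auto simp: Z_def)
  then have hom1: "homeomorphism (k ` Z) Z (i \<circ> inv_into U \<phi>) k"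
    by (rule homeomorphism_symD)
  have hom2: "homeomorphism Z (\<theta> ` Z) \<theta> \<theta>'"
    by (rule homeomorphism_of_subsets[OF hom\<theta>]) (auto simp: Z_def)
  have "openin (top_of_set B) (\<theta> ` Z)" by (rule homeomorphism_imp_open_map[OF hom\<theta> opZ(1)])
  then have op2: "openin (top_of_set half_space) (\<theta> ` Z)" using opB by (rule openin_trans)
  have "openin (top_of_set (\<phi> ` U)) (k ` Z)"
    by (rule homeomorphism_imp_open_map[OF homeomorphism_symD[OF k(1)] opZ(2)])
  then have op1: "openin (top_of_set half_space) (k ` Z)" using ch(1) by (rule openin_trans)
  have ipZ: "i p \<in> Z" using p ipJ W(2) by (simp add: Z_def Col_def)
  have "fst (k (i p)) = 0 \<longleftrightarrow> fst ((\<theta> \<circ> (i \<circ> inv_into U \<phi>)) (k (i p))) = 0"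
    by (rule homeomorphism_preserves_boundary[OF op1 op2 homeomorphism_compose[OF hom1 hom2]]) (use ipZ in simp)
  moreover have "(i \<circ> inv_into U \<phi>) (k (i p)) = i p" using hom1 ipZ by (simp add: homeomorphism_def)
  ultimately show ?thesis using k(2) p(1) by (simp add: \<theta>_def)
qed


text \<open>In the collars the boundary is the fibre over 0 and over 1. Both fibres are open and closed in the
  boundary, nonempty and disjoint, while the boundary consists of two connected pieces. So each
  fibre is one of the pieces, and no boundary point is left.\<close>

lemma interior_of_strip_is_interior:
  fixes V :: "('a, real \<times> (real^2)) manifold" and i :: "'a \<Rightarrow> (real \<times> real) \<times> 'b::euclidean_space"
  defines "J \<equiv> i ` topspace (fst V)"
  assumes cob: "cobordism V (submanifold L) (submanifold L')"
    and emb: "embedding_map (fst V) euclidean i"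
    and \<delta>: "0 < \<delta>" "\<delta> \<le> 1 / 2"
    and left: "{w \<in> J. fst (fst w) < \<delta>} = {((t, 0), l) | t l. t \<in> {0..<\<delta>} \<and> l \<in> L}"
    and right: "{w \<in> J. 1 - fst (fst w) < \<delta>} = {((1 - t, 0), l) | t l. t \<in> {0..<\<delta>} \<and> l \<in> L'}"
    and L: "L \<noteq> {}" "connected L" and L': "L' \<noteq> {}" "connected L'"
    and p: "p \<in> topspace (fst V)" "0 < fst (fst (i p))" "fst (fst (i p)) < 1"
  shows "p \<notin> boundary_points V"
proof
  assume pbd: "p \<in> boundary_points V"
  define X where "X = fst V"
  define bd where "bd = boundary_points V"
  define q where "q p = fst (fst (i p))" for p
  have V: "smooth_manifold half_space V" and cl: "closed_manifold (submanifold L :: ('b, real^2) manifold)"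
      "closed_manifold (submanifold L' :: ('b, real^2) manifold)"
    using cob by (auto simp: cobordism_def compact_manifold_with_boundary_def)
  obtain B1 B2 where B: "B1 \<union> B2 = bd"
    "diffeomorphic (open_submanifold (boundary_manifold V) B1) (submanifold L)"
    "diffeomorphic (open_submanifold (boundary_manifold V) B2) (submanifold L')"
    using cob unfolding cobordism_def bd_def by blast
  have charts: "topspace X = (\<Union>(U, \<phi>)\<in>snd V. U)"
    using V by (simp add: smooth_manifold_def X_def split: prod.splits)
  have bdX: "bd \<subseteq> topspace X" unfolding charts by (auto simp: bd_def boundary_points_def)
  have conn: "connectedin X B"
    if Bbd: "B \<subseteq> bd" and diffeo: "diffeomorphic (open_submanifold (boundary_manifold V) B) (submanifold N :: ('b, real^2) manifold)"
      and N: "connected N"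
    for B and N :: "'b set"
  proof -
    obtain f g where fg: "homeomorphic_maps (subtopology (subtopology X bd) B) (top_of_set N) f g"
      using diffeo by (auto simp: diffeomorphic_def open_submanifold_def boundary_manifold_def submanifold_def X_def bd_def)
    have tB: "topspace (subtopology (subtopology X bd) B) = B" using Bbd bdX by auto
    have "connectedin (top_of_set N) N" using N by (simp add: connectedin_subtopology)
    then have "connectedin (subtopology (subtopology X bd) B) (g ` N)"
      using fg by (auto simp: homeomorphic_maps_def intro: connectedin_continuous_map_image)
    moreover have "g ` N = B"
      using homeomorphic_imp_surjective_map[of "top_of_set N" "subtopology (subtopology X bd) B" g] fg tB
      by (metis homeomorphic_map_maps homeomorphic_maps_sym topspace_euclidean_subtopology)
    ultimately show ?thesis by (simp add: connectedin_subtopology)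
  qed
  have conn1: "connectedin X B1" and conn2: "connectedin X B2"
    using conn[OF _ B(2) L(2)] conn[OF _ B(3) L'(2)] B(1) by auto
  have iX: "continuous_map X euclidean i"
    using emb by (simp add: X_def embedding_map_imp_continuous_map)
  have ends: "B \<subseteq> {p. r (q p) = 0} \<or> B \<inter> {p. r (q p) = 0} = {}"
    if r: "continuous_on UNIV r" "\<And>p. p \<in> bd \<Longrightarrow> r (q p) < \<delta> \<Longrightarrow> r (q p) = 0"
      and B: "B \<subseteq> bd" "connectedin X B" for r :: "real \<Rightarrow> real" and B
  proof -
    have "continuous_on UNIV (\<lambda>w :: (real \<times> real) \<times> 'b. r (fst (fst w)))"
      by (intro continuous_intros continuous_on_compose2[OF r(1)]) auto
    then have "continuous_map X euclidean ((\<lambda>w. r (fst (fst w))) \<circ> i)"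
      by (intro continuous_map_compose[OF iX]) simp
    then have c: "continuous_map X euclidean (\<lambda>p. r (q p))" by (simp add: o_def q_def)
    define E1 where "E1 = {p \<in> topspace X. r (q p) \<in> {..<\<delta>}}"
    define E2 where "E2 = {p \<in> topspace X. r (q p) \<in> - {0}}"
    have "openin X E1" "openin X E2"
      unfolding E1_def E2_def by (rule openin_continuous_map_preimage[OF c]; simp add: open_Compl)+
    moreover have "B \<subseteq> E1 \<union> E2" using B(1) bdX \<delta>(1) by (auto simp: E1_def E2_def)
    moreover have "E1 \<inter> E2 \<inter> B = {}" using B(1) r(2) by (auto simp: E1_def E2_def)
    ultimately have "E1 \<inter> B = {} \<or> E2 \<inter> B = {}"
      using B(2) unfolding connectedin by blast
    moreover have "B \<inter> {p. r (q p) = 0} \<subseteq> E1" "B - {p. r (q p) = 0} \<subseteq> E2"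
      using B(1) bdX \<delta>(1) by (auto simp: E1_def E2_def)
    ultimately show ?thesis by blast
  qed
  have at0: "p \<in> bd \<longleftrightarrow> q p = 0" if "p \<in> topspace X" "q p < \<delta>" for p
  proof -
    have "fst (\<phi> p) = 0 \<longleftrightarrow> q p = 0" if "(U, \<phi>) \<in> snd V" "p \<in> U" for U \<phi>
      using collar_boundary[OF V emb cl(1), of "\<lambda>t. t" \<delta>, folded J_def, OF _ _ left that] \<open>q p < \<delta>\<close>
      by (simp add: q_def)
    then show ?thesis using that(1) unfolding charts by (auto simp: bd_def boundary_points_def)
  qed
  have at1: "p \<in> bd \<longleftrightarrow> 1 - q p = 0" if "p \<in> topspace X" "1 - q p < \<delta>" for p
  proof -
    have "fst (\<phi> p) = 0 \<longleftrightarrow> 1 - q p = 0" if "(U, \<phi>) \<in> snd V" "p \<in> U" for U \<phi>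
      using collar_boundary[OF V emb cl(2), of "\<lambda>t. 1 - t" \<delta>, folded J_def, OF _ _ right that] \<open>1 - q p < \<delta>\<close>
      by (simp add: q_def continuous_intros)
    then show ?thesis using that(1) unfolding charts by (auto simp: bd_def boundary_points_def)
  qed
  have ends0: "B \<subseteq> {p. q p = 0} \<or> B \<inter> {p. q p = 0} = {}" if "B \<subseteq> bd" "connectedin X B" for B
    using ends[of "\<lambda>t. t", OF _ _ that] at0 bdX by auto
  have ends1: "B \<subseteq> {p. 1 - q p = 0} \<or> B \<inter> {p. 1 - q p = 0} = {}" if "B \<subseteq> bd" "connectedin X B" for B
    using ends[of "\<lambda>t. 1 - t", OF _ _ that] at1 bdX by (auto simp: continuous_intros)
  have "\<exists>p0 \<in> bd. q p0 = 0"
  proof -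
    obtain l where "l \<in> L" using L by blast
    then have "((0, 0), l) \<in> {w \<in> J. fst (fst w) < \<delta>}" unfolding left using \<delta> by auto
    then obtain p0 where "p0 \<in> topspace X" "i p0 = ((0, 0), l)" by (auto simp: J_def X_def)
    then show ?thesis using at0[of p0] \<delta> by (intro bexI[of _ p0]) (auto simp: q_def)
  qed
  then obtain p0 where p0: "p0 \<in> bd" "q p0 = 0" by blast
  have "\<exists>p1 \<in> bd. q p1 = 1"
  proof -
    obtain l where "l \<in> L'" using L' by blast
    then have "((1 - 0, 0), l) \<in> {w \<in> J. 1 - fst (fst w) < \<delta>}" unfolding right using \<delta> by fastforce
    then obtain p1 where "p1 \<in> topspace X" "i p1 = ((1, 0), l)" by (auto simp: J_def X_def)
    then show ?thesis using at1[of p1] \<delta> by (intro bexI[of _ p1]) (auto simp: q_def)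
  qed
  then obtain p1 where p1: "p1 \<in> bd" "q p1 = 1" by blast
  have pq: "q p \<noteq> 0" "q p \<noteq> 1" "p \<in> bd" using p pbd by (auto simp: q_def bd_def)
  have "B1 \<subseteq> bd" "B2 \<subseteq> bd" using B(1) by auto
  note * = ends0[OF this(1) conn1] ends0[OF this(2) conn2] ends1[OF this(1) conn1] ends1[OF this(2) conn2]
  from pq(3) B(1) have "p \<in> B1 \<or> p \<in> B2" by blast
  then show False
  proof
    assume "p \<in> B1"
    then have "B1 \<inter> {p. q p = 0} = {}" "B1 \<inter> {p. 1 - q p = 0} = {}" using * pq by auto
    then have "p0 \<in> B2" "p1 \<in> B2" using p0 p1 B(1) by auto
    then show False using * p0 p1 by auto
  next
    assume "p \<in> B2"
    then have "B2 \<inter> {p. q p = 0} = {}" "B2 \<inter> {p. 1 - q p = 0} = {}" using * pq by auto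
    then have "p0 \<in> B1" "p1 \<in> B1" using p0 p1 B(1) by auto
    then show False using * p0 p1 by auto
  qed
qed

lemma connected_antidiagonal: "connected antidiagonal"
proof -
  have "antidiagonal = (\<lambda>x. (x, - x)) ` S2" by (auto simp: antidiagonal_def)
  moreover have "connected ((\<lambda>x :: real^3. (x, - x)) ` S2)"
    by (rule connected_continuous_image) (auto intro!: continuous_intros connected_sphere)
  ultimately show ?thesis by simp
qed

lemma equator_eq_image: "equator = (\<lambda>t. vector [cos t, sin t, 0]) ` UNIV"
proof (intro equalityI subsetI)
  fix x assume x: "x \<in> equator"
  then have "x \<bullet> x = 1" "x $ 3 = 0" by (simp_all add: equator_def norm_eq_sqrt_inner)
  then have "(x $ 1)\<^sup>2 + (x $ 2)\<^sup>2 = 1" by (simp add: inner_vec_def sum_3 power2_eq_square)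
  then obtain t where "x $ 1 = cos t" "x $ 2 = sin t" using sincos_total_2pi by metis
  then have "x = vector [cos t, sin t, 0]" using x by (simp add: vec_eq_iff forall_3 vector_3 equator_def)
  then show "x \<in> (\<lambda>t. vector [cos t, sin t, 0]) ` UNIV" by blast
qed (auto simp: equator_def norm_eq_sqrt_inner inner_vec_def sum_3 vector_3 power2_eq_square[symmetric])

lemma connected_equator: "connected equator"
proof -
  have eq: "(\<lambda>t. vector [cos t, sin t, 0] :: real^3) = (\<lambda>t. cos t *\<^sub>R axis 1 1 + sin t *\<^sub>R axis 2 1)"
    by (auto simp: fun_eq_iff vec_eq_iff forall_3 vector_3 axis_def)
  show ?thesis
    unfolding equator_eq_image eq by (intro connected_continuous_image continuous_intros connected_UNIV)
qed

lemma antidiagonal_not_lagrangian_cobordant_clifford_torus: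
  "\<not> lagrangian_cobordant TYPE(real^2) (S2 \<times> S2) \<Omega> antidiagonal clifford_torus"
proof
  assume "lagrangian_cobordant TYPE(real^2) (S2 \<times> S2) \<Omega> antidiagonal clifford_torus"
  then obtain V :: "(real \<times> (real^2), real \<times> (real^2)) manifold" and i \<epsilon>
    where cob: "cobordism V (submanifold antidiagonal) (submanifold clifford_torus)"
      and emb: "lagrangian_embedding_strip V (S2 \<times> S2) \<Omega> i" and \<epsilon>: "0 < \<epsilon>"
      and left: "i ` topspace (fst V) \<inter> ({0..<\<epsilon>} \<times> UNIV) \<times> (S2 \<times> S2) = ({0..<\<epsilon>} \<times> {0}) \<times> antidiagonal"
      and right: "i ` topspace (fst V) \<inter> ({1-\<epsilon><..1} \<times> UNIV) \<times> (S2 \<times> S2) = ({1-\<epsilon><..1} \<times> {0}) \<times> clifford_torus"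
    unfolding lagrangian_cobordant_def by (elim exE conjE) (rule that; assumption)
  define J where "J = i ` topspace (fst V)"
  define \<delta> where "\<delta> = min \<epsilon> (1 / 2)"
  have \<delta>: "0 < \<delta>" "\<delta> \<le> 1 / 2" "\<delta> \<le> \<epsilon>" using \<epsilon> by (auto simp: \<delta>_def)
  have i: "embedding_map (fst V) euclidean i" and J: "J \<subseteq> ({0..1} \<times> UNIV) \<times> (S2 \<times> S2)"
    and smooth: "\<And>U \<phi>. (U, \<phi>) \<in> snd V \<Longrightarrow> smooth_on (\<phi> ` U) (i \<circ> inv_into U \<phi>)"
    using emb by (auto simp: lagrangian_embedding_strip_def J_def)
  have V: "smooth_manifold half_space V" and "compact_space (fst V)"
    using cob by (auto simp: cobordism_def compact_manifold_with_boundary_def)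
  then have "compactin (fst V) (topspace (fst V))" by (simp add: compact_space_def)
  then have "compactin euclidean J"
    unfolding J_def by (rule image_compactin[OF _ embedding_map_imp_continuous_map[OF i]])
  then have cJ: "compact J" by simp
  have left\<delta>: "J \<inter> ({0..<\<delta>} \<times> UNIV) \<times> (S2 \<times> S2) = ({0..<\<delta>} \<times> {0}) \<times> antidiagonal"
  proof -
    have "J \<inter> ({0..<\<delta>} \<times> UNIV) \<times> (S2 \<times> S2) = (({0..<\<epsilon>} \<times> {0}) \<times> antidiagonal) \<inter> (({0..<\<delta>} \<times> UNIV) \<times> UNIV)"
      unfolding left[symmetric] J_def using \<delta> by auto
    then show ?thesis using \<delta> by auto
  qed
  have right\<delta>: "J \<inter> ({1-\<delta><..1} \<times> UNIV) \<times> (S2 \<times> S2) = ({1-\<delta><..1} \<times> {0}) \<times> clifford_torus"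
  proof -
    have "J \<inter> ({1-\<delta><..1} \<times> UNIV) \<times> (S2 \<times> S2) = (({1-\<epsilon><..1} \<times> {0}) \<times> clifford_torus) \<inter> (({1-\<delta><..1} \<times> UNIV) \<times> UNIV)"
      unfolding right[symmetric] J_def using \<delta> by auto
    then show ?thesis using \<delta> by auto
  qed
  have l: "{w \<in> J. fst (fst w) < \<delta>} = {((t, 0), l) | t l. t \<in> {0..<\<delta>} \<and> l \<in> antidiagonal}"
  proof -
    have "{w \<in> J. fst (fst w) < \<delta>} = J \<inter> ({0..<\<delta>} \<times> UNIV) \<times> (S2 \<times> S2)" using J by auto
    then show ?thesis unfolding left\<delta> by auto
  qed
  have r: "{w \<in> J. 1 - fst (fst w) < \<delta>} = {((1 - t, 0), l) | t l. t \<in> {0..<\<delta>} \<and> l \<in> clifford_torus}"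
  proof -
    have "{w \<in> J. 1 - fst (fst w) < \<delta>} = J \<inter> ({1-\<delta><..1} \<times> UNIV) \<times> (S2 \<times> S2)" using J by auto
    also have "\<dots> = {((1 - t, 0), l) | t l. t \<in> {0..<\<delta>} \<and> l \<in> clifford_torus}"
      unfolding right\<delta>
    proof (intro equalityI subsetI)
      fix w :: "(real \<times> real) \<times> (real^3) \<times> (real^3)" assume "w \<in> ({1-\<delta><..1} \<times> {0}) \<times> clifford_torus"
      then show "w \<in> {((1 - t, 0), l) | t l. t \<in> {0..<\<delta>} \<and> l \<in> clifford_torus}"
        by (intro CollectI exI[of _ "1 - fst (fst w)"] exI[of _ "snd w"]) (auto simp: prod_eq_iff)
    qed auto
    finally show ?thesis .
  qed
  show False
  proof (rule no_embedded_cobordism[OF cJ J \<delta>(1,2) left\<delta>])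
    fix w assume w: "w \<in> J" "1 - \<delta> < fst (fst w)"
    then have "w \<in> J \<inter> ({1-\<delta><..1} \<times> UNIV) \<times> (S2 \<times> S2)" using J by auto
    then show "snd (snd w) $ 3 = 0" unfolding right\<delta> by (auto simp: clifford_torus_def equator_def)
  next
    fix w assume w: "w \<in> J" "0 < fst (fst w)" "fst (fst w) < 1"
    then obtain p where p: "p \<in> topspace (fst V)" "w = i p" by (auto simp: J_def)
    have "antidiagonal \<noteq> {}" using vector_choose_size[of 1] by (auto simp: antidiagonal_def)
    moreover have "clifford_torus \<noteq> {}" by (simp add: clifford_torus_def equator_eq_image)
    moreover have "connected clifford_torus"
      unfolding clifford_torus_def by (intro connected_Times connected_equator)
    ultimately have nb: "p \<notin> boundary_points V"
      using interior_of_strip_is_interior[OF cob i \<delta>(1,2), folded J_def, OF l r _ connected_antidiagonal _ _ p(1)]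
        w p(2) by simp
    obtain U \<phi> where U: "(U, \<phi>) \<in> snd V" "p \<in> U"
      using V p(1) by (auto simp: smooth_manifold_def split: prod.splits)
    have "\<phi> p \<in> half_space"
      using openin_imp_subset[OF chart_homeomorphism(2)[OF V i U(1)]] U(2) by blast
    then have "0 < fst (\<phi> p)"
      using nb U by (force simp: boundary_points_def half_space_def)
    from interior_chart_imp_C2_chart_at[OF V i U(1) smooth[OF U(1)] U(2) this]
    show "C2_chart_at J w" by (simp add: J_def p(2))
  qed
qed

theorem mainTheorem5:
  fixes c :: real
  assumes "c \<noteq> 0"
  shows "cobordant (submanifold antidiagonal :: ((real^3) \<times> (real^3), real^2) manifold)
                   (submanifold clifford_torus) \<and>
         \<not> lagrangian_cobordant TYPE(real^2) (S2 \<times> S2) (sum_form (area_form c) (area_form c))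
             antidiagonal clifford_torus"
  using antidiagonal_cobordant_clifford_torus antidiagonal_not_lagrangian_cobordant_clifford_torus
  by blast

end
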